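(* Let $\rho\in(0,1)$ and $c\in\mathbb{R}\setminus\{0\}$, let $(a_n)$, $(b_n)$ be sequences of positive integers with $a_n+b_n=2n$ and $\frac{a_n}{2n}=\rho+o(n^{-1/2})$, and let $X$ have the law induced by $\mathbb{P}^{e^{-c/n}}_{a_n,b_n}$. Let $$\tilde X^{(n)}_t=\sqrt n\Bigl(\frac{1}{2n}X_{2nt}-L_{\rho,c}(t)\Bigr),\qquad t\in[0,1],$$ $$f(s)=\frac{1}{\sqrt2}\,\frac{\sqrt{(e^{2c\rho}-1)(1-e^{-2c(1-\rho)})}}{\sinh(cs)+e^{c(2\rho-1)}\sinh(c(1-s))},\qquad s\in[0,1].$$ Then, as $n\to\infty$, the processes $(\tilde X^{(n)}_s/f(s))_{s\in[0,1]}$ converge weakly in $D$ to the Ornstein–Uhlenbeck bridge $(Y_s)_{s\in[0,1]}$, i.e. the centered Gaussian process on $[0,1]$ with covariance $$\mathbb{E}[Y_sY_t]=\frac{\sinh(cs)\sinh(c(1-t))}{c\sinh(c)},\qquad 0\le s<t\le1 .$$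
   Context: For positive integers $a,b$ and $q>0$, $\mathbb{P}^q_{a,b}$ is the probability measure on Young diagrams (partitions) $\pi$ fitting in the box $[0,a]\times[0,b]$ (at most $a$ parts, each at most $b$) given by $\mathbb{P}^q_{a,b}(\pi)=q^{|\pi|}/Z_{a,b}(q)$, where $|\pi|$ is the number of unit squares of $\pi$ and $Z_{a,b}(q)=\sum_\pi q^{|\pi|}$. The boundary of $\pi$ is encoded as a lattice path $(X_k)_{0\le k\le a+b}$ with $X_0=0$, $X_{a+b}=b-a$, $X_{k+1}-X_k\in\{+1,-1\}$ (so $b$ up-steps and $a$ down-steps). The diagram consists of the unit cells lying between this path and the lower boundary of the bounding rectangle (the path with $a$ down-steps followed by $b$ up-steps); thus $|\pi|$ is the number of pairs consisting of an up-step and a later down-step. Every such path corresponds to exactly one $\pi$. The path is extended to a continuous piecewise linear function $s\mapsto X_s$ on $[0,a+b]$, linear between consecutive integers. The limit shape is $L_{\rho,c}(t)=1-2\rho+\frac1c\log\frac{\sinh(ct)+e^{c(2\rho-1)}\sinh(c(1-t))}{\sinh c}$ for $t\in[0,1]$. $D$ is the space of càdlàg paths on $[0,1]$ with its usual (Skorokhod) topology. *)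

theory Defs
  imports "HOL-Probability.Probability" "HOL-Library.Landau_Symbols"
begin

section \<open>Young diagrams in a box and their boundary paths\<close>

text \<open>A diagram with at most \<open>a\<close> parts, each at most \<open>b\<close>, is the list of its row lengths in
  weakly decreasing order, padded with zeros to length \<open>a\<close>.\<close>

definition young_diagrams :: "nat \<Rightarrow> nat \<Rightarrow> nat list set" where
  "young_diagrams a b = {p. length p = a \<and> sorted_wrt (\<ge>) p \<and> (\<forall>x\<in>set p. x \<le> b)}"

definition diagram_size :: "nat list \<Rightarrow> nat" where
  "diagram_size p = sum_list p"

definition partition_function :: "real \<Rightarrow> nat \<Rightarrow> nat \<Rightarrow> real" where
  "partition_function q a b = (\<Sum>p\<in>young_diagrams a b. q ^ diagram_size p)"

definition q_volume :: "real \<Rightarrow> nat \<Rightarrow> nat \<Rightarrow> nat list measure" where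
  "q_volume q a b =
     point_measure (young_diagrams a b) (\<lambda>p. ennreal (q ^ diagram_size p / partition_function q a b))"

text \<open>Each row of the diagram corresponds to one down-step of the boundary path, and the length of
  the row is the number of up-steps before that down-step. The down-step of row \<open>i\<close> (counted
  from 0) is also preceded by the down-steps of the \<open>a - 1 - i\<close> rows with larger index. Step
  \<open>j\<close> goes from \<open>X j\<close> to \<open>X (j + 1)\<close>.\<close>

definition down_step :: "nat list \<Rightarrow> nat \<Rightarrow> nat" where
  "down_step p i = p ! i + (length p - 1 - i)"

definition down_steps :: "nat list \<Rightarrow> nat set" where
  "down_steps p = down_step p ` {..<length p}"

definition boundary_path :: "nat list \<Rightarrow> nat \<Rightarrow> int" where
  "boundary_path p k = (\<Sum>j<k. if j \<in> down_steps p then - 1 else 1)"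

lemma finite_young_diagrams: "finite (young_diagrams a b)"
proof -
  have "young_diagrams a b \<subseteq> {p. set p \<subseteq> {..b} \<and> length p = a}"
    by (auto simp: young_diagrams_def)
  then show ?thesis
    using finite_lists_length_eq[of "{..b}" a] finite_subset by blast
qed

lemma young_diagrams_nonempty: "young_diagrams a b \<noteq> {}"
proof -
  have "replicate a 0 \<in> young_diagrams a b"
    by (auto simp: young_diagrams_def sorted_wrt_iff_nth_less)
  then show ?thesis by blast
qed

lemma partition_function_pos: "q > 0 \<Longrightarrow> partition_function q a b > 0"
  unfolding partition_function_def
  by (intro sum_pos finite_young_diagrams young_diagrams_nonempty) auto

lemma prob_space_q_volume:
  assumes "q > 0"
  shows "prob_space (q_volume q a b)"
proof
  have "emeasure (q_volume q a b) (space (q_volume q a b))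
      = (\<Sum>p\<in>young_diagrams a b. ennreal (q ^ diagram_size p / partition_function q a b))"
    by (simp add: q_volume_def space_point_measure emeasure_point_measure_finite
        finite_young_diagrams)
  also have "\<dots> = ennreal (\<Sum>p\<in>young_diagrams a b. q ^ diagram_size p / partition_function q a b)"
    using assms partition_function_pos[OF assms, of a b] by (intro sum_ennreal) auto
  also have "(\<Sum>p\<in>young_diagrams a b. q ^ diagram_size p / partition_function q a b)
      = partition_function q a b / partition_function q a b"
    unfolding partition_function_def by (rule sum_divide_distrib[symmetric])
  finally show "emeasure (q_volume q a b) (space (q_volume q a b)) = 1"
    using partition_function_pos[OF assms, of a b] by simp
qed

lemma measurable_q_volume: "f \<in> q_volume q a b \<rightarrow>\<^sub>M borel"
  for f :: "nat list \<Rightarrow> 'b :: topological_space"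
  by (simp add: q_volume_def measurable_def space_point_measure sets_point_measure)

lemma down_step_less:
  assumes "p \<in> young_diagrams a b" "i < j" "j < a"
  shows "down_step p j < down_step p i"
proof -
  have "p ! j \<le> p ! i" "length p = a"
    using assms by (auto simp: young_diagrams_def sorted_wrt_iff_nth_less)
  then show ?thesis using assms by (simp add: down_step_def)
qed

lemma inj_on_down_step:
  assumes "p \<in> young_diagrams a b"
  shows "inj_on (down_step p) {..<a}"
proof (rule inj_onI)
  fix i j assume "i \<in> {..<a}" "j \<in> {..<a}" "down_step p i = down_step p j"
  then show "i = j"
    using down_step_less[OF assms, of i j] down_step_less[OF assms, of j i]
    by (cases i j rule: linorder_cases) auto
qed

lemma down_steps_subset:
  assumes "p \<in> young_diagrams a b"
  shows "down_steps p \<subseteq> {..<a + b}"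
proof -
  have "down_step p i < a + b" if "i < a" for i
  proof -
    have "p ! i \<le> b" "length p = a"
      using assms that by (auto simp: young_diagrams_def)
    then show ?thesis using that by (simp add: down_step_def)
  qed
  then show ?thesis using assms by (auto simp: down_steps_def young_diagrams_def)
qed

lemma card_down_steps:
  assumes "p \<in> young_diagrams a b"
  shows "card (down_steps p) = a"
  using inj_on_down_step[OF assms] assms
  by (simp add: down_steps_def young_diagrams_def card_image)

lemma boundary_path_0: "boundary_path p 0 = 0"
  by (simp add: boundary_path_def)

lemma boundary_path_end:
  assumes "p \<in> young_diagrams a b"
  shows "boundary_path p (a + b) = int b - int a"
proof -
  have "boundary_path p (a + b)
      = (\<Sum>j<a + b. 1 - 2 * (if j \<in> down_steps p then 1 else 0))"
    unfolding boundary_path_def by (intro sum.cong) auto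
  also have "\<dots> = int (a + b) - 2 * (\<Sum>j<a + b. if j \<in> down_steps p then 1 else 0)"
    by (simp add: sum_subtractf sum_distrib_left del: of_nat_add)
  also have "(\<Sum>j<a + b. if j \<in> down_steps p then 1 else (0::int)) = int (card (down_steps p))"
    using down_steps_subset[OF assms] by (simp add: sum.If_cases Int_absorb1)
  finally show ?thesis by (simp add: card_down_steps[OF assms])
qed

lemma card_up_steps_before:
  assumes "p \<in> young_diagrams a b" "i < a"
  shows "card {k. k < down_step p i \<and> k \<notin> down_steps p} = p ! i"
proof -
  have len: "length p = a" using assms by (simp add: young_diagrams_def)
  have "down_steps p \<inter> {..<down_step p i} = down_step p ` {i<..<a}" (is "?L = ?R")
  proof
    show "?L \<subseteq> ?R"
    proof
      fix k assume k: "k \<in> ?L"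
      then obtain j where j: "j < a" "k = down_step p j" "down_step p j < down_step p i"
        by (auto simp: down_steps_def len)
      then have "i < j"
        using down_step_less[OF assms(1), of j i] assms(2)
        by (cases i j rule: linorder_cases) auto
      then show "k \<in> ?R" using j by auto
    qed
    show "?R \<subseteq> ?L"
      using down_step_less[OF assms(1)] by (auto simp: down_steps_def len)
  qed
  then have "card (down_steps p \<inter> {..<down_step p i}) = card (down_step p ` {i<..<a})"
    by simp
  also have "\<dots> = a - 1 - i"
    by (subst card_image) (auto intro: inj_on_subset[OF inj_on_down_step[OF assms(1)]])
  finally have c: "card (down_steps p \<inter> {..<down_step p i}) = a - 1 - i" .
  have "{k. k < down_step p i \<and> k \<notin> down_steps p}
      = {..<down_step p i} - down_steps p \<inter> {..<down_step p i}" by auto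
  then have "card {k. k < down_step p i \<and> k \<notin> down_steps p} = down_step p i - (a - 1 - i)"
    using c by (simp add: card_Diff_subset)
  then show ?thesis by (simp add: down_step_def len)
qed

lemma diagram_size_eq_card:
  assumes "p \<in> young_diagrams a b"
  shows "diagram_size p = card {(k, j). k < j \<and> k \<notin> down_steps p \<and> j \<in> down_steps p}"
proof -
  have len: "length p = a" using assms by (simp add: young_diagrams_def)
  have "{(k, j). k < j \<and> k \<notin> down_steps p \<and> j \<in> down_steps p}
      = prod.swap ` (SIGMA j:down_steps p. {k. k < j \<and> k \<notin> down_steps p})" by auto
  then have "card {(k, j). k < j \<and> k \<notin> down_steps p \<and> j \<in> down_steps p}
      = card (SIGMA j:down_steps p. {k. k < j \<and> k \<notin> down_steps p})"
    by (simp add: card_image)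
  also have "\<dots> = (\<Sum>j\<in>down_steps p. card {k. k < j \<and> k \<notin> down_steps p})"
    by (rule card_SigmaI) (auto simp: down_steps_def)
  also have "\<dots> = (\<Sum>i<a. card {k. k < down_step p i \<and> k \<notin> down_steps p})"
    using inj_on_down_step[OF assms] by (simp add: down_steps_def len sum.reindex)
  also have "\<dots> = (\<Sum>i<a. p ! i)"
    using card_up_steps_before[OF assms] by (intro sum.cong) auto
  finally show ?thesis
    by (simp add: diagram_size_def sum_list_sum_nth len lessThan_atLeast0)
qed

lemma bij_betw_down_steps:
  "bij_betw down_steps (young_diagrams a b) {S. S \<subseteq> {..<a + b} \<and> card S = a}"
  unfolding bij_betw_def
proof
  show "inj_on down_steps (young_diagrams a b)"
  proof (rule inj_onI)
    fix p r assume p: "p \<in> young_diagrams a b" and r: "r \<in> young_diagrams a b"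
      and eq: "down_steps p = down_steps r"
    have rev_eq: "rev (map (down_step s) [0..<a]) = sorted_list_of_set (down_steps s)"
      if s: "s \<in> young_diagrams a b" for s
    proof -
      have "sorted_wrt (<) (rev (map (down_step s) [0..<a]))"
        unfolding sorted_wrt_rev using down_step_less[OF s] by (simp add: sorted_wrt_iff_nth_less)
      moreover have "set (rev (map (down_step s) [0..<a])) = down_steps s"
        using s by (auto simp: down_steps_def young_diagrams_def)
      ultimately show ?thesis
        by (metis sorted_list_of_set.idem_if_sorted_distinct strict_sorted_iff)
    qed
    have "map (down_step p) [0..<a] = map (down_step r) [0..<a]"
      using rev_eq[OF p] rev_eq[OF r] eq by (metis rev_rev_ident)
    then have "down_step p i = down_step r i" if "i < a" for i
      using that by simp
    moreover have "length p = a" "length r = a"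
      using p r by (auto simp: young_diagrams_def)
    ultimately have "p ! i = r ! i" if "i < a" for i
      using that by (metis down_step_def add_right_cancel)
    then show "p = r"
      using p r by (auto simp: young_diagrams_def intro: nth_equalityI)
  qed
  show "down_steps ` young_diagrams a b = {S. S \<subseteq> {..<a + b} \<and> card S = a}"
  proof
    show "down_steps ` young_diagrams a b \<subseteq> {S. S \<subseteq> {..<a + b} \<and> card S = a}"
      using down_steps_subset card_down_steps by blast
    show "{S. S \<subseteq> {..<a + b} \<and> card S = a} \<subseteq> down_steps ` young_diagrams a b"
    proof
      fix S assume "S \<in> {S. S \<subseteq> {..<a + b} \<and> card S = a}"
      then have S: "S \<subseteq> {..<a + b}" "card S = a" "finite S"
        using finite_subset by auto
      define xs where "xs = sorted_list_of_set S"
      have len: "length xs = a" and xs_set: "set xs = S" and srt: "sorted_wrt (<) xs"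
        using S by (auto simp: xs_def)
      have ge: "xs ! i + (j - i) \<le> xs ! j" if "i \<le> j" "j < a" for i j
        using that
      proof (induction j rule: dec_induct)
        case (step m)
        then have "xs ! m < xs ! Suc m"
          using srt len by (simp add: sorted_wrt_iff_nth_less)
        then show ?case using step by (simp add: Suc_diff_le)
      qed simp
      define p where "p = map (\<lambda>i. xs ! (a - 1 - i) - (a - 1 - i)) [0..<a]"
      have lp: "length p = a" by (simp add: p_def)
      have ge0: "j \<le> xs ! j" if "j < a" for j
        using ge[of 0 j] that by simp
      have ds: "down_step p i = xs ! (a - 1 - i)" if "i < a" for i
        using that ge0[of "a - 1 - i"] by (simp add: down_step_def lp p_def)
      have "p \<in> young_diagrams a b"
        unfolding young_diagrams_def mem_Collect_eq
      proof (intro conjI lp ballI)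
        show "sorted_wrt (\<ge>) p"
          unfolding sorted_wrt_iff_nth_less lp
        proof (intro allI impI)
          fix i j assume ij: "i < j" "j < a"
          have "xs ! (a - 1 - j) + ((a - 1 - i) - (a - 1 - j)) \<le> xs ! (a - 1 - i)"
            using ij by (intro ge) auto
          then show "p ! j \<le> p ! i" using ij by (simp add: p_def)
        qed
        fix x assume "x \<in> set p"
        then obtain i where i: "i < a" "x = xs ! (a - 1 - i) - (a - 1 - i)"
          unfolding p_def by auto
        define k where "k = a - 1 - i"
        have k: "k < a" "x = xs ! k - k" using i by (auto simp: k_def)
        have "xs ! (a - 1) \<in> S" using k xs_set len by (metis diff_less nth_mem less_nat_zero_code
              neq0_conv zero_less_one)
        then have "xs ! (a - 1) < a + b" using S by auto
        then show "x \<le> b" using ge[of k "a - 1"] k by linarith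
      qed
      moreover have "down_steps p = S"
      proof -
        have "down_steps p = (\<lambda>i. xs ! (a - 1 - i)) ` {..<a}"
          unfolding down_steps_def lp by (intro image_cong) (auto simp: ds)
        also have "\<dots> = (!) xs ` ((\<lambda>i. a - 1 - i) ` {..<a})" by (simp add: image_image)
        also have "(\<lambda>i. a - 1 - i) ` {..<a} = {..<a}"
        proof
          show "{..<a} \<subseteq> (\<lambda>i. a - 1 - i) ` {..<a}"
          proof
            fix k assume "k \<in> {..<a}"
            then show "k \<in> (\<lambda>i. a - 1 - i) ` {..<a}"
              by (intro image_eqI[of _ _ "a - 1 - k"]) auto
          qed
        qed auto
        also have "(!) xs ` {..<a} = S"
          using xs_set len by (auto simp: set_conv_nth)
        finally show ?thesis .
      qed
      ultimately show "S \<in> down_steps ` young_diagrams a b" by blast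
    qed
  qed
qed

definition linear_interpolation :: "(nat \<Rightarrow> int) \<Rightarrow> real \<Rightarrow> real" where
  "linear_interpolation x s =
     (let k = nat \<lfloor>s\<rfloor> in of_int (x k) + (s - real k) * of_int (x (k + 1) - x k))"

text \<open>At the right endpoint \<open>s = a + b\<close> the value \<open>x (a + b + 1)\<close> is multiplied by zero.\<close>

section \<open>The space of cadlag paths on the unit interval\<close>

text \<open>Paths are functions on \<open>{0..1}\<close>; being extensional, they are determined by their values
  there. One-sided limits at \<open>0\<close> from the left and at \<open>1\<close> from the right
  are not constrained.\<close>

definition is_cadlag :: "(real \<Rightarrow> real) \<Rightarrow> bool" where
  "is_cadlag x \<longleftrightarrow>
     (\<forall>t\<in>{0..<1}. (x \<longlongrightarrow> x t) (at_right t)) \<and>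
     (\<forall>t\<in>{0<..1}. \<exists>l. (x \<longlongrightarrow> l) (at_left t))"

lemma at_right_eq_within_01: "t \<in> {0..<1} \<Longrightarrow> at_right t = at t within {t<..<1::real}"
  by (intro at_within_nhd[of t "{..<1}"]) auto

lemma at_left_eq_within_01: "t \<in> {0<..1} \<Longrightarrow> at_left t = at t within {0<..<t::real}"
  by (intro at_within_nhd[of t "{0<..}"]) auto

lemma is_cadlag_continuous_on:
  assumes "continuous_on {0..1} x"
  shows "is_cadlag x"
  unfolding is_cadlag_def
proof (intro conjI ballI)
  fix t :: real assume t: "t \<in> {0..<1}"
  have "(x \<longlongrightarrow> x t) (at t within {0..1})"
    using assms t by (auto simp: continuous_on_def)
  then show "(x \<longlongrightarrow> x t) (at_right t)"
    unfolding at_right_eq_within_01[OF t] by (rule tendsto_within_subset) (use t in auto)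
next
  fix t :: real assume t: "t \<in> {0<..1}"
  have "(x \<longlongrightarrow> x t) (at t within {0..1})"
    using assms t by (auto simp: continuous_on_def)
  then have "(x \<longlongrightarrow> x t) (at_left t)"
    unfolding at_left_eq_within_01[OF t] by (rule tendsto_within_subset) (use t in auto)
  then show "\<exists>l. (x \<longlongrightarrow> l) (at_left t)" ..
qed

lemma is_cadlag_cong:
  assumes "\<And>t. t \<in> {0..1} \<Longrightarrow> x t = y t"
  shows "is_cadlag x \<longleftrightarrow> is_cadlag y"
proof -
  have r: "((x \<longlongrightarrow> l) (at_right t)) = ((y \<longlongrightarrow> l) (at_right t))" if "t \<in> {0..<1}" for t l
    unfolding at_right_eq_within_01[OF that]
    by (intro filterlim_cong refl) (use that assms in \<open>auto simp: eventually_at_filter\<close>)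
  have l: "((x \<longlongrightarrow> l) (at_left t)) = ((y \<longlongrightarrow> l) (at_left t))" if "t \<in> {0<..1}" for t l
    unfolding at_left_eq_within_01[OF that]
    by (intro filterlim_cong refl) (use that assms in \<open>auto simp: eventually_at_filter\<close>)
  show ?thesis
    unfolding is_cadlag_def using r l assms by auto
qed

typedef cadlag = "{x. is_cadlag x \<and> x \<in> extensional {0..1::real}}"
  morphisms path_of Cadlag
proof
  show "restrict (\<lambda>_. 0) {0..1} \<in> {x. is_cadlag x \<and> x \<in> extensional {0..1::real}}"
    using is_cadlag_cong[of "restrict (\<lambda>_. 0) {0..1}" "\<lambda>_. 0"]
      is_cadlag_continuous_on[of "\<lambda>_. 0"] by auto
qed

definition to_cadlag :: "(real \<Rightarrow> real) \<Rightarrow> cadlag" where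
  "to_cadlag x = Cadlag (restrict x {0..1})"

lemma path_to_cadlag:
  assumes "is_cadlag x" "t \<in> {0..1}"
  shows "path_of (to_cadlag x) t = x t"
proof -
  have "is_cadlag (restrict x {0..1})"
    using is_cadlag_cong[of "restrict x {0..1}" x] assms(1) by simp
  then show ?thesis
    using assms(2) by (simp add: to_cadlag_def Cadlag_inverse)
qed

lemma is_cadlag_path: "is_cadlag (path_of x)"
  using path_of by auto

lemma cadlag_eqI:
  assumes "\<And>t. t \<in> {0..1} \<Longrightarrow> path_of x t = path_of y t"
  shows "x = y"
proof -
  have "path_of x = path_of y"
    using path_of[of x] path_of[of y] assms by (intro extensionalityI[of _ "{0..1}"]) auto
  then show ?thesis by (simp add: path_of_inject)
qed

lemma path_locally_bounded:
  assumes "t \<in> {0..1::real}"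
  shows "\<exists>e>0. \<exists>B. \<forall>s\<in>{0..1}. \<bar>s - t\<bar> < e \<longrightarrow> \<bar>path_of x s\<bar> \<le> B"
proof -
  have R: "\<exists>e>0. \<exists>B. \<forall>s\<in>{0..1}. t < s \<and> s < t + e \<longrightarrow> \<bar>path_of x s\<bar> \<le> B"
  proof (cases "t < 1")
    case True
    then have "(path_of x \<longlongrightarrow> path_of x t) (at_right t)"
      using is_cadlag_path[of x] assms by (auto simp: is_cadlag_def)
    then have "eventually (\<lambda>s. dist (path_of x s) (path_of x t) < 1) (at_right t)"
      by (rule tendstoD) simp
    then obtain u where u: "u > t" "\<And>s. t < s \<Longrightarrow> s < u \<Longrightarrow> dist (path_of x s) (path_of x t) < 1"
      by (auto simp: eventually_at_right_field)
    show ?thesis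
      by (intro exI[of _ "u - t"] exI[of _ "\<bar>path_of x t\<bar> + 1"] conjI ballI impI)
         (use u in \<open>force simp: dist_real_def\<close>)+
  next
    case False
    then show ?thesis by (intro exI[of _ 1]) auto
  qed
  have L: "\<exists>e>0. \<exists>B. \<forall>s\<in>{0..1}. s < t \<and> t - e < s \<longrightarrow> \<bar>path_of x s\<bar> \<le> B"
  proof (cases "t > 0")
    case True
    then obtain l where "(path_of x \<longlongrightarrow> l) (at_left t)"
      using is_cadlag_path[of x] assms by (force simp: is_cadlag_def)
    then have "eventually (\<lambda>s. dist (path_of x s) l < 1) (at_left t)"
      by (rule tendstoD) simp
    then obtain u where u: "u < t" "\<And>s. u < s \<Longrightarrow> s < t \<Longrightarrow> dist (path_of x s) l < 1"
      by (auto simp: eventually_at_left_field)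
    show ?thesis
      by (intro exI[of _ "t - u"] exI[of _ "\<bar>l\<bar> + 1"] conjI ballI impI)
         (use u in \<open>force simp: dist_real_def\<close>)+
  next
    case False
    then show ?thesis by (intro exI[of _ 1]) auto
  qed
  from R obtain e B where eB: "e > 0"
    "\<And>s. s \<in> {0..1} \<Longrightarrow> t < s \<Longrightarrow> s < t + e \<Longrightarrow> \<bar>path_of x s\<bar> \<le> B" by blast
  from L obtain d C where dC: "d > 0"
    "\<And>s. s \<in> {0..1} \<Longrightarrow> s < t \<Longrightarrow> t - d < s \<Longrightarrow> \<bar>path_of x s\<bar> \<le> C" by blast
  have "\<bar>path_of x s\<bar> \<le> max (max B C) \<bar>path_of x t\<bar>" if "s \<in> {0..1}" "\<bar>s - t\<bar> < min e d" for s
  proof (cases s t rule: linorder_cases)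
    case less
    then show ?thesis using dC(2)[of s] that by auto
  next
    case greater
    then show ?thesis using eB(2)[of s] that by auto
  qed auto
  then show ?thesis using eB(1) dC(1) by (metis min_less_iff_conj)
qed

lemma path_bounded: "\<exists>B. \<forall>t\<in>{0..1}. \<bar>path_of x t\<bar> \<le> B"
proof -
  have "\<forall>t\<in>{0..1}. \<exists>e B. e > 0 \<and> (\<forall>s\<in>{0..1}. \<bar>s - t\<bar> < e \<longrightarrow> \<bar>path_of x s\<bar> \<le> B)"
    using path_locally_bounded by blast
  then obtain e B where eB: "\<And>t. t \<in> {0..1} \<Longrightarrow> e t > 0"
    "\<And>t s. t \<in> {0..1} \<Longrightarrow> s \<in> {0..1} \<Longrightarrow> \<bar>s - t\<bar> < e t \<Longrightarrow> \<bar>path_of x s\<bar> \<le> B t"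
    by metis
  have "compact {0..1::real}" by simp
  moreover have "{0..1} \<subseteq> (\<Union>t\<in>{0..1}. ball t (e t))"
    using eB(1) by force
  ultimately obtain T where T: "T \<subseteq> {0..1}" "finite T" "{0..1} \<subseteq> (\<Union>t\<in>T. ball t (e t))"
    using compactE_image[of "{0..1}" "{0..1}" "\<lambda>t. ball t (e t)"] by (metis open_ball)
  have "\<bar>path_of x s\<bar> \<le> (\<Sum>t\<in>T. \<bar>B t\<bar>)" if s: "s \<in> {0..1}" for s
  proof -
    obtain t where t: "t \<in> T" "dist t s < e t" using T(3) s by auto
    then have "\<bar>path_of x s\<bar> \<le> B t"
      using eB(2)[of t s] T(1) s by (auto simp: dist_real_def abs_minus_commute)
    also have "\<dots> \<le> \<bar>B t\<bar>" by simp
    also have "\<dots> \<le> (\<Sum>t\<in>T. \<bar>B t\<bar>)"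
      using t T(2) by (intro member_le_sum) auto
    finally show ?thesis .
  qed
  then show ?thesis by blast
qed

definition time_changes :: "(real \<Rightarrow> real) set" where
  "time_changes =
     {l. strict_mono_on {0..1} l \<and> continuous_on {0..1} l \<and> l ` {0..1} = {0..1}}"

definition skorokhod_close :: "real \<Rightarrow> cadlag \<Rightarrow> cadlag \<Rightarrow> bool" where
  "skorokhod_close e x y \<longleftrightarrow>
     (\<exists>l\<in>time_changes. \<forall>t\<in>{0..1}. \<bar>l t - t\<bar> \<le> e \<and> \<bar>path_of x t - path_of y (l t)\<bar> \<le> e)"

lemma time_changes_id: "(\<lambda>t. t) \<in> time_changes"
  by (auto simp: time_changes_def strict_mono_on_def)

lemma time_changes_in: "l \<in> time_changes \<Longrightarrow> t \<in> {0..1} \<Longrightarrow> l t \<in> {0..1}"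
  unfolding time_changes_def by blast

lemma time_changes_comp:
  assumes "l \<in> time_changes" "m \<in> time_changes"
  shows "(\<lambda>t. m (l t)) \<in> time_changes"
proof -
  have l: "strict_mono_on {0..1} l" "continuous_on {0..1} l" "l ` {0..1} = {0..1}"
    and m: "strict_mono_on {0..1} m" "continuous_on {0..1} m" "m ` {0..1} = {0..1}"
    using assms by (auto simp: time_changes_def)
  have "strict_mono_on {0..1} (\<lambda>t. m (l t))"
    using l(1) m(1) time_changes_in[OF assms(1)] by (simp add: strict_mono_on_def)
  moreover have "continuous_on {0..1} (\<lambda>t. m (l t))"
    using continuous_on_compose2[OF m(2) l(2)] l(3) by simp
  moreover have "(\<lambda>t. m (l t)) ` {0..1} = {0..1}"
    using l(3) m(3) by (metis image_image)
  ultimately show ?thesis by (simp add: time_changes_def)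
qed

lemma time_changes_inverse:
  assumes "l \<in> time_changes"
  obtains m where "m \<in> time_changes" "\<And>t. t \<in> {0..1} \<Longrightarrow> l (m t) = t"
proof -
  have l: "strict_mono_on {0..1} l" "continuous_on {0..1} l" "l ` {0..1} = {0..1}"
    using assms by (auto simp: time_changes_def)
  define m where "m = the_inv_into {0..1} l"
  have inj: "inj_on l {0..1}" using l(1) strict_mono_on_imp_inj_on by blast
  have lm: "l (m t) = t" "m t \<in> {0..1}" if "t \<in> {0..1}" for t
    using that f_the_inv_into_f[OF inj, of t] the_inv_into_into[OF inj, of t "{0..1}"] l(3)
    by (auto simp: m_def)
  have ml: "m (l t) = t" if "t \<in> {0..1}" for t
    using that the_inv_into_f_f[OF inj] by (simp add: m_def)
  have "strict_mono_on {0..1} m"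
  proof (rule strict_mono_onI)
    fix s t :: real assume st: "s \<in> {0..1}" "t \<in> {0..1}" "s < t"
    show "m s < m t"
    proof (rule ccontr)
      assume "\<not> m s < m t"
      then have "l (m t) \<le> l (m s)"
        using l(1) lm(2) st by (metis strict_mono_on_leD linorder_not_less)
      then show False using lm st by simp
    qed
  qed
  moreover have "continuous_on {0..1} m"
    using continuous_on_inv[OF l(2), of m] l(3) ml by simp
  moreover have "m ` {0..1} = {0..1}"
  proof
    show "{0..1} \<subseteq> m ` {0..1}"
      using ml time_changes_in[OF assms] by (metis image_eqI subsetI)
  qed (use lm in auto)
  ultimately show ?thesis using that[of m] lm(1) by (simp add: time_changes_def)
qed

lemma skorokhod_close_nonneg: "skorokhod_close e x y \<Longrightarrow> 0 \<le> e"
proof -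
  assume "skorokhod_close e x y"
  then obtain l where "\<forall>t\<in>{0..1}. \<bar>l t - t\<bar> \<le> e" unfolding skorokhod_close_def by blast
  then have "\<bar>l 0 - 0\<bar> \<le> e" by fastforce
  then show ?thesis by linarith
qed

lemma skorokhod_close_refl: "skorokhod_close 0 x x"
  unfolding skorokhod_close_def using time_changes_id by (intro bexI[of _ "\<lambda>t. t"]) auto

lemma skorokhod_close_sym:
  assumes "skorokhod_close e x y"
  shows "skorokhod_close e y x"
proof -
  obtain l where l: "l \<in> time_changes"
    "\<And>t. t \<in> {0..1} \<Longrightarrow> \<bar>l t - t\<bar> \<le> e \<and> \<bar>path_of x t - path_of y (l t)\<bar> \<le> e"
    using assms unfolding skorokhod_close_def by blast
  obtain m where m: "m \<in> time_changes" "\<And>t. t \<in> {0..1} \<Longrightarrow> l (m t) = t"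
    using time_changes_inverse[OF l(1)] by blast
  show ?thesis
    unfolding skorokhod_close_def
  proof (intro bexI[OF _ m(1)] ballI)
    fix t :: real assume t: "t \<in> {0..1}"
    show "\<bar>m t - t\<bar> \<le> e \<and> \<bar>path_of y t - path_of x (m t)\<bar> \<le> e"
      using l(2)[OF time_changes_in[OF m(1) t]] m(2)[OF t] by (auto simp: abs_minus_commute)
  qed
qed

lemma skorokhod_close_trans:
  assumes "skorokhod_close e x y" "skorokhod_close d y z"
  shows "skorokhod_close (e + d) x z"
proof -
  obtain l where l: "l \<in> time_changes"
    "\<And>t. t \<in> {0..1} \<Longrightarrow> \<bar>l t - t\<bar> \<le> e \<and> \<bar>path_of x t - path_of y (l t)\<bar> \<le> e"
    using assms(1) unfolding skorokhod_close_def by blast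
  obtain m where m: "m \<in> time_changes"
    "\<And>t. t \<in> {0..1} \<Longrightarrow> \<bar>m t - t\<bar> \<le> d \<and> \<bar>path_of y t - path_of z (m t)\<bar> \<le> d"
    using assms(2) unfolding skorokhod_close_def by blast
  show ?thesis
    unfolding skorokhod_close_def
  proof (intro bexI[OF _ time_changes_comp[OF l(1) m(1)]] ballI)
    fix t :: real assume t: "t \<in> {0..1}"
    show "\<bar>m (l t) - t\<bar> \<le> e + d \<and> \<bar>path_of x t - path_of z (m (l t))\<bar> \<le> e + d"
      using l(2)[OF t] m(2)[OF time_changes_in[OF l(1) t]] by linarith
  qed
qed

lemma skorokhod_close_ex: "\<exists>e. skorokhod_close e x y"
proof -
  obtain B C where "\<And>t. t \<in> {0..1} \<Longrightarrow> \<bar>path_of x t\<bar> \<le> B" "\<And>t. t \<in> {0..1} \<Longrightarrow> \<bar>path_of y t\<bar> \<le> C"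
    using path_bounded[of x] path_bounded[of y] by blast
  then have BC: "\<bar>path_of x t - path_of y t\<bar> \<le> \<bar>B\<bar> + \<bar>C\<bar>" if "t \<in> {0..1}" for t
    using that by (smt (verit))
  have "skorokhod_close (\<bar>B\<bar> + \<bar>C\<bar>) x y"
    unfolding skorokhod_close_def using time_changes_id BC
    by (intro bexI[of _ "\<lambda>t. t"]) auto
  then show ?thesis ..
qed

lemma skorokhod_close_imp_eq:
  assumes "\<And>e. e > 0 \<Longrightarrow> skorokhod_close e x y"
  shows "x = y"
proof (rule cadlag_eqI)
  fix t :: real assume t: "t \<in> {0..1}"
  show "path_of x t = path_of y t"
  proof (cases "t = 1")
    case True
    have "\<bar>path_of x 1 - path_of y 1\<bar> \<le> e" if e: "e > 0" for e
    proof -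
      obtain l where l: "l \<in> time_changes"
        "\<And>t. t \<in> {0..1} \<Longrightarrow> \<bar>l t - t\<bar> \<le> e \<and> \<bar>path_of x t - path_of y (l t)\<bar> \<le> e"
        using assms[OF e] unfolding skorokhod_close_def by blast
      have "l 1 = 1"
      proof -
        have "1 \<in> l ` {0..1}" using l(1) by (auto simp: time_changes_def)
        then obtain u where u: "u \<in> {0..1}" "l u = 1" by auto
        then have "l u \<le> l 1"
          using strict_mono_on_leD[of "{0..1}" l u 1] l(1) by (simp add: time_changes_def)
        then show ?thesis using u time_changes_in[OF l(1), of 1] by simp
      qed
      then show ?thesis using l(2)[of 1] by simp
    qed
    then have "\<bar>path_of x 1 - path_of y 1\<bar> \<le> 0" by (rule field_le_epsilon) simp
    then show ?thesis using True by simp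
  next
    case False
    then have t1: "t \<in> {0..<1}" using t by auto
    have rx: "(path_of x \<longlongrightarrow> path_of x t) (at_right t)" and ry: "(path_of y \<longlongrightarrow> path_of y t) (at_right t)"
      using is_cadlag_path[of x] is_cadlag_path[of y] t1 by (auto simp: is_cadlag_def)
    have "\<bar>path_of x t - path_of y t\<bar> \<le> 0 + e" if e: "e > 0" for e
    proof -
      have "eventually (\<lambda>s. dist (path_of x s) (path_of x t) < e / 3) (at_right t)"
        using rx by (rule tendstoD) (use e in simp)
      then obtain u where u: "u > t" "\<And>s. t < s \<Longrightarrow> s < u \<Longrightarrow> dist (path_of x s) (path_of x t) < e / 3"
        by (auto simp: eventually_at_right_field)
      have "eventually (\<lambda>s. dist (path_of y s) (path_of y t) < e / 3) (at_right t)"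
        using ry by (rule tendstoD) (use e in simp)
      then obtain v where v: "v > t" "\<And>s. t < s \<Longrightarrow> s < v \<Longrightarrow> dist (path_of y s) (path_of y t) < e / 3"
        by (auto simp: eventually_at_right_field)
      define w where "w = min 1 (min u v)"
      define s where "s = (t + w) / 2"
      define d where "d = min (e / 3) ((w - t) / 4)"
      have w: "t < w" using u(1) v(1) t1 by (auto simp: w_def)
      have s: "t < s" "s < w" using w by (auto simp: s_def)
      have "d > 0" using e w by (simp add: d_def)
      then obtain l where l: "l \<in> time_changes"
        "\<And>t. t \<in> {0..1} \<Longrightarrow> \<bar>l t - t\<bar> \<le> d \<and> \<bar>path_of x t - path_of y (l t)\<bar> \<le> d"
        using assms[of d] unfolding skorokhod_close_def by blast
      have s01: "s \<in> {0..1}" using s t1 by (auto simp: w_def)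
      have "\<bar>l s - s\<bar> \<le> (w - t) / 4" using l(2)[OF s01] by (simp add: d_def)
      then have "l s - s \<le> (w - t) / 4" "s - l s \<le> (w - t) / 4" by linarith+
      moreover have "s - t = (w - t) / 2" "w - s = (w - t) / 2" by (simp_all add: s_def field_simps)
      ultimately have "t < l s" "l s < w" using w by linarith+
      then have "dist (path_of y (l s)) (path_of y t) < e / 3" by (intro v) (auto simp: w_def)
      moreover have "dist (path_of x s) (path_of x t) < e / 3"
        using s by (intro u) (auto simp: w_def)
      moreover have "\<bar>path_of x s - path_of y (l s)\<bar> \<le> e / 3"
        using l(2)[OF s01] by (simp add: d_def)
      ultimately show ?thesis unfolding dist_real_def by linarith
    qed
    then have "\<bar>path_of x t - path_of y t\<bar> \<le> 0" by (rule field_le_epsilon)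
    then show ?thesis by simp
  qed
qed

instantiation cadlag :: metric_space
begin

definition dist_cadlag :: "cadlag \<Rightarrow> cadlag \<Rightarrow> real" where
  "dist_cadlag x y = Inf {e. skorokhod_close e x y}"

definition uniformity_cadlag :: "(cadlag \<times> cadlag) filter" where
  "uniformity_cadlag = (INF e\<in>{0<..}. principal {(x, y). dist x y < e})"

definition open_cadlag :: "cadlag set \<Rightarrow> bool" where
  "open_cadlag U = (\<forall>x\<in>U. eventually (\<lambda>(x', y). x' = x \<longrightarrow> y \<in> U) uniformity)"

lemma skorokhod_bdd_below: "bdd_below {e. skorokhod_close e x y}"
  using skorokhod_close_nonneg by (intro bdd_belowI[of _ 0]) auto

lemma dist_cadlag_le: "skorokhod_close e x y \<Longrightarrow> dist x y \<le> e"
  unfolding dist_cadlag_def using skorokhod_bdd_below by (intro cInf_lower) auto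

lemma dist_cadlag_lessD:
  assumes "dist x y < d"
  obtains e where "skorokhod_close e x y" "e < d"
  using assms skorokhod_close_ex[of x y] skorokhod_bdd_below[of x y]
  unfolding dist_cadlag_def by (subst (asm) cInf_less_iff) auto

instance
proof
  show "(uniformity :: (cadlag \<times> cadlag) filter)
      = (INF e\<in>{0<..}. principal {(x, y). dist x y < e})"
    by (rule uniformity_cadlag_def)
  show "open U = (\<forall>x\<in>U. eventually (\<lambda>(x', y). x' = x \<longrightarrow> y \<in> U) uniformity)"
    for U :: "cadlag set"
    by (rule open_cadlag_def)
  have nonneg: "0 \<le> dist x y" for x y :: cadlag
    unfolding dist_cadlag_def
    using skorokhod_close_ex[of x y] skorokhod_close_nonneg by (intro cInf_greatest) auto
  show "dist x y = 0 \<longleftrightarrow> x = y" for x y :: cadlag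
  proof
    assume 0: "dist x y = 0"
    show "x = y"
    proof (rule skorokhod_close_imp_eq)
      fix e :: real assume "e > 0"
      then have "dist x y < e" using 0 by simp
      then obtain d where d: "skorokhod_close d x y" "d < e"
        by (rule dist_cadlag_lessD)
      then show "skorokhod_close e x y"
        unfolding skorokhod_close_def by (meson less_imp_le order_trans)
    qed
  next
    assume "x = y"
    then show "dist x y = 0"
      using dist_cadlag_le[OF skorokhod_close_refl[of x]] nonneg[of x x] by simp
  qed
  show "dist x y \<le> dist x z + dist y z" for x y z :: cadlag
  proof (rule field_le_epsilon)
    fix e :: real assume e: "e > 0"
    obtain d1 where d1: "skorokhod_close d1 x z" "d1 < dist x z + e / 2"
      using dist_cadlag_lessD[of x z "dist x z + e / 2"] e by auto
    obtain d2 where d2: "skorokhod_close d2 y z" "d2 < dist y z + e / 2"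
      using dist_cadlag_lessD[of y z "dist y z + e / 2"] e by auto
    have "dist x y \<le> d1 + d2"
      using dist_cadlag_le skorokhod_close_trans[OF d1(1) skorokhod_close_sym[OF d2(1)]] by blast
    then show "dist x y \<le> dist x z + dist y z + e" using d1(2) d2(2) by simp
  qed
qed

end

definition weakly_converges ::
    "(nat \<Rightarrow> 'a :: topological_space measure) \<Rightarrow> 'a measure \<Rightarrow> bool" where
  "weakly_converges \<mu> \<nu> \<longleftrightarrow>
     (\<forall>F :: 'a \<Rightarrow> real. continuous_on UNIV F \<and> bounded (range F) \<longrightarrow>
        (\<lambda>n. \<integral>x. F x \<partial>\<mu> n) \<longlonglongrightarrow> (\<integral>x. F x \<partial>\<nu>))"

section \<open>Gaussian processes and the Ornstein-Uhlenbeck bridge\<close>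

text \<open>Constants count as Gaussian (variance zero); the bridge needs this at its endpoints.\<close>

definition gaussian_rv :: "'a measure \<Rightarrow> ('a \<Rightarrow> real) \<Rightarrow> bool" where
  "gaussian_rv M X \<longleftrightarrow> X \<in> borel_measurable M \<and>
     ((\<exists>m. AE \<omega> in M. X \<omega> = m) \<or>
      (\<exists>m \<sigma>. \<sigma> > 0 \<and> distributed M lborel X (normal_density m \<sigma>)))"

definition gaussian_process :: "'a measure \<Rightarrow> 'i set \<Rightarrow> ('i \<Rightarrow> 'a \<Rightarrow> real) \<Rightarrow> bool" where
  "gaussian_process M T Y \<longleftrightarrow>
     (\<forall>J u. finite J \<and> J \<subseteq> T \<longrightarrow> gaussian_rv M (\<lambda>\<omega>. \<Sum>t\<in>J. u t * Y t \<omega>))"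

text \<open>The law on path space, with the coordinate process as the Gaussian process. The case
  \<open>s = t\<close> of the covariance formula is included: without it the variance at time 1 would be
  unconstrained.\<close>

definition OU_bridge_law :: "real \<Rightarrow> cadlag measure \<Rightarrow> bool" where
  "OU_bridge_law c \<nu> \<longleftrightarrow>
     prob_space \<nu> \<and> sets \<nu> = sets borel \<and>
     gaussian_process \<nu> {0..1} (\<lambda>t x. path_of x t) \<and>
     (\<forall>t\<in>{0..1}. (\<integral>x. path_of x t \<partial>\<nu>) = 0) \<and>
     (\<forall>s t. 0 \<le> s \<and> s \<le> t \<and> t \<le> 1 \<longrightarrow>
        (\<integral>x. path_of x s * path_of x t \<partial>\<nu>) = sinh (c * s) * sinh (c * (1 - t)) / (c * sinh c))"

section \<open>Limit shape and fluctuations\<close>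

definition limit_shape :: "real \<Rightarrow> real \<Rightarrow> real \<Rightarrow> real" where
  "limit_shape \<rho> c t =
     1 - 2 * \<rho> +
     1 / c * ln ((sinh (c * t) + exp (c * (2 * \<rho> - 1)) * sinh (c * (1 - t))) / sinh c)"

definition fluctuation :: "real \<Rightarrow> real \<Rightarrow> nat \<Rightarrow> (nat \<Rightarrow> int) \<Rightarrow> real \<Rightarrow> real" where
  "fluctuation \<rho> c n x t =
     sqrt (real n) *
       (1 / (2 * real n) * linear_interpolation x (2 * real n * t) - limit_shape \<rho> c t)"

definition fluctuation_scale :: "real \<Rightarrow> real \<Rightarrow> real \<Rightarrow> real" where
  "fluctuation_scale \<rho> c s =
     1 / sqrt 2 * (sqrt ((exp (2 * c * \<rho>) - 1) * (1 - exp (- 2 * c * (1 - \<rho>)))) /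
       (sinh (c * s) + exp (c * (2 * \<rho> - 1)) * sinh (c * (1 - s))))"

definition rescaled_path :: "real \<Rightarrow> real \<Rightarrow> nat \<Rightarrow> nat list \<Rightarrow> cadlag" where
  "rescaled_path \<rho> c n p =
     to_cadlag (\<lambda>s. fluctuation \<rho> c n (boundary_path p) s / fluctuation_scale \<rho> c s)"

text \<open>For \<open>c < 0\<close> both the common denominator below and \<open>sinh c\<close> are negative, so the logarithm is
  still taken of a positive number, while the scale function itself is negative.\<close>

lemma shape_denominator_pos:
  fixes c s :: real
  assumes "c \<noteq> 0" "s \<in> {0..1}"
  shows "(sinh (c * s) + exp (c * (2 * \<rho> - 1)) * sinh (c * (1 - s))) / sinh c > 0"
proof -
  have pos: "sinh (d * s) + E * sinh (d * (1 - s)) > 0" if "d > 0" "E > 0" for d E :: real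
  proof (cases "s = 0")
    case True
    then show ?thesis using that by simp
  next
    case False
    then have "sinh (d * s) > 0" using that assms by simp
    moreover have "E * sinh (d * (1 - s)) \<ge> 0" using that assms by simp
    ultimately show ?thesis by (rule add_pos_nonneg)
  qed
  show ?thesis
  proof (cases "c > 0")
    case True
    then show ?thesis using pos[of c] by simp
  next
    case False
    then have "sinh (- c * s) + exp (c * (2 * \<rho> - 1)) * sinh (- c * (1 - s)) > 0" "sinh c < 0"
      using pos[of "- c" "exp (c * (2 * \<rho> - 1))"] assms(1) by simp_all
    then show ?thesis
      by (intro divide_neg_neg) simp_all
  qed
qed

lemma fluctuation_scale_nonzero:
  assumes "0 < \<rho>" "\<rho> < 1" "c \<noteq> 0" "s \<in> {0..1}"
  shows "fluctuation_scale \<rho> c s \<noteq> 0"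
proof -
  have "exp (2 * c * \<rho>) \<noteq> 1" "exp (- 2 * c * (1 - \<rho>)) \<noteq> 1"
    using assms by auto
  then show ?thesis
    using shape_denominator_pos[OF assms(3,4), of \<rho>] by (auto simp: fluctuation_scale_def)
qed

lemma continuous_on_linear_interpolation: "continuous_on {0..} (linear_interpolation x)"
proof -
  have seg: "linear_interpolation x s
      = of_int (x k) + (s - real k) * of_int (x (k + 1) - x k)"
    if s: "s \<in> {real k..real k + 1}" for k s
  proof (cases "s = real k + 1")
    case True
    then have "nat \<lfloor>s\<rfloor> = k + 1" by (simp add: nat_add_distrib)
    then show ?thesis using True by (simp add: linear_interpolation_def)
  next
    case False
    then have "\<lfloor>s\<rfloor> = int k" using s by (simp add: floor_eq_iff)
    then show ?thesis by (simp add: linear_interpolation_def)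
  qed
  have cseg: "continuous_on {real k..real k + 1} (linear_interpolation x)" for k
    by (rule continuous_on_eq[of _ "\<lambda>s. of_int (x k) + (s - real k) * of_int (x (k + 1) - x k)"])
       (auto intro!: continuous_intros simp: seg)
  have upto: "continuous_on {0..real k} (linear_interpolation x)" for k
  proof (induction k)
    case (Suc k)
    have "continuous_on ({0..real k} \<union> {real k..real k + 1}) (linear_interpolation x)"
      by (intro continuous_on_closed_Un Suc cseg) auto
    moreover have "{0..real k} \<union> {real k..real k + 1} = {0..real (Suc k)}" by auto
    ultimately show ?case by simp
  qed auto
  show ?thesis
    unfolding continuous_on_eq_continuous_within
  proof
    fix s :: real assume s: "s \<in> {0..}"
    obtain k where k: "s < real k" using reals_Archimedean2 by blast
    have "continuous (at s within {0..real k}) (linear_interpolation x)"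
      using upto[of k] s k by (auto simp: continuous_on_eq_continuous_within)
    moreover have "at s within {0..real k} = at s within {0..}"
      by (rule at_within_nhd[of s "{..<real k}"]) (use k in auto)
    ultimately show "continuous (at s within {0..}) (linear_interpolation x)"
      by simp
  qed
qed

lemma path_rescaled_path:
  assumes "0 < \<rho>" "\<rho> < 1" "c \<noteq> 0" "s \<in> {0..1}"
  shows "path_of (rescaled_path \<rho> c n p) s
    = fluctuation \<rho> c n (boundary_path p) s / fluctuation_scale \<rho> c s"
proof -
  have shape: "continuous_on {0..1} (limit_shape \<rho> c)"
    unfolding limit_shape_def using shape_denominator_pos[OF assms(3), of _ \<rho>] assms(3)
    by (intro continuous_intros) force+
  have scale: "continuous_on {0..1} (fluctuation_scale \<rho> c)"
    unfolding fluctuation_scale_def using shape_denominator_pos[OF assms(3), of _ \<rho>]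
    by (intro continuous_intros) force+
  have interp: "continuous_on {0..1}
      (\<lambda>t. linear_interpolation (boundary_path p) (2 * real n * t))"
    by (rule continuous_on_compose2[OF continuous_on_linear_interpolation])
       (auto intro!: continuous_intros)
  have "continuous_on {0..1}
      (\<lambda>s. fluctuation \<rho> c n (boundary_path p) s / fluctuation_scale \<rho> c s)"
    using fluctuation_scale_nonzero[OF assms(1-3)]
    unfolding fluctuation_def by (intro continuous_intros shape scale interp) auto
  then show ?thesis
    unfolding rescaled_path_def using is_cadlag_continuous_on assms(4)
    by (intro path_to_cadlag)
qed

end

theory Submission
  imports Defs "HOL-Real_Asymp.Real_Asymp"
begin

text \<open>
  The size of a diagram is, up to a constant, the sum of the positions of its down-steps. Hence the
  boundary path is a walk with independent steps, where step \<open>j\<close> is a down-step with odds \<open>z q ^ j\<close>,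
  conditioned on the total number of down-steps. The factor \<open>z\<close> is free; it is chosen so that the
  expected fraction of down-steps is \<open>\<rho>\<close>, and then the mean path is the limit shape up to \<open>O(1)\<close>.

  Fourier inversion writes the conditioned characteristic function of a linear combination of path
  values as a quotient of two integrals over the circle, to which dominated convergence applies after
  rescaling by \<open>sqrt n\<close>. The limit is the characteristic function of the bridge, which gives
  convergence of the finite-dimensional distributions.

  For tightness the conditioning is removed: local probabilities are at most of order
  \<open>1 / sqrt n\<close>, so conditioning increases the probability of an event that depends only on a short
  block of steps by at most a constant factor. An exponential maximal inequality for independent
  steps bounds the oscillation on each block.

  The limit process is a deterministic time change and rescaling of a Brownian bridge, which is built
  as a Schauder series with independent Gaussian coefficients.
\<close>

section \<open>Test functions and measurability on path space\<close>

text \<open>Both closed formulas of the theorem come from the step probabilities. The mean slope of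
  the path is \<open>1 - 2 * occ\<close>, whose integral is the limit shape, and the square of
  \<open>fluctuation_scale\<close> is \<open>2 * occ * (1 - occ)\<close>, the rate at which the
  unconditioned walk collects variance. For \<open>c < 0\<close> the scale is negative, so only
  products of two of its values are evaluated. The hypothesis on \<open>a n / (2 * n)\<close> puts
  the prescribed number of down-steps within o(sqrt n) of its mean; a larger deviation could leave a
  drift in the limit. No compactness criterion on path space is used. A bounded Lipschitz function
  is evaluated at a path and at its interpolation over \<open>m\<close> nodes. Since
  \<open>m\<close> is fixed before \<open>n\<close> tends to infinity, the claim reduces to a
  finite-dimensional limit and an oscillation bound. The paths being compared are continuous, so the
  uniform distance serves as an upper bound for the Skorokhod distance.\<close>

lemma dist_to_cadlag_le:
  assumes "continuous_on {0..1} x" "continuous_on {0..1} y"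
    and "\<And>t. t \<in> {0..1} \<Longrightarrow> \<bar>x t - y t\<bar> \<le> e"
  shows "dist (to_cadlag x) (to_cadlag y) \<le> e"
proof (rule dist_cadlag_le)
  have "0 \<le> e" using assms(3)[of 0] by simp
  then show "skorokhod_close e (to_cadlag x) (to_cadlag y)"
    unfolding skorokhod_close_def using assms time_changes_id
    by (intro bexI[of _ "\<lambda>t. t"]) (auto simp: path_to_cadlag is_cadlag_continuous_on)
qed

text \<open>The Pasch-Hausdorff envelope: \<open>G k\<close> is the largest
  \<open>k\<close>-Lipschitz function below \<open>F\<close>. Continuity of \<open>F\<close> gives
  pointwise convergence only, which is what dominated convergence needs.\<close>

lemma inf_convolution:
  fixes F :: "'a::metric_space \<Rightarrow> real"
  assumes cont: "continuous_on UNIV F" and B: "\<And>x. \<bar>F x\<bar> \<le> B"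
    and G_def: "G = (\<lambda>k x. INF y. F y + real k * dist x y)"
  shows "G k x \<le> F x"
    and "\<bar>G k x\<bar> \<le> B"
    and "\<bar>G k x - G k y\<bar> \<le> real k * dist x y"
    and "(\<lambda>k. G k x) \<longlonglongrightarrow> F x"
proof -
  have FB: "- B \<le> F y" "F y \<le> B" for y using B[of y] by auto
  have bdd: "bdd_below (range (\<lambda>y. F y + real k * dist x y))" for k x
    by (rule bdd_belowI[of _ "- B"]) (use FB in \<open>auto intro: add_increasing2\<close>)
  have le: "G k x \<le> F y + real k * dist x y" for k x y
    unfolding G_def by (rule cINF_lower[OF bdd]) simp
  have ge: "C \<le> G k x" if "\<And>y. C \<le> F y + real k * dist x y" for C k x
    unfolding G_def by (rule cINF_greatest) (use that in auto)
  show leF: "G k x \<le> F x" for k x using le[of k x x] by simp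
  have geB: "- B \<le> G k x" for k x by (rule ge) (use FB in \<open>auto intro: add_increasing2\<close>)
  show "\<bar>G k x\<bar> \<le> B" using leF[of k x] geB[of k x] FB[of x] by linarith
  have lip: "G k x \<le> G k y + real k * dist x y" for k x y
  proof -
    have "G k x - real k * dist x y \<le> G k y"
    proof (rule ge)
      fix z
      have "real k * dist x z \<le> real k * (dist x y + dist y z)"
        by (intro mult_left_mono dist_triangle) simp
      then show "G k x - real k * dist x y \<le> F z + real k * dist y z"
        using le[of k x z] by (simp add: algebra_simps)
    qed
    then show ?thesis by simp
  qed
  show "\<bar>G k x - G k y\<bar> \<le> real k * dist x y"
    using lip[of k x y] lip[of k y x] by (simp add: dist_commute)
  show "(\<lambda>k. G k x) \<longlonglongrightarrow> F x"
  proof (rule LIMSEQ_I)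
    fix r :: real assume r: "0 < r"
    have "isCont F x" using cont by (simp add: continuous_on_eq_continuous_at)
    then have "\<exists>d>0. \<forall>y. dist y x < d \<longrightarrow> dist (F y) (F x) < r / 2"
      using r unfolding continuous_at_eps_delta by (metis half_gt_zero)
    then obtain d where d: "d > 0" "\<And>y. dist y x < d \<Longrightarrow> \<bar>F y - F x\<bar> < r / 2"
      unfolding dist_real_def by blast
    \<comment> \<open>Outside the \<open>d\<close>-ball the penalty \<open>k * dist x y\<close> is
      at least \<open>2 * B\<close>, the largest possible oscillation of \<open>F\<close>, so the
      infimum is decided inside the ball.\<close>
    obtain k0 :: nat where k0: "2 * B / d < real k0" using reals_Archimedean2 by blast
    show "\<exists>no. \<forall>k\<ge>no. norm (G k x - F x) < r"
    proof (intro exI[of _ k0] allI impI)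
      fix k assume k: "k \<ge> k0"
      have "F x - r / 2 \<le> G k x"
      proof (rule ge)
        fix y
        show "F x - r / 2 \<le> F y + real k * dist x y"
        proof (cases "dist y x < d")
          case True
          then have "F x - r / 2 \<le> F y" using d(2)[of y] by linarith
          then show ?thesis by (simp add: add_increasing2)
        next
          case False
          have "2 * B \<le> real k0 * d" using k0 d(1) by (simp add: field_simps)
          also have "\<dots> \<le> real k * dist x y"
            using False k d(1) by (intro mult_mono) (auto simp: dist_commute)
          finally show ?thesis using FB[of x] FB[of y] r by linarith
        qed
      qed
      then show "norm (G k x - F x) < r" using leF[of k x] r by simp
    qed
  qed
qed

text \<open>Lipschitz minorants give the lower bound for the limit inferior of the integrals, and
  the same bound for \<open>- F\<close> gives the upper one.\<close>

lemma weakly_converges_lipschitz: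
  fixes \<mu> :: "nat \<Rightarrow> 'a::metric_space measure"
  assumes \<mu>: "\<And>n. prob_space (\<mu> n)" "\<And>n. sets (\<mu> n) = sets borel"
    and \<nu>: "prob_space \<nu>" "sets \<nu> = sets borel"
    and lip: "\<And>F :: 'a \<Rightarrow> real. \<And>B L. (\<And>x. \<bar>F x\<bar> \<le> B) \<Longrightarrow>
      (\<And>x y. \<bar>F x - F y\<bar> \<le> L * dist x y) \<Longrightarrow> continuous_on UNIV F \<Longrightarrow>
      (\<lambda>n. \<integral>x. F x \<partial>\<mu> n) \<longlonglongrightarrow> (\<integral>x. F x \<partial>\<nu>)"
  shows "weakly_converges \<mu> \<nu>"
proof -
  interpret N: prob_space \<nu> by fact
  have meas: "F \<in> borel_measurable M" if "continuous_on UNIV F" "sets M = sets borel"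
    for F :: "'a \<Rightarrow> real" and M
    using that borel_measurable_continuous_onI measurable_cong_sets by blast
  have bint: "integrable M F" if "continuous_on UNIV F" "\<And>x. \<bar>F x\<bar> \<le> B" "sets M = sets borel"
    "prob_space M" for F :: "'a \<Rightarrow> real" and M B
  proof -
    interpret prob_space M by fact
    show ?thesis using that meas[OF that(1,3)] by (intro integrable_const_bound[of _ B]) auto
  qed
  have lower: "\<forall>\<^sub>F n in sequentially. (\<integral>x. F x \<partial>\<nu>) - e < (\<integral>x. F x \<partial>\<mu> n)"
    if F: "continuous_on UNIV F" "\<And>x. \<bar>F x\<bar> \<le> B" and e: "e > 0" for F :: "'a \<Rightarrow> real" and B e
  proof -
    define G where "G = (\<lambda>k x. INF y. F y + real k * dist x y)"
    note G = inf_convolution[OF F G_def]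
    have Gc: "continuous_on UNIV (G k)" for k
    proof -
      have "(real k)-lipschitz_on UNIV (G k)"
        by (rule lipschitz_onI) (use G(3) in \<open>auto simp: dist_real_def\<close>)
      then show ?thesis by (rule lipschitz_on_continuous_on)
    qed
    have "(\<lambda>k. \<integral>x. G k x \<partial>\<nu>) \<longlonglongrightarrow> (\<integral>x. F x \<partial>\<nu>)"
      by (rule integral_dominated_convergence[where w = "\<lambda>_. B"])
         (use G Gc F \<nu>(2) meas in auto)
    then have "\<forall>\<^sub>F k in sequentially. (\<integral>x. F x \<partial>\<nu>) - e < (\<integral>x. G k x \<partial>\<nu>)"
      by (rule order_tendstoD) (use e in simp)
    then obtain k where k: "(\<integral>x. F x \<partial>\<nu>) - e < (\<integral>x. G k x \<partial>\<nu>)"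
      by (meson eventually_False_sequentially eventually_elim2 eventually_mono)
    have "(\<lambda>n. \<integral>x. G k x \<partial>\<mu> n) \<longlonglongrightarrow> (\<integral>x. G k x \<partial>\<nu>)"
      by (rule lip) (use G Gc in auto)
    then have "\<forall>\<^sub>F n in sequentially. (\<integral>x. F x \<partial>\<nu>) - e < (\<integral>x. G k x \<partial>\<mu> n)"
      by (rule order_tendstoD) (rule k)
    then show ?thesis
    proof (rule eventually_mono)
      fix n assume "(\<integral>x. F x \<partial>\<nu>) - e < (\<integral>x. G k x \<partial>\<mu> n)"
      \<comment> \<open>Under \<open>\<mu> n\<close> only the inequality \<open>G k \<le> F\<close>
        is needed, so \<open>k\<close> can be chosen from \<open>\<nu>\<close> alone, independently
        of \<open>n\<close>.\<close>
      also have "(\<integral>x. G k x \<partial>\<mu> n) \<le> (\<integral>x. F x \<partial>\<mu> n)"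
        by (intro integral_mono bint[OF Gc, of _ B] bint[OF F]) (use G \<mu> in auto)
      finally show "(\<integral>x. F x \<partial>\<nu>) - e < (\<integral>x. F x \<partial>\<mu> n)" .
    qed
  qed
  show ?thesis
    unfolding weakly_converges_def
  proof (intro allI impI)
    fix F :: "'a \<Rightarrow> real"
    assume "continuous_on UNIV F \<and> bounded (range F)"
    then obtain B where F: "continuous_on UNIV F" "\<And>x. \<bar>F x\<bar> \<le> B"
      by (auto simp: bounded_iff)
    show "(\<lambda>n. \<integral>x. F x \<partial>\<mu> n) \<longlonglongrightarrow> (\<integral>x. F x \<partial>\<nu>)"
    proof (rule tendstoI)
      fix e :: real assume e: "e > 0"
      have F': "continuous_on UNIV (\<lambda>x. - F x)" "\<And>x. \<bar>- F x\<bar> \<le> B"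
        using F by (auto intro: continuous_intros)
      show "\<forall>\<^sub>F n in sequentially. dist (\<integral>x. F x \<partial>\<mu> n) (\<integral>x. F x \<partial>\<nu>) < e"
        using lower[OF F e] lower[OF F' e] by eventually_elim (simp add: dist_real_def)
    qed
  qed
qed

text \<open>A small time change can move a jump across \<open>t\<close>, so evaluation at an
  interior time is not continuous in the Skorokhod metric. At time 1 it is, because time changes fix
  the endpoint; for \<open>t < 1\<close> the value is recovered from times just after
  \<open>t\<close> by right continuity.\<close>

lemma measurable_path_of:
  assumes t: "t \<in> {0..1}"
  shows "(\<lambda>x. path_of x t) \<in> borel_measurable borel"
proof (cases "t = 1")
  case True
  have end1: "l 1 = 1" if "l \<in> time_changes" for l
  proof -
    have "1 \<in> l ` {0..1}" using that by (auto simp: time_changes_def)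
    then obtain u where u: "u \<in> {0..1}" "l u = 1" by auto
    then have "l u \<le> l 1"
      using strict_mono_on_leD[of "{0..1}" l u 1] that by (simp add: time_changes_def)
    then show ?thesis using u time_changes_in[OF that, of 1] by simp
  qed
  have "\<bar>path_of x 1 - path_of y 1\<bar> \<le> dist x y" for x y
  proof (rule field_le_epsilon)
    fix e :: real assume "e > 0"
    then obtain d where d: "skorokhod_close d x y" "d < dist x y + e"
      using dist_cadlag_lessD[of x y "dist x y + e"] by auto
    then obtain l where l: "l \<in> time_changes" "\<bar>path_of x 1 - path_of y (l 1)\<bar> \<le> d"
      unfolding skorokhod_close_def by force
    then show "\<bar>path_of x 1 - path_of y 1\<bar> \<le> dist x y + e"
      using end1[OF l(1)] d(2) by simp
  qed
  then have "1-lipschitz_on UNIV (\<lambda>x. path_of x 1)"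
    by (intro lipschitz_onI) (auto simp: dist_real_def)
  then show ?thesis
    using True by (auto intro: borel_measurable_continuous_onI lipschitz_on_continuous_on)
next
  case False
  then have t1: "t < 1" "0 \<le> t" using t by auto
  \<comment> \<open>Paths exceeding \<open>r\<close> somewhere in a window strictly to the right of
    \<open>t\<close>. The window and the inequality are open, so small changes of time and value
    preserve membership.\<close>
  define U where "U = (\<lambda>k r. {x. \<exists>s\<in>{0..1}. t < s \<and> s < t + 1 / real (Suc k) \<and> path_of x s > r})"
  have openU: "open (U k r)" for k r
    unfolding open_dist
  proof
    fix x assume "x \<in> U k r"
    then obtain s where s: "s \<in> {0..1}" "t < s" "s < t + 1 / real (Suc k)" "path_of x s > r"
      unfolding U_def by blast
    define e where "e = min (path_of x s - r) (min (s - t) (t + 1 / real (Suc k) - s))"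
    have e: "e > 0" using s by (simp add: e_def)
    show "\<exists>e>0. \<forall>y. dist y x < e \<longrightarrow> y \<in> U k r"
    proof (intro exI[of _ e] conjI e allI impI)
      fix y assume "dist y x < e"
      then obtain d where d: "skorokhod_close d x y" "d < e"
        using dist_cadlag_lessD[of x y e] by (auto simp: dist_commute)
      then obtain l where l: "l \<in> time_changes" "\<bar>l s - s\<bar> \<le> d" "\<bar>path_of x s - path_of y (l s)\<bar> \<le> d"
        unfolding skorokhod_close_def using s(1) by blast
      have "l s \<in> {0..1}" using time_changes_in[OF l(1) s(1)] .
      moreover have "t < l s" "l s < t + 1 / real (Suc k)" "path_of y (l s) > r"
        using l d(2) unfolding e_def by linarith+
      ultimately show "y \<in> U k r" unfolding U_def by blast
    qed
  qed
  \<comment> \<open>A value below \<open>r\<close> at \<open>t\<close> means a bound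
    \<open>r - 1 / (j + 1)\<close> on a whole window after \<open>t\<close>; the gap
    \<open>1 / (j + 1)\<close> makes up for the loss of strictness in the limit.\<close>
  have eq: "{x. path_of x t < r} = (\<Union>k j. - U k (r - 1 / real (Suc j)))" for r
  proof (intro set_eqI iffI)
    fix x assume "x \<in> {x. path_of x t < r}"
    then have "r - path_of x t > 0" by simp
    then obtain j where j: "1 / real (Suc j) < r - path_of x t"
      using nat_approx_posE by blast
    have "(path_of x \<longlongrightarrow> path_of x t) (at_right t)"
      using is_cadlag_path[of x] t1 by (auto simp: is_cadlag_def)
    then have "eventually (\<lambda>s. path_of x s < r - 1 / real (Suc j)) (at_right t)"
      by (rule order_tendstoD) (use j in simp)
    then obtain u where u: "u > t" "\<And>s. t < s \<Longrightarrow> s < u \<Longrightarrow> path_of x s < r - 1 / real (Suc j)"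
      by (auto simp: eventually_at_right_field)
    then obtain k where k: "1 / real (Suc k) < u - t"
      using nat_approx_posE[of "u - t"] by auto
    have "x \<notin> U k (r - 1 / real (Suc j))"
      unfolding U_def using u(2) k by force
    then show "x \<in> (\<Union>k j. - U k (r - 1 / real (Suc j)))" by blast
  next
    fix x assume "x \<in> (\<Union>k j. - U k (r - 1 / real (Suc j)))"
    then obtain k j where kj: "x \<notin> U k (r - 1 / real (Suc j))" by blast
    have lim: "(path_of x \<longlongrightarrow> path_of x t) (at_right t)"
      using is_cadlag_path[of x] t1 by (auto simp: is_cadlag_def)
    have "eventually (\<lambda>s. path_of x s \<le> r - 1 / real (Suc j)) (at_right t)"
      unfolding eventually_at_right_field
      using kj t1 by (intro exI[of _ "min 1 (t + 1 / real (Suc k))"]) (force simp: U_def)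
    then have "path_of x t \<le> r - 1 / real (Suc j)"
      by (intro tendsto_upperbound[OF lim]) auto
    also have "\<dots> < r" by simp
    finally show "x \<in> {x. path_of x t < r}" by simp
  qed
  show ?thesis
    unfolding borel_measurable_iff_less
    using openU by (auto simp: eq)
qed

section \<open>Piecewise linear interpolation on a regular grid\<close>

definition hat :: "nat \<Rightarrow> nat \<Rightarrow> real \<Rightarrow> real" where
  "hat m k t = max 0 (1 - \<bar>real m * t - real k\<bar>)"

definition interp :: "nat \<Rightarrow> (real \<Rightarrow> real) \<Rightarrow> real \<Rightarrow> real" where
  "interp m x t = (\<Sum>k\<le>m. x (real k / real m) * hat m k t)"

lemma hat_nonneg: "0 \<le> hat m k t"
  by (simp add: hat_def)

lemma continuous_on_hat: "continuous_on S (hat m k)"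
  unfolding hat_def by (intro continuous_intros)

lemma continuous_on_interp: "continuous_on S (interp m x)"
  unfolding interp_def by (intro continuous_intros continuous_on_hat)

lemma sum_hat:
  assumes "t \<in> {0..1}"
  shows "(\<Sum>k\<le>m. hat m k t) = 1"
proof -
  have "(\<Sum>k\<le>m. max 0 (1 - \<bar>r - real k\<bar>)) = 1" if "0 \<le> r" "r \<le> real m" for r
    using that
  proof (induction m)
    case (Suc m)
    show ?case
    proof (cases "r \<le> real m")
      case True
      then show ?thesis using Suc by simp
    next
      case False
      \<comment> \<open>For \<open>r\<close> beyond \<open>m\<close> only the hats at
        \<open>m\<close> and \<open>m + 1\<close> are nonzero.\<close>
      have "(\<Sum>k\<le>Suc m. max 0 (1 - \<bar>r - real k\<bar>)) = (\<Sum>k\<in>{m, Suc m}. max 0 (1 - \<bar>r - real k\<bar>))"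
        by (rule sum.mono_neutral_right) (use False in \<open>auto simp: not_less_eq_eq\<close>)
      also have "\<dots> = 1" using False Suc.prems by simp
      finally show ?thesis .
    qed
  qed simp
  moreover have "real m * t \<le> real m * 1" using assms by (intro mult_left_mono) auto
  ultimately show ?thesis
    unfolding hat_def using assms by simp
qed

text \<open>The hats form a partition of unity, so the interpolation is a weighted average of node
  values in which only nodes closer than \<open>1 / m\<close> to \<open>t\<close> carry weight. The
  assumption is a pure oscillation bound, which later comes from a random event.\<close>

lemma interp_error:
  assumes t: "t \<in> {0..1}" and m: "m > 0"
    and e: "\<And>k. k \<le> m \<Longrightarrow> \<bar>t - real k / real m\<bar> < 1 / real m \<Longrightarrow> \<bar>x t - x (real k / real m)\<bar> \<le> e"
  shows "\<bar>x t - interp m x t\<bar> \<le> e"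
proof -
  have "x t - interp m x t = (\<Sum>k\<le>m. (x t - x (real k / real m)) * hat m k t)"
    using sum_hat[OF t, of m]
    by (simp add: interp_def left_diff_distrib sum_subtractf flip: sum_distrib_left)
  also have "\<bar>\<dots>\<bar> \<le> (\<Sum>k\<le>m. \<bar>(x t - x (real k / real m)) * hat m k t\<bar>)"
    by (rule sum_abs)
  also have "\<dots> \<le> (\<Sum>k\<le>m. e * hat m k t)"
  proof (rule sum_mono)
    fix k assume k: "k \<in> {..m}"
    show "\<bar>(x t - x (real k / real m)) * hat m k t\<bar> \<le> e * hat m k t"
    proof (cases "hat m k t = 0")
      case False
      then have "\<bar>real m * t - real k\<bar> < 1" by (auto simp: hat_def max_def split: if_splits)
      then have "\<bar>t - real k / real m\<bar> < 1 / real m"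
        using m by (auto simp: abs_less_iff field_simps)
      then show ?thesis
        using e[of k] k hat_nonneg[of m k t] by (simp add: abs_mult mult_right_mono)
    qed simp
  qed
  also have "\<dots> = e" using sum_hat[OF t, of m] by (simp flip: sum_distrib_left)
  finally show ?thesis .
qed

lemma interp_uniform:
  assumes "continuous_on {0..1} x" "e > 0"
  shows "\<forall>\<^sub>F m in sequentially. \<forall>t\<in>{0..1}. \<bar>x t - interp m x t\<bar> \<le> e"
proof -
  have "uniformly_continuous_on {0..1} x"
    using assms(1) by (intro compact_uniformly_continuous) auto
  then obtain d where d: "d > 0"
    "\<And>s t. s \<in> {0..1} \<Longrightarrow> t \<in> {0..1} \<Longrightarrow> dist t s < d \<Longrightarrow> dist (x t) (x s) < e"
    unfolding uniformly_continuous_on_def using assms(2) by metis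
  obtain m0 :: nat where m0: "1 / d < real m0" using reals_Archimedean2 by blast
  have m0p: "0 < real m0" using d(1) m0 by (meson divide_pos_pos less_trans zero_less_one)
  show ?thesis
    unfolding eventually_sequentially
  proof (intro exI[of _ m0] allI impI ballI)
    fix m t assume m: "m0 \<le> m" and t: "t \<in> {0..1::real}"
    have "1 / real m \<le> 1 / real m0" using m m0p by (intro divide_left_mono) auto
    also have "\<dots> < d" using m0 d(1) m0p by (simp add: field_simps)
    finally have md: "1 / real m < d" .
    show "\<bar>x t - interp m x t\<bar> \<le> e"
    proof (rule interp_error[OF t])
      show "m > 0" using m m0p by simp
      fix k assume k: "k \<le> m" "\<bar>t - real k / real m\<bar> < 1 / real m"
      have "real k / real m \<in> {0..1}" using k(1) \<open>m > 0\<close> by auto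
      then show "\<bar>x t - x (real k / real m)\<bar> \<le> e"
        using d(2)[of "real k / real m" t] t k(2) md by (simp add: dist_real_def)
    qed
  qed
qed

text \<open>Turns a Lipschitz functional on path space into a Lipschitz function of finitely many
  coefficients, to which \<open>expectation_lipschitz_tendsto\<close> applies.\<close>

lemma to_cadlag_sum_lipschitz:
  fixes \<phi> :: "nat \<Rightarrow> real \<Rightarrow> real"
  assumes \<phi>: "\<And>k. continuous_on {0..1} (\<phi> k)"
  shows "\<exists>C\<ge>0. \<forall>v w. dist (to_cadlag (\<lambda>t. \<Sum>k\<le>m. v k * \<phi> k t)) (to_cadlag (\<lambda>t. \<Sum>k\<le>m. w k * \<phi> k t))
    \<le> (\<Sum>k\<le>m. C * \<bar>v k - w k\<bar>)"
proof -
  have "\<exists>C. \<forall>t\<in>{0..1}. \<bar>\<phi> k t\<bar> \<le> C" for k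
  proof -
    have "compact (\<phi> k ` {0..1})" using \<phi> by (intro compact_continuous_image) auto
    then have "bounded (\<phi> k ` {0..1})" by (rule compact_imp_bounded)
    then show ?thesis by (auto simp: bounded_iff)
  qed
  then obtain C where C: "\<And>k t. t \<in> {0..1} \<Longrightarrow> \<bar>\<phi> k t\<bar> \<le> C k" by metis
  define D where "D = (\<Sum>k\<le>m. \<bar>C k\<bar>)"
  have D: "\<bar>\<phi> k t\<bar> \<le> D" if "k \<le> m" "t \<in> {0..1}" for k t
  proof -
    have "\<bar>\<phi> k t\<bar> \<le> \<bar>C k\<bar>" using C[OF that(2), of k] by linarith
    also have "\<dots> \<le> D" unfolding D_def using that(1) by (intro member_le_sum) auto
    finally show ?thesis .
  qed
  show ?thesis
  proof (intro exI[of _ D] conjI allI)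
    show "0 \<le> D" by (simp add: D_def sum_nonneg)
    fix v w :: "nat \<Rightarrow> real"
    show "dist (to_cadlag (\<lambda>t. \<Sum>k\<le>m. v k * \<phi> k t)) (to_cadlag (\<lambda>t. \<Sum>k\<le>m. w k * \<phi> k t))
      \<le> (\<Sum>k\<le>m. D * \<bar>v k - w k\<bar>)"
    proof (rule dist_to_cadlag_le)
      fix t :: real assume t: "t \<in> {0..1}"
      have "\<bar>(\<Sum>k\<le>m. v k * \<phi> k t) - (\<Sum>k\<le>m. w k * \<phi> k t)\<bar> = \<bar>\<Sum>k\<le>m. \<phi> k t * (v k - w k)\<bar>"
        by (simp add: sum_subtractf right_diff_distrib mult.commute)
      also have "\<dots> \<le> (\<Sum>k\<le>m. \<bar>\<phi> k t * (v k - w k)\<bar>)" by (rule sum_abs)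
      also have "\<dots> \<le> (\<Sum>k\<le>m. D * \<bar>v k - w k\<bar>)"
        by (intro sum_mono) (auto simp: abs_mult intro!: mult_right_mono D t)
      finally show "\<bar>(\<Sum>k\<le>m. v k * \<phi> k t) - (\<Sum>k\<le>m. w k * \<phi> k t)\<bar> \<le> (\<Sum>k\<le>m. D * \<bar>v k - w k\<bar>)" .
    qed (intro continuous_intros \<phi>)+
  qed
qed

text \<open>The random path is a continuous image of a random coefficient vector, so its
  measurability does not require a description of the Borel sets of path space through
  coordinates.\<close>

lemma measurable_to_cadlag_sum:
  fixes X :: "nat \<Rightarrow> 'a \<Rightarrow> real" and \<phi> :: "nat \<Rightarrow> real \<Rightarrow> real"
  assumes "\<And>k. k \<le> m \<Longrightarrow> X k \<in> borel_measurable M"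
    and \<phi>: "\<And>k. continuous_on {0..1} (\<phi> k)"
  shows "(\<lambda>\<omega>. to_cadlag (\<lambda>t. \<Sum>k\<le>m. X k \<omega> * \<phi> k t)) \<in> borel_measurable M"
proof -
  define \<Gamma> where "\<Gamma> = (\<lambda>v::nat \<Rightarrow> real. to_cadlag (\<lambda>t. \<Sum>k\<le>m. v k * \<phi> k t))"
  obtain C where dist_le: "\<And>v w. dist (\<Gamma> v) (\<Gamma> w) \<le> (\<Sum>k\<le>m. C * \<bar>v k - w k\<bar>)"
    using to_cadlag_sum_lipschitz[of \<phi> m, OF \<phi>] unfolding \<Gamma>_def by blast
  have "continuous_on UNIV \<Gamma>"
    unfolding continuous_on_def
  proof
    fix w :: "nat \<Rightarrow> real"
    have co: "((\<lambda>v. v k) \<longlongrightarrow> w k) (at w)" for k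
    proof -
      have "continuous_on UNIV (\<lambda>v::nat \<Rightarrow> real. v k)"
        by (rule continuous_on_product_coordinates)
      then show ?thesis by (simp add: continuous_on_def)
    qed
    have "((\<lambda>v. \<Sum>k\<le>m. C * \<bar>v k - w k\<bar>) \<longlongrightarrow> (\<Sum>k\<le>m. C * \<bar>w k - w k\<bar>)) (at w)"
      by (intro tendsto_intros co)
    then have "((\<lambda>v. \<Sum>k\<le>m. C * \<bar>v k - w k\<bar>) \<longlongrightarrow> 0) (at w)" by simp
    then have "((\<lambda>v. dist (\<Gamma> v) (\<Gamma> w)) \<longlongrightarrow> 0) (at w)"
      by (rule Lim_null_comparison[rotated])
         (rule always_eventually, use dist_le in \<open>simp only: real_norm_def abs_of_nonneg zero_le_dist simp_thms\<close>)
    then show "(\<Gamma> \<longlongrightarrow> \<Gamma> w) (at w within UNIV)" by (subst tendsto_dist_iff) simp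
  qed
  then have "\<Gamma> \<in> borel_measurable borel" by (rule borel_measurable_continuous_onI)
  \<comment> \<open>Coefficients beyond \<open>m\<close> are set to 0 because nothing is known about
    the measurability of \<open>X k\<close> there.\<close>
  moreover have "(\<lambda>\<omega> k. if k \<le> m then X k \<omega> else 0) \<in> borel_measurable M"
  proof (rule measurable_coordinatewise_then_product)
    fix k
    show "(\<lambda>\<omega>. if k \<le> m then X k \<omega> else 0) \<in> borel_measurable M"
      by (cases "k \<le> m") (simp_all add: assms(1))
  qed
  ultimately have "(\<lambda>\<omega>. \<Gamma> (\<lambda>k. if k \<le> m then X k \<omega> else 0)) \<in> borel_measurable M"
    by (rule measurable_compose[rotated])
  then show ?thesis by (simp add: \<Gamma>_def)
qed

text \<open>Continuous paths are limits of their interpolations, and pointwise limits in a metric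
  space preserve measurability.\<close>

lemma measurable_to_cadlag:
  assumes cont: "\<And>\<omega>. \<omega> \<in> space M \<Longrightarrow> continuous_on {0..1} (\<lambda>t. X t \<omega>)"
    and meas: "\<And>t. t \<in> {0..1} \<Longrightarrow> X t \<in> borel_measurable M"
  shows "(\<lambda>\<omega>. to_cadlag (\<lambda>t. X t \<omega>)) \<in> borel_measurable M"
proof (rule borel_measurable_LIMSEQ_metric)
  show "(\<lambda>\<omega>. to_cadlag (interp m (\<lambda>t. X t \<omega>))) \<in> borel_measurable M" for m
    unfolding interp_def
    by (rule measurable_to_cadlag_sum[of m "\<lambda>k. X (real k / real m)" M "hat m"])
       (auto intro!: meas continuous_on_hat simp: divide_le_eq_1)
  fix \<omega> assume \<omega>: "\<omega> \<in> space M"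
  show "(\<lambda>m. to_cadlag (interp m (\<lambda>t. X t \<omega>))) \<longlonglongrightarrow> to_cadlag (\<lambda>t. X t \<omega>)"
  proof (rule tendstoI)
    fix e :: real assume e: "e > 0"
    show "\<forall>\<^sub>F m in sequentially. dist (to_cadlag (interp m (\<lambda>t. X t \<omega>))) (to_cadlag (\<lambda>t. X t \<omega>)) < e"
      using interp_uniform[OF cont[OF \<omega>] half_gt_zero[OF e]]
    proof eventually_elim
      case (elim m)
      have "dist (to_cadlag (interp m (\<lambda>t. X t \<omega>))) (to_cadlag (\<lambda>t. X t \<omega>)) \<le> e / 2"
        by (rule dist_to_cadlag_le)
           (use elim in \<open>auto simp: abs_minus_commute intro: continuous_on_interp cont[OF \<omega>]\<close>)
      then show ?case using e by simp
    qed
  qed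
qed

section \<open>Joint characteristic functions and weak convergence\<close>

abbreviation lborel_on :: "'i set \<Rightarrow> ('i \<Rightarrow> real) measure" where
  "lborel_on I \<equiv> PiM I (\<lambda>_. lborel)"

abbreviation std_normal_on :: "'i set \<Rightarrow> ('i \<Rightarrow> real) measure" where
  "std_normal_on I \<equiv> PiM I (\<lambda>_. std_normal_distribution)"

lemma exp_square_eq_char:
  "complex_of_real (exp (- d\<^sup>2 / 2)) = (\<integral>l. iexp (l * d) \<partial>std_normal_distribution)"
  using fun_cong[OF char_std_normal_distribution, of d] by (simp add: char_def mult.commute)

lemma abs_integral_le:
  fixes f g :: "'a \<Rightarrow> real"
  assumes "integrable M f" "integrable M g" "\<And>x. x \<in> space M \<Longrightarrow> \<bar>f x\<bar> \<le> g x"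
  shows "\<bar>\<integral>x. f x \<partial>M\<bar> \<le> (\<integral>x. g x \<partial>M)"
proof -
  have "\<bar>\<integral>x. f x \<partial>M\<bar> \<le> (\<integral>x. \<bar>f x\<bar> \<partial>M)" by (rule integral_abs_bound)
  also have "\<dots> \<le> (\<integral>x. g x \<partial>M)" using assms by (intro integral_mono) auto
  finally show ?thesis .
qed

lemma integrable_iexp':
  assumes "prob_space M" "f \<in> borel_measurable M"
  shows "integrable M (\<lambda>x. iexp (f x))"
  using assms prob_space.integrable_iexp[of M f] by simp

text \<open>The product of Gaussian kernels is itself an average of characters.\<close>

lemma expectation_gaussian_kernel:
  assumes M: "prob_space M" and fin: "finite I"
    and X[measurable]: "\<And>k. k \<in> I \<Longrightarrow> X k \<in> borel_measurable M"
  shows "complex_of_real (\<integral>\<omega>. (\<Prod>k\<in>I. exp (- (y k - X k \<omega>)\<^sup>2 / (2 * s\<^sup>2))) \<partial>M)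
    = (\<integral>l. (\<integral>\<omega>. iexp (\<Sum>k\<in>I. l k * ((y k - X k \<omega>) / s)) \<partial>M) \<partial>std_normal_on I)"
proof -
  interpret M: prob_space M by fact
  interpret N: prob_space std_normal_distribution
    by (rule real_distribution.axioms(1)[OF real_dist_normal_dist])
  interpret G: product_prob_space "\<lambda>_. std_normal_distribution" I by standard
  interpret P: pair_prob_space "std_normal_on I" M ..
  have [measurable]: "(\<lambda>l. l k) \<in> borel_measurable (std_normal_on I)" if "k \<in> I" for k
    using measurable_component_singleton[OF that, of "\<lambda>_. std_normal_distribution"]
    by (simp cong: measurable_cong_sets)
  have int: "integrable (std_normal_on I \<Otimes>\<^sub>M M)
      (\<lambda>(l, \<omega>). iexp (\<Sum>k\<in>I. l k * ((y k - X k \<omega>) / s)))"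
    unfolding split_beta by (rule integrable_iexp'[OF P.prob_space_axioms]) measurable
  have "complex_of_real (\<Prod>k\<in>I. exp (- (y k - X k \<omega>)\<^sup>2 / (2 * s\<^sup>2)))
      = (\<integral>l. iexp (\<Sum>k\<in>I. l k * ((y k - X k \<omega>) / s)) \<partial>std_normal_on I)" for \<omega>
  proof -
    have "complex_of_real (\<Prod>k\<in>I. exp (- (y k - X k \<omega>)\<^sup>2 / (2 * s\<^sup>2)))
        = (\<Prod>k\<in>I. \<integral>l. iexp (l * ((y k - X k \<omega>) / s)) \<partial>std_normal_distribution)"
      unfolding of_real_prod exp_square_eq_char[symmetric]
      by (simp add: power_divide mult.commute)
    also have "\<dots> = (\<integral>l. (\<Prod>k\<in>I. iexp (l k * ((y k - X k \<omega>) / s))) \<partial>std_normal_on I)"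
      by (rule G.product_integral_prod[OF fin, symmetric])
         (rule integrable_iexp'[OF N.prob_space_axioms], simp cong: measurable_cong_sets)
    also have "(\<lambda>l. \<Prod>k\<in>I. iexp (l k * ((y k - X k \<omega>) / s)))
        = (\<lambda>l. iexp (\<Sum>k\<in>I. l k * ((y k - X k \<omega>) / s)))"
      using fin by (simp add: exp_sum[symmetric] sum_distrib_left)
    finally show ?thesis .
  qed
  then have "complex_of_real (\<integral>\<omega>. (\<Prod>k\<in>I. exp (- (y k - X k \<omega>)\<^sup>2 / (2 * s\<^sup>2))) \<partial>M)
      = (\<integral>\<omega>. (\<integral>l. iexp (\<Sum>k\<in>I. l k * ((y k - X k \<omega>) / s)) \<partial>std_normal_on I) \<partial>M)"
    by (subst integral_complex_of_real[symmetric]) simp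
  also have "\<dots> = (\<integral>l. (\<integral>\<omega>. iexp (\<Sum>k\<in>I. l k * ((y k - X k \<omega>) / s)) \<partial>M) \<partial>std_normal_on I)"
    by (rule P.Fubini_integral[OF int])
  finally show ?thesis .
qed

lemma integral_iexp_shift:
  "(\<integral>\<omega>. iexp (\<Sum>k\<in>I. l k * ((y k - Z k \<omega>) / s)) \<partial>K)
    = iexp (\<Sum>k\<in>I. l k * y k / s) * (\<integral>\<omega>. iexp (\<Sum>k\<in>I. (- l k / s) * Z k \<omega>) \<partial>K)"
proof -
  have "(\<Sum>k\<in>I. l k * ((y k - Z k \<omega>) / s))
      = (\<Sum>k\<in>I. l k * y k / s) + (\<Sum>k\<in>I. (- l k / s) * Z k \<omega>)" for \<omega>
    unfolding sum.distrib[symmetric]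
    by (intro sum.cong refl) (simp add: diff_divide_distrib right_diff_distrib)
  then show ?thesis by (simp add: distrib_left exp_add)
qed

lemma measurable_iexp_average:
  assumes K: "prob_space K" and Z[measurable]: "\<And>k. k \<in> I \<Longrightarrow> Z k \<in> borel_measurable K"
  shows "(\<lambda>l. \<integral>\<omega>. iexp (\<Sum>k\<in>I. l k * ((y k - Z k \<omega>) / s)) \<partial>K)
    \<in> borel_measurable (std_normal_on I)"
proof -
  interpret K: prob_space K by fact
  have [measurable]: "(\<lambda>l. l k) \<in> borel_measurable (std_normal_on I)" if "k \<in> I" for k
    using measurable_component_singleton[OF that, of "\<lambda>_. std_normal_distribution"]
    by (simp cong: measurable_cong_sets)
  show ?thesis by measurable
qed

lemma norm_integral_iexp_le:
  assumes "prob_space K"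
  shows "norm (\<integral>\<omega>. iexp (f \<omega>) \<partial>K) \<le> 1"
proof -
  interpret K: prob_space K by fact
  have "norm (\<integral>\<omega>. iexp (f \<omega>) \<partial>K) \<le> (\<integral>\<omega>. norm (iexp (f \<omega>)) \<partial>K)" by (rule integral_norm_bound)
  then show ?thesis by (simp add: K.prob_space)
qed

text \<open>Both sides are Gaussian averages of characteristic functions, which are bounded by 1, so
  pointwise convergence of the latter is enough. The limit variables \<open>Y\<close> are given,
  hence no tightness argument has to produce a limit.\<close>

lemma gaussian_kernel_tendsto:
  assumes M: "\<And>n. prob_space (M n)" "prob_space M'" and fin: "finite I"
    and X: "\<And>n k. k \<in> I \<Longrightarrow> X n k \<in> borel_measurable (M n)"
    and Y: "\<And>k. k \<in> I \<Longrightarrow> Y k \<in> borel_measurable M'"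
    and char: "\<And>u. (\<lambda>n. \<integral>\<omega>. iexp (\<Sum>k\<in>I. u k * X n k \<omega>) \<partial>M n) \<longlonglongrightarrow> (\<integral>\<omega>. iexp (\<Sum>k\<in>I. u k * Y k \<omega>) \<partial>M')"
  shows "(\<lambda>n. \<integral>\<omega>. (\<Prod>k\<in>I. exp (- (y k - X n k \<omega>)\<^sup>2 / (2 * s\<^sup>2))) \<partial>M n)
    \<longlonglongrightarrow> (\<integral>\<omega>. (\<Prod>k\<in>I. exp (- (y k - Y k \<omega>)\<^sup>2 / (2 * s\<^sup>2))) \<partial>M')"
proof -
  let ?G = "std_normal_on I"
  interpret N: prob_space std_normal_distribution
    by (rule real_distribution.axioms(1)[OF real_dist_normal_dist])
  interpret G: product_prob_space "\<lambda>_. std_normal_distribution" I by standard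
  have [measurable]: "(\<lambda>l. l k) \<in> borel_measurable ?G" if "k \<in> I" for k
    using measurable_component_singleton[OF that, of "\<lambda>_. std_normal_distribution"]
    by (simp cong: measurable_cong_sets)
  have "(\<lambda>n. \<integral>l. (\<integral>\<omega>. iexp (\<Sum>k\<in>I. l k * ((y k - X n k \<omega>) / s)) \<partial>M n) \<partial>?G)
    \<longlonglongrightarrow> (\<integral>l. (\<integral>\<omega>. iexp (\<Sum>k\<in>I. l k * ((y k - Y k \<omega>) / s)) \<partial>M') \<partial>?G)"
  proof (rule integral_dominated_convergence[where w = "\<lambda>_. 1"])
    show "AE l in ?G. (\<lambda>n. \<integral>\<omega>. iexp (\<Sum>k\<in>I. l k * ((y k - X n k \<omega>) / s)) \<partial>M n)
        \<longlonglongrightarrow> (\<integral>\<omega>. iexp (\<Sum>k\<in>I. l k * ((y k - Y k \<omega>) / s)) \<partial>M')"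
      unfolding integral_iexp_shift by (intro AE_I2 tendsto_intros char)
    show "(\<lambda>l. \<integral>\<omega>. iexp (\<Sum>k\<in>I. l k * ((y k - Y k \<omega>) / s)) \<partial>M') \<in> borel_measurable ?G"
      by (rule measurable_iexp_average[OF M(2) Y])
    show "(\<lambda>l. \<integral>\<omega>. iexp (\<Sum>k\<in>I. l k * ((y k - X n k \<omega>) / s)) \<partial>M n) \<in> borel_measurable ?G" for n
      by (rule measurable_iexp_average[OF M(1) X])
    show "AE l in ?G. norm (\<integral>\<omega>. iexp (\<Sum>k\<in>I. l k * ((y k - X n k \<omega>) / s)) \<partial>M n) \<le> 1" for n
      by (intro AE_I2 norm_integral_iexp_le M)
  qed simp
  then have "(\<lambda>n. complex_of_real (\<integral>\<omega>. (\<Prod>k\<in>I. exp (- (y k - X n k \<omega>)\<^sup>2 / (2 * s\<^sup>2))) \<partial>M n))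
    \<longlonglongrightarrow> complex_of_real (\<integral>\<omega>. (\<Prod>k\<in>I. exp (- (y k - Y k \<omega>)\<^sup>2 / (2 * s\<^sup>2))) \<partial>M')"
    by (subst (1 2) expectation_gaussian_kernel) (use M fin X Y in auto)
  then show ?thesis by (simp add: tendsto_of_real_iff)
qed

text \<open>Since both masses are 1, the integral of \<open>\<bar>f n - g\<bar>\<close> is twice
  that of the positive part of \<open>g - f n\<close>, and this positive part is dominated by
  \<open>g\<close>.\<close>

lemma Scheffe:
  fixes f :: "nat \<Rightarrow> 'a \<Rightarrow> real"
  assumes int: "\<And>n. integrable M (f n)" "integrable M g"
    and nonneg: "\<And>n x. 0 \<le> f n x" "\<And>x. 0 \<le> g x"
    and lim: "\<And>x. (\<lambda>n. f n x) \<longlonglongrightarrow> g x"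
    and mass: "\<And>n. integral\<^sup>L M (f n) = 1" "integral\<^sup>L M g = 1"
  shows "(\<lambda>n. \<integral>x. \<bar>f n x - g x\<bar> \<partial>M) \<longlonglongrightarrow> 0"
proof -
  have [measurable]: "f n \<in> borel_measurable M" "g \<in> borel_measurable M" for n using int by auto
  have "(\<lambda>n. max 0 (g x - f n x)) \<longlonglongrightarrow> max 0 (g x - g x)" for x
    by (intro tendsto_intros lim)
  note lim' = this
  have "(\<lambda>n. \<integral>x. max 0 (g x - f n x) \<partial>M) \<longlonglongrightarrow> (\<integral>x. max 0 (g x - g x) \<partial>M)"
    by (rule integral_dominated_convergence[where w = g])
       (use int nonneg lim' in \<open>auto intro!: AE_I2\<close>)
  then have "(\<lambda>n. 2 * (\<integral>x. max 0 (g x - f n x) \<partial>M)) \<longlonglongrightarrow> 0"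
    by (auto intro: tendsto_mult_right_zero)
  moreover have "(\<integral>x. \<bar>f n x - g x\<bar> \<partial>M) = 2 * (\<integral>x. max 0 (g x - f n x) \<partial>M)" for n
  proof -
    have i: "integrable M (\<lambda>x. max 0 (g x - f n x))"
      using int by (intro integrable_max) auto
    have "(\<integral>x. \<bar>f n x - g x\<bar> \<partial>M) = (\<integral>x. 2 * max 0 (g x - f n x) + (f n x - g x) \<partial>M)"
      by (intro Bochner_Integration.integral_cong) (auto simp: max_def abs_if)
    also have "\<dots> = 2 * (\<integral>x. max 0 (g x - f n x) \<partial>M) + (integral\<^sup>L M (f n) - integral\<^sup>L M g)"
      using int i by (subst Bochner_Integration.integral_add) (auto simp: Bochner_Integration.integral_diff)
    finally show ?thesis using mass by simp
  qed
  ultimately show ?thesis by simp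
qed

section \<open>Gaussian smoothing of Lipschitz functions\<close>

definition gauss_kernel :: "'i set \<Rightarrow> real \<Rightarrow> ('i \<Rightarrow> real) \<Rightarrow> ('i \<Rightarrow> real) \<Rightarrow> real" where
  "gauss_kernel I s x y = (\<Prod>k\<in>I. normal_density (x k) s (y k))"

lemma gauss_kernel_nonneg: "0 \<le> gauss_kernel I s x y"
  unfolding gauss_kernel_def by (intro prod_nonneg) simp

lemma gauss_kernel_eq:
  assumes "s > 0"
  shows "gauss_kernel I s x y = (1 / sqrt (2 * pi * s\<^sup>2)) ^ card I * (\<Prod>k\<in>I. exp (- (y k - x k)\<^sup>2 / (2 * s\<^sup>2)))"
  unfolding gauss_kernel_def normal_density_def by (simp add: prod_dividef power_one_over)

lemma
  assumes fin: "finite I" and s: "s > 0"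
  shows integrable_gauss_kernel: "integrable (lborel_on I) (gauss_kernel I s x)"
    and integral_gauss_kernel: "integral\<^sup>L (lborel_on I) (gauss_kernel I s x) = 1"
proof -
  interpret product_sigma_finite "\<lambda>_::'a. lborel :: real measure" by standard
  show "integrable (lborel_on I) (gauss_kernel I s x)"
    unfolding gauss_kernel_def using s by (intro product_integrable_prod fin) auto
  show "integral\<^sup>L (lborel_on I) (gauss_kernel I s x) = 1"
    unfolding gauss_kernel_def using s by (subst product_integral_prod[OF fin]) auto
qed

lemma
  assumes fin: "finite I" and s: "s > 0" and j: "j \<in> I"
  shows integrable_gauss_kernel_dev: "integrable (lborel_on I) (\<lambda>y. \<bar>y j - x j\<bar> * gauss_kernel I s x y)"
    and integral_gauss_kernel_dev: "(\<integral>y. \<bar>y j - x j\<bar> * gauss_kernel I s x y \<partial>lborel_on I) = s * sqrt (2 / pi)"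
proof -
  interpret product_sigma_finite "\<lambda>_::'a. lborel :: real measure" by standard
  \<comment> \<open>The deviation is assigned to the factor of coordinate \<open>j\<close>, so that
    the integrand stays a product over the coordinates.\<close>
  define h where "h = (\<lambda>k z. (if k = j then \<bar>z - x k\<bar> else 1) * normal_density (x k) s z)"
  have eq: "\<bar>y j - x j\<bar> * gauss_kernel I s x y = (\<Prod>k\<in>I. h k (y k))" for y
    unfolding h_def gauss_kernel_def prod.distrib using fin j by (simp add: prod.delta)
  have int: "integrable lborel (h k)" for k
    unfolding h_def using s integrable_normal_moment_abs[of s "x k" 1]
    by (cases "k = j") (simp_all add: mult.commute)
  have val: "integral\<^sup>L lborel (h k) = (if k = j then s * sqrt (2 / pi) else 1)" for k
    unfolding h_def using s integral_normal_moment_abs_odd[of s "x k" 0]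
    by (cases "k = j") (simp_all add: mult.commute)
  show "integrable (lborel_on I) (\<lambda>y. \<bar>y j - x j\<bar> * gauss_kernel I s x y)"
    unfolding eq by (intro product_integrable_prod fin int)
  show "(\<integral>y. \<bar>y j - x j\<bar> * gauss_kernel I s x y \<partial>lborel_on I) = s * sqrt (2 / pi)"
    unfolding eq using fin j by (subst product_integral_prod[OF fin int]) (simp add: val prod.delta)
qed

text \<open>Smoothing displaces each coordinate by \<open>s * sqrt (2 / pi)\<close> on average, the
  mean absolute value of a centred normal variable with deviation \<open>s\<close>, and a Lipschitz
  function changes at most proportionally.\<close>

lemma gauss_kernel_smoothing:
  fixes g :: "('i \<Rightarrow> real) \<Rightarrow> real"
  assumes fin: "finite I" and s: "s > 0"
    and meas[measurable]: "g \<in> borel_measurable (lborel_on I)"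
    and B: "\<And>x. \<bar>g x\<bar> \<le> B" and L: "\<And>x y. \<bar>g x - g y\<bar> \<le> (\<Sum>k\<in>I. L * \<bar>x k - y k\<bar>)"
  shows "\<bar>g x - (\<integral>y. g y * gauss_kernel I s x y \<partial>lborel_on I)\<bar> \<le> real (card I) * (L * (s * sqrt (2 / pi)))"
proof -
  note int = integrable_gauss_kernel[OF fin s, of x]
  have [measurable]: "gauss_kernel I s x \<in> borel_measurable (lborel_on I)" using int by auto
  have ig: "integrable (lborel_on I) (\<lambda>y. g y * gauss_kernel I s x y)"
  proof (rule Bochner_Integration.integrable_bound)
    show "integrable (lborel_on I) (\<lambda>y. B * gauss_kernel I s x y)" using int by simp
    have "0 \<le> B" using B[of x] by linarith
    then show "AE y in lborel_on I. norm (g y * gauss_kernel I s x y) \<le> norm (B * gauss_kernel I s x y)"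
      using B by (intro AE_I2) (auto simp: abs_mult intro!: mult_right_mono)
  qed simp
  have "g x - (\<integral>y. g y * gauss_kernel I s x y \<partial>lborel_on I)
      = (\<integral>y. g x * gauss_kernel I s x y \<partial>lborel_on I) - (\<integral>y. g y * gauss_kernel I s x y \<partial>lborel_on I)"
    by (simp add: integral_gauss_kernel[OF fin s])
  also have "\<dots> = (\<integral>y. (g x - g y) * gauss_kernel I s x y \<partial>lborel_on I)"
    using int ig by (subst Bochner_Integration.integral_diff[symmetric]) (auto simp: left_diff_distrib)
  also have "\<bar>\<dots>\<bar> \<le> (\<integral>y. (\<Sum>k\<in>I. L * (\<bar>y k - x k\<bar> * gauss_kernel I s x y)) \<partial>lborel_on I)"
  proof (rule abs_integral_le)
    show "integrable (lborel_on I) (\<lambda>y. (g x - g y) * gauss_kernel I s x y)"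
      unfolding left_diff_distrib using int ig by auto
    show "integrable (lborel_on I) (\<lambda>y. \<Sum>k\<in>I. L * (\<bar>y k - x k\<bar> * gauss_kernel I s x y))"
      using integrable_gauss_kernel_dev[OF fin s] by auto
    fix y
    have "\<bar>(g x - g y) * gauss_kernel I s x y\<bar> \<le> (\<Sum>k\<in>I. L * \<bar>x k - y k\<bar>) * gauss_kernel I s x y"
      using L[of x y] gauss_kernel_nonneg[of I s x y] by (simp add: abs_mult mult_right_mono)
    then show "\<bar>(g x - g y) * gauss_kernel I s x y\<bar> \<le> (\<Sum>k\<in>I. L * (\<bar>y k - x k\<bar> * gauss_kernel I s x y))"
      by (simp add: sum_distrib_right sum_distrib_left abs_minus_commute mult_ac)
  qed
  also have "\<dots> = (\<Sum>k\<in>I. L * (s * sqrt (2 / pi)))"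
    using integrable_gauss_kernel_dev[OF fin s]
    by (subst Bochner_Integration.integral_sum) (auto simp: integral_gauss_kernel_dev[OF fin s] intro!: sum.cong)
  finally show ?thesis by simp
qed

text \<open>Fubini for the law of \<open>X\<close> and the smoothing kernel: averaging the kernel
  over \<open>M\<close> yields the density of \<open>X\<close> plus independent Gaussian
  noise.\<close>

lemma
  assumes M: "prob_space M" and fin: "finite I" and s: "s > 0"
    and X[measurable]: "\<And>k. k \<in> I \<Longrightarrow> X k \<in> borel_measurable M"
    and meas[measurable]: "g \<in> borel_measurable (lborel_on I)"
    and B: "\<And>x. \<bar>g x\<bar> \<le> B"
  shows integrable_averaged_gauss_kernel:
      "integrable (lborel_on I) (\<lambda>y. g y * (\<integral>\<omega>. gauss_kernel I s (\<lambda>k. X k \<omega>) y \<partial>M))"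
    and integral_averaged_gauss_kernel:
      "(\<integral>y. g y * (\<integral>\<omega>. gauss_kernel I s (\<lambda>k. X k \<omega>) y \<partial>M) \<partial>lborel_on I)
        = (\<integral>\<omega>. (\<integral>y. g y * gauss_kernel I s (\<lambda>k. X k \<omega>) y \<partial>lborel_on I) \<partial>M)"
    and measurable_averaged_gauss_kernel:
      "(\<lambda>\<omega>. \<integral>y. g y * gauss_kernel I s (\<lambda>k. X k \<omega>) y \<partial>lborel_on I) \<in> borel_measurable M"
proof -
  interpret M: prob_space M by fact
  interpret product_sigma_finite "\<lambda>_::'b. lborel :: real measure" by standard
  interpret L: sigma_finite_measure "lborel_on I" by (rule sigma_finite[OF fin])
  interpret P: pair_sigma_finite M "lborel_on I" ..
  have [measurable]: "(\<lambda>(\<omega>, y). gauss_kernel I s (\<lambda>k. X k \<omega>) y) \<in> borel_measurable (M \<Otimes>\<^sub>M lborel_on I)"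
  proof -
    have [measurable]: "(\<lambda>l. l k) \<in> borel_measurable (lborel_on I)" if "k \<in> I" for k
      using measurable_component_singleton[OF that, of "\<lambda>_. lborel"] by simp
    show ?thesis unfolding gauss_kernel_def split_beta normal_density_def by measurable
  qed
  have int: "integrable (M \<Otimes>\<^sub>M lborel_on I) (\<lambda>(\<omega>, y). gauss_kernel I s (\<lambda>k. X k \<omega>) y)"
  proof (rule P.Fubini_integrable)
    show "integrable M (\<lambda>\<omega>. \<integral>y. norm (case (\<omega>, y) of (\<omega>, y) \<Rightarrow> gauss_kernel I s (\<lambda>k. X k \<omega>) y) \<partial>lborel_on I)"
      by (simp add: gauss_kernel_nonneg integral_gauss_kernel[OF fin s])
  qed (auto intro!: integrable_gauss_kernel[OF fin s])
  have int': "integrable (M \<Otimes>\<^sub>M lborel_on I) (\<lambda>(\<omega>, y). g y * gauss_kernel I s (\<lambda>k. X k \<omega>) y)"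
  proof (rule Bochner_Integration.integrable_bound)
    show "integrable (M \<Otimes>\<^sub>M lborel_on I) (\<lambda>p. B * (case p of (\<omega>, y) \<Rightarrow> gauss_kernel I s (\<lambda>k. X k \<omega>) y))"
      using int by simp
    have "0 \<le> B" using B[of undefined] by linarith
    then show "AE p in M \<Otimes>\<^sub>M lborel_on I. norm (case p of (\<omega>, y) \<Rightarrow> g y * gauss_kernel I s (\<lambda>k. X k \<omega>) y)
        \<le> norm (B * (case p of (\<omega>, y) \<Rightarrow> gauss_kernel I s (\<lambda>k. X k \<omega>) y))"
      using B by (intro AE_I2) (auto simp: abs_mult intro!: mult_right_mono split: prod.split)
  qed (unfold split_beta, measurable)
  show "integrable (lborel_on I) (\<lambda>y. g y * (\<integral>\<omega>. gauss_kernel I s (\<lambda>k. X k \<omega>) y \<partial>M))"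
    using P.integrable_snd[OF int'] by simp
  show "(\<integral>y. g y * (\<integral>\<omega>. gauss_kernel I s (\<lambda>k. X k \<omega>) y \<partial>M) \<partial>lborel_on I)
      = (\<integral>\<omega>. (\<integral>y. g y * gauss_kernel I s (\<lambda>k. X k \<omega>) y \<partial>lborel_on I) \<partial>M)"
    using P.Fubini_integral[OF int'] by simp
  show "(\<lambda>\<omega>. \<integral>y. g y * gauss_kernel I s (\<lambda>k. X k \<omega>) y \<partial>lborel_on I) \<in> borel_measurable M"
    using P.integrable_fst[OF int'] by auto
qed

lemma expectation_near_smoothed:
  assumes K: "prob_space K" and fin: "finite I" and s: "s > 0"
    and Z: "\<And>k. k \<in> I \<Longrightarrow> Z k \<in> borel_measurable K"
    and gZ: "(\<lambda>\<omega>. g (\<lambda>k. Z k \<omega>)) \<in> borel_measurable K"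
    and meas: "g \<in> borel_measurable (lborel_on I)" and B: "\<And>x. \<bar>g x\<bar> \<le> B"
    and smooth: "\<And>x. \<bar>g x - (\<integral>y. g y * gauss_kernel I s x y \<partial>lborel_on I)\<bar> \<le> d"
  shows "\<bar>(\<integral>\<omega>. g (\<lambda>k. Z k \<omega>) \<partial>K) - (\<integral>y. g y * (\<integral>\<omega>. gauss_kernel I s (\<lambda>k. Z k \<omega>) y \<partial>K) \<partial>lborel_on I)\<bar> \<le> d"
proof -
  interpret K: prob_space K by fact
  have i1: "integrable K (\<lambda>\<omega>. g (\<lambda>k. Z k \<omega>))"
    by (rule K.integrable_const_bound[of _ B]) (use B gZ in auto)
  have i2: "integrable K (\<lambda>\<omega>. \<integral>y. g y * gauss_kernel I s (\<lambda>k. Z k \<omega>) y \<partial>lborel_on I)"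
  proof (rule K.integrable_const_bound[of _ "B + d"])
    show "AE \<omega> in K. norm (\<integral>y. g y * gauss_kernel I s (\<lambda>k. Z k \<omega>) y \<partial>lborel_on I) \<le> B + d"
    proof (rule AE_I2)
      fix \<omega>
      show "norm (\<integral>y. g y * gauss_kernel I s (\<lambda>k. Z k \<omega>) y \<partial>lborel_on I) \<le> B + d"
        using smooth[of "\<lambda>k. Z k \<omega>"] B[of "\<lambda>k. Z k \<omega>"] unfolding real_norm_def by linarith
    qed
  qed (rule measurable_averaged_gauss_kernel[OF K fin s Z meas B])
  have "\<bar>\<integral>\<omega>. g (\<lambda>k. Z k \<omega>) - (\<integral>y. g y * gauss_kernel I s (\<lambda>k. Z k \<omega>) y \<partial>lborel_on I) \<partial>K\<bar>
      \<le> (\<integral>\<omega>. d \<partial>K)"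
    by (rule abs_integral_le) (use i1 i2 smooth in auto)
  then show ?thesis
    using i1 i2 by (simp add: integral_averaged_gauss_kernel[OF K fin s Z meas B] K.prob_space)
qed
text \<open>After smoothing with a Gaussian kernel the laws have densities; these converge pointwise, hence in
  mean by Scheffe's lemma.\<close>

lemma expectation_lipschitz_tendsto:
  fixes g :: "('i \<Rightarrow> real) \<Rightarrow> real" and M :: "nat \<Rightarrow> 'a measure" and M' :: "'b measure"
  assumes M: "\<And>n. prob_space (M n)" "prob_space M'" and fin: "finite I"
    and X: "\<And>n k. k \<in> I \<Longrightarrow> X n k \<in> borel_measurable (M n)"
    and Y: "\<And>k. k \<in> I \<Longrightarrow> Y k \<in> borel_measurable M'"
    and char: "\<And>u. (\<lambda>n. \<integral>\<omega>. iexp (\<Sum>k\<in>I. u k * X n k \<omega>) \<partial>M n) \<longlonglongrightarrow> (\<integral>\<omega>. iexp (\<Sum>k\<in>I. u k * Y k \<omega>) \<partial>M')"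
    and meas[measurable]: "g \<in> borel_measurable (lborel_on I)"
    and gX: "\<And>n. (\<lambda>\<omega>. g (\<lambda>k. X n k \<omega>)) \<in> borel_measurable (M n)"
    and gY: "(\<lambda>\<omega>. g (\<lambda>k. Y k \<omega>)) \<in> borel_measurable M'"
    and B: "\<And>x. \<bar>g x\<bar> \<le> B" and L: "\<And>x y. \<bar>g x - g y\<bar> \<le> (\<Sum>k\<in>I. L * \<bar>x k - y k\<bar>)"
  shows "(\<lambda>n. \<integral>\<omega>. g (\<lambda>k. X n k \<omega>) \<partial>M n) \<longlonglongrightarrow> (\<integral>\<omega>. g (\<lambda>k. Y k \<omega>) \<partial>M')"
proof (rule tendstoI)
  fix e :: real assume e: "e > 0"
  define C where "C = real (card I) * (\<bar>L\<bar> * sqrt (2 / pi))"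
  have C: "0 \<le> C" by (simp add: C_def)
  \<comment> \<open>Makes the smoothing error at most \<open>e / 3\<close> under every law; the
    \<open>+ 1\<close> keeps the denominator positive when \<open>C = 0\<close>.\<close>
  define s where "s = e / (3 * (C + 1))"
  have s: "s > 0" and sC: "s * C < e / 3"
    using e C by (auto simp: s_def field_simps)
  have L': "\<bar>g x - g y\<bar> \<le> (\<Sum>k\<in>I. \<bar>L\<bar> * \<bar>x k - y k\<bar>)" for x y
    using L[of x y] by (rule order_trans) (intro sum_mono mult_right_mono, auto)
  have smooth: "\<bar>g x - (\<integral>y. g y * gauss_kernel I s x y \<partial>lborel_on I)\<bar> \<le> e / 3" for x
    using gauss_kernel_smoothing[OF fin s meas B L', of x] sC by (simp add: C_def mult_ac)
  define R where "R = (\<lambda>n y. \<integral>\<omega>. gauss_kernel I s (\<lambda>k. X n k \<omega>) y \<partial>M n)"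
  define R' where "R' = (\<lambda>y. \<integral>\<omega>. gauss_kernel I s (\<lambda>k. Y k \<omega>) y \<partial>M')"
  have Rlim: "(\<lambda>n. R n y) \<longlonglongrightarrow> R' y" for y
    unfolding R_def R'_def gauss_kernel_eq[OF s] using gaussian_kernel_tendsto[OF M fin X Y char]
    by (auto intro!: tendsto_mult_left)
  have Rint: "integrable (lborel_on I) (R n)" "integral\<^sup>L (lborel_on I) (R n) = 1" for n
  proof -
    interpret K: prob_space "M n" by (rule M)
    have "integrable (lborel_on I) (\<lambda>y. 1 * R n y)"
      unfolding R_def by (rule integrable_averaged_gauss_kernel[where B = 1]) (use M fin s X in auto)
    then show "integrable (lborel_on I) (R n)" by simp
    have "(\<integral>y. 1 * R n y \<partial>lborel_on I) = (\<integral>\<omega>. (\<integral>y. 1 * gauss_kernel I s (\<lambda>k. X n k \<omega>) y \<partial>lborel_on I) \<partial>M n)"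
      unfolding R_def by (rule integral_averaged_gauss_kernel[where B = 1]) (use M fin s X in auto)
    then show "integral\<^sup>L (lborel_on I) (R n) = 1"
      by (simp add: integral_gauss_kernel[OF fin s] K.prob_space)
  qed
  interpret K: prob_space M' by (rule M)
  have R'int: "integrable (lborel_on I) R'" "integral\<^sup>L (lborel_on I) R' = 1"
  proof -
    have "integrable (lborel_on I) (\<lambda>y. 1 * R' y)"
      unfolding R'_def by (rule integrable_averaged_gauss_kernel[where B = 1]) (use M fin s Y in auto)
    then show "integrable (lborel_on I) R'" by simp
    have "(\<integral>y. 1 * R' y \<partial>lborel_on I) = (\<integral>\<omega>. (\<integral>y. 1 * gauss_kernel I s (\<lambda>k. Y k \<omega>) y \<partial>lborel_on I) \<partial>M')"
      unfolding R'_def by (rule integral_averaged_gauss_kernel[where B = 1]) (use M fin s Y in auto)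
    then show "integral\<^sup>L (lborel_on I) R' = 1"
      by (simp add: integral_gauss_kernel[OF fin s] K.prob_space)
  qed
  have nonneg: "0 \<le> R n y" "0 \<le> R' y" for n y
    unfolding R_def R'_def by (auto intro!: Bochner_Integration.integral_nonneg gauss_kernel_nonneg)
  have lim0: "(\<lambda>n. B * (\<integral>y. \<bar>R n y - R' y\<bar> \<partial>lborel_on I)) \<longlonglongrightarrow> 0"
    by (intro tendsto_mult_right_zero Scheffe Rint R'int nonneg Rlim)
  have diff: "\<bar>(\<integral>y. g y * R n y \<partial>lborel_on I) - (\<integral>y. g y * R' y \<partial>lborel_on I)\<bar>
      \<le> B * (\<integral>y. \<bar>R n y - R' y\<bar> \<partial>lborel_on I)" for n
  proof -
    have i1: "integrable (lborel_on I) (\<lambda>y. g y * R n y)"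
      unfolding R_def by (rule integrable_averaged_gauss_kernel[OF M(1) fin s X meas B])
    have i2: "integrable (lborel_on I) (\<lambda>y. g y * R' y)"
      unfolding R'_def by (rule integrable_averaged_gauss_kernel[OF M(2) fin s Y meas B])
    have "\<bar>\<integral>y. g y * R n y - g y * R' y \<partial>lborel_on I\<bar> \<le> (\<integral>y. B * \<bar>R n y - R' y\<bar> \<partial>lborel_on I)"
    proof (rule abs_integral_le)
      fix y
      have "\<bar>g y * R n y - g y * R' y\<bar> = \<bar>g y\<bar> * \<bar>R n y - R' y\<bar>"
        by (simp add: abs_mult flip: right_diff_distrib)
      then show "\<bar>g y * R n y - g y * R' y\<bar> \<le> B * \<bar>R n y - R' y\<bar>"
        using B by (simp add: mult_right_mono)
    qed (use i1 i2 Rint R'int in auto)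
    then show ?thesis using i1 i2 by simp
  qed
  have "\<forall>\<^sub>F n in sequentially. B * (\<integral>y. \<bar>R n y - R' y\<bar> \<partial>lborel_on I) < e / 3"
    using lim0 by (rule order_tendstoD) (use e in simp)
  then show "\<forall>\<^sub>F n in sequentially. dist (\<integral>\<omega>. g (\<lambda>k. X n k \<omega>) \<partial>M n) (\<integral>\<omega>. g (\<lambda>k. Y k \<omega>) \<partial>M') < e"
  proof eventually_elim
    case (elim n)
    show ?case
      using expectation_near_smoothed[OF M(1)[of n] fin s X gX meas B smooth] expectation_near_smoothed[OF M(2) fin s Y gY meas B smooth] diff[of n] elim
      unfolding dist_real_def R_def R'_def by linarith
  qed
qed

section \<open>Conditioned sums of independent indicators\<close>

text \<open>The probability that exactly \<open>S\<close> is selected when each \<open>j\<close> in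
  \<open>A\<close> is selected independently with probability \<open>p j\<close>.\<close>

definition bern :: "('i \<Rightarrow> real) \<Rightarrow> 'i set \<Rightarrow> 'i set \<Rightarrow> real" where
  "bern p A S = (\<Prod>j\<in>S. p j) * (\<Prod>j\<in>A - S. 1 - p j)"

text \<open>The characteristic function of an indicator minus its mean \<open>p\<close>.\<close>

definition bern_char :: "real \<Rightarrow> real \<Rightarrow> complex" where
  "bern_char p x = p * iexp ((1 - p) * x) + (1 - p) * iexp (- p * x)"

lemma bern_nonneg: "(\<And>j. j \<in> A \<Longrightarrow> p j \<in> {0..1}) \<Longrightarrow> S \<subseteq> A \<Longrightarrow> 0 \<le> bern p A S"
  unfolding bern_def by (intro mult_nonneg_nonneg prod_nonneg) auto

lemma sum_bern: "finite A \<Longrightarrow> (\<Sum>S\<in>Pow A. bern p A S) = 1"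
  unfolding bern_def by (subst prod_add[symmetric]) auto

lemma iexp_add: "iexp (x + y) = iexp x * iexp y"
  by (simp add: distrib_left exp_add)

lemma iexp_sum: "finite A \<Longrightarrow> iexp (\<Sum>j\<in>A. f j) = (\<Prod>j\<in>A. iexp (f j))"
  by (simp add: sum_distrib_left exp_sum)

text \<open>Expanding the product over the selected sets expresses the independence of the steps.
  The common frequency \<open>x\<close> is dual to the number of selected indices and the shifts
  \<open>w j\<close> carry a linear statistic, so that the condition on the number can be imposed by
  integrating over \<open>x\<close>.\<close>

lemma prod_bern_char:
  assumes fin: "finite A"
  shows "(\<Prod>j\<in>A. bern_char (p j) (x + w j))
    = (\<Sum>S\<in>Pow A. bern p A S * iexp ((\<Sum>j\<in>S. w j) - (\<Sum>j\<in>A. p j * w j))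
        * iexp ((real (card S) - (\<Sum>j\<in>A. p j)) * x))"
proof -
  have "(\<Prod>j\<in>A. bern_char (p j) (x + w j))
      = (\<Sum>S\<in>Pow A. (\<Prod>j\<in>S. complex_of_real (p j) * iexp ((1 - p j) * (x + w j)))
          * (\<Prod>j\<in>A - S. complex_of_real (1 - p j) * iexp (- p j * (x + w j))))"
    unfolding bern_char_def prod_add[OF fin, symmetric] by simp
  also have "\<dots> = (\<Sum>S\<in>Pow A. bern p A S * iexp ((\<Sum>j\<in>S. w j) - (\<Sum>j\<in>A. p j * w j))
        * iexp ((real (card S) - (\<Sum>j\<in>A. p j)) * x))"
  proof (rule sum.cong[OF refl])
    fix S assume "S \<in> Pow A"
    then have S: "S \<subseteq> A" "finite S" "finite (A - S)" using fin finite_subset by auto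
    have split: "(\<Sum>j\<in>A. f j) = (\<Sum>j\<in>S. f j) + (\<Sum>j\<in>A - S. f j)" for f :: "_ \<Rightarrow> real"
      using sum.subset_diff[OF S(1) fin, of f] by simp
    have "(\<Sum>j\<in>S. (1 - p j) * (x + w j)) + (\<Sum>j\<in>A - S. - p j * (x + w j))
        = ((\<Sum>j\<in>S. w j) - (\<Sum>j\<in>A. p j * w j)) + (real (card S) - (\<Sum>j\<in>A. p j)) * x"
      unfolding split
      by (simp add: sum_distrib_left sum_distrib_right sum.distrib sum_subtractf sum_negf algebra_simps)
    then have key: "iexp (\<Sum>j\<in>S. (1 - p j) * (x + w j)) * iexp (\<Sum>j\<in>A - S. - p j * (x + w j))
        = iexp ((\<Sum>j\<in>S. w j) - (\<Sum>j\<in>A. p j * w j)) * iexp ((real (card S) - (\<Sum>j\<in>A. p j)) * x)"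
      by (metis iexp_add)
    have bern_eq: "complex_of_real (bern p A S) = (\<Prod>j\<in>S. complex_of_real (p j)) * (\<Prod>j\<in>A - S. complex_of_real (1 - p j))"
      by (simp only: bern_def of_real_mult of_real_prod)
    have regroup: "(u * y) * (v * z) = (u * v) * y' * z'" if "y * z = y' * z'" for u v y z y' z' :: complex
      using that by (metis mult.assoc mult.left_commute)
    show "(\<Prod>j\<in>S. complex_of_real (p j) * iexp ((1 - p j) * (x + w j)))
          * (\<Prod>j\<in>A - S. complex_of_real (1 - p j) * iexp (- p j * (x + w j)))
        = bern p A S * iexp ((\<Sum>j\<in>S. w j) - (\<Sum>j\<in>A. p j * w j)) * iexp ((real (card S) - (\<Sum>j\<in>A. p j)) * x)"
      unfolding prod.distrib iexp_sum[OF S(2), symmetric] iexp_sum[OF S(3), symmetric] bern_eq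
      by (rule regroup[OF key])
  qed
  finally show ?thesis .
qed

section \<open>Fourier inversion over one period\<close>

lemma integral_iexp_period:
  fixes k :: int
  shows "(\<integral>x. indicator {- pi..pi} x *\<^sub>R iexp (of_int k * x) \<partial>lborel) = (if k = 0 then 2 * pi else 0)"
proof (cases "k = 0")
  case True
  have "(\<integral>x. indicator {- pi..pi} x *\<^sub>R (1 :: complex) \<partial>lborel) = 2 * pi"
    by (simp add: scaleR_conv_of_real)
  then show ?thesis using True by simp
next
  case False
  define F where "F = (\<lambda>x. iexp (of_int k * x) / (\<i> * of_int k))"
  have "(\<integral>x. indicator {- pi..pi} x *\<^sub>R iexp (of_int k * x) \<partial>lborel) = F pi - F (- pi)"
  proof (rule integral_FTC_Icc)
    fix x
    have "((\<lambda>z. exp (\<i> * (of_int k * z)) / (\<i> * of_int k)) has_field_derivative iexp (of_int k * x)) (at (complex_of_real x))"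
      using False by (auto intro!: derivative_eq_intros simp: mult_ac)
    then have "((\<lambda>x. exp (\<i> * (of_int k * complex_of_real x)) / (\<i> * of_int k)) has_vector_derivative iexp (of_int k * x)) (at x within {- pi..pi})"
      by (rule has_vector_derivative_real_field)
    then show "(F has_vector_derivative iexp (of_int k * x)) (at x within {- pi..pi})"
      by (simp add: F_def)
  qed (auto intro!: continuous_intros)
  also have "F pi = F (- pi)"
  proof -
    have "iexp (of_int k * pi) = iexp (of_int k * (- pi))"
      by (subst exp_eq) (auto intro!: exI[of _ k])
    then show ?thesis by (simp add: F_def)
  qed
  finally show ?thesis using False by simp
qed

text \<open>The prefactor undoes the centring and leaves the integer frequency
  \<open>card S - N\<close>, whose integral over a full period vanishes unless
  \<open>card S = N\<close>.\<close>

lemma bern_fourier: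
  assumes fin: "finite A"
  shows "(\<integral>x. indicator {- pi..pi} x *\<^sub>R (iexp (((\<Sum>j\<in>A. p j) - real N) * x) * (\<Prod>j\<in>A. bern_char (p j) (x + w j))) \<partial>lborel)
    = 2 * pi * (\<Sum>S | S \<subseteq> A \<and> card S = N. bern p A S * iexp ((\<Sum>j\<in>S. w j) - (\<Sum>j\<in>A. p j * w j)))"
proof -
  have int: "integrable lborel (\<lambda>x. indicator {- pi..pi} x *\<^sub>R iexp (of_int k * x))" for k
    by (rule borel_integrable_atLeastAtMost'[unfolded set_integrable_def]) (intro continuous_intros)
  define B where "B = (\<lambda>S. bern p A S * iexp ((\<Sum>j\<in>S. w j) - (\<Sum>j\<in>A. p j * w j)))"
  have "indicator {- pi..pi} x *\<^sub>R (iexp (((\<Sum>j\<in>A. p j) - real N) * x) * (\<Prod>j\<in>A. bern_char (p j) (x + w j)))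
      = (\<Sum>S\<in>Pow A. B S * (indicator {- pi..pi} x *\<^sub>R iexp (of_int (int (card S) - int N) * x)))" for x
  proof -
    have "iexp (((\<Sum>j\<in>A. p j) - real N) * x) * (B S * iexp ((real (card S) - (\<Sum>j\<in>A. p j)) * x))
        = B S * iexp (of_int (int (card S) - int N) * x)" for S
    proof -
      have "((\<Sum>j\<in>A. p j) - real N) * x + (real (card S) - (\<Sum>j\<in>A. p j)) * x = of_int (int (card S) - int N) * x"
        by (simp add: algebra_simps)
      then show ?thesis by (metis iexp_add mult.left_commute)
    qed
    then show ?thesis
      unfolding prod_bern_char[OF fin] sum_distrib_left scaleR_sum_right B_def
      by (intro sum.cong refl) (simp only: mult_scaleR_right)
  qed
  note expand = this
  have "(\<integral>x. indicator {- pi..pi} x *\<^sub>R (iexp (((\<Sum>j\<in>A. p j) - real N) * x) * (\<Prod>j\<in>A. bern_char (p j) (x + w j))) \<partial>lborel)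
      = (\<Sum>S\<in>Pow A. B S * (\<integral>x. indicator {- pi..pi} x *\<^sub>R iexp (of_int (int (card S) - int N) * x) \<partial>lborel))"
    unfolding expand
    by (subst Bochner_Integration.integral_sum) (intro integrable_mult_right int, simp only: integral_mult_right_zero)
  also have "\<dots> = (\<Sum>S\<in>Pow A. if card S = N then 2 * pi * B S else 0)"
    unfolding integral_iexp_period by (intro sum.cong refl) auto
  also have "\<dots> = (\<Sum>S | S \<subseteq> A \<and> card S = N. 2 * pi * B S)"
    by (rule sum.mono_neutral_cong_right) (use fin in auto)
  finally show ?thesis by (simp add: B_def sum_distrib_left)
qed

section \<open>Bounds for the characteristic function of one step\<close>

lemma sin_ge_quarter:
  fixes y :: real
  assumes "0 \<le> y" "y \<le> 3 * pi / 4"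
  shows "y / 4 \<le> sin y"
proof (cases "y \<le> 1")
  case True
  have "\<bar>sin y - y\<bar> \<le> y ^ 3 / 6"
    using Maclaurin_sin_bound[of y 3] assms(1) by (simp add: eval_nat_numeral sin_coeff_def fact_numeral)
  then have "y - y ^ 3 / 6 \<le> sin y" by linarith
  moreover have "y ^ 3 \<le> y" using True assms(1) power_decreasing[of 1 3 y] by simp
  ultimately show ?thesis using assms(1) by linarith
next
  case False
  have "sin (pi / 4) \<le> sin y"
  proof (cases "y \<le> pi / 2")
    case True
    have "sin (pi / 4) \<le> sin y"
      by (rule sin_monotone_2pi_le) (use True False pi_less_4 pi_gt3 in auto)
    then show ?thesis .
  next
    case F2: False
    have "sin (pi / 4) \<le> sin (pi - y)"
      by (rule sin_monotone_2pi_le) (use F2 assms in auto)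
    then show ?thesis by simp
  qed
  moreover have "3 / 5 \<le> sin (pi / 4 :: real)"
  proof -
    have "6 / 5 \<le> sqrt 2" by (rule real_le_rsqrt) (simp add: power2_eq_square)
    then show ?thesis by (simp add: sin_45)
  qed
  \<comment> \<open>Here \<open>y / 4\<close> is at most \<open>3 * pi / 16\<close>, which lies
    below \<open>3 / 5\<close>, and \<open>3 / 5\<close> lies below
    \<open>sin (pi / 4)\<close>.\<close>
  moreover have "y / 4 \<le> 3 / 5" using assms(2) pi_less_4 pi_approx by simp
  ultimately show ?thesis by linarith
qed

text \<open>The range exceeds the period from \<open>- pi\<close> to \<open>pi\<close> because the
  arguments in \<open>bern_local_limit\<close> are displaced by the weights, by less than
  \<open>pi / 2\<close> for large \<open>n\<close>.\<close>

lemma one_minus_cos_ge: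
  assumes "\<bar>x\<bar> \<le> 3 * pi / 2"
  shows "x\<^sup>2 / 32 \<le> 1 - cos x"
proof -
  have "\<bar>x\<bar> / 2 / 4 \<le> sin (\<bar>x\<bar> / 2)" by (rule sin_ge_quarter) (use assms in auto)
  then have "(\<bar>x\<bar> / 8)\<^sup>2 \<le> (sin (\<bar>x\<bar> / 2))\<^sup>2" by (intro power_mono) auto
  moreover have "cos x = 1 - 2 * (sin (\<bar>x\<bar> / 2))\<^sup>2"
    using cos_double_sin[of "\<bar>x\<bar> / 2"] by simp
  ultimately show ?thesis by (simp add: power2_eq_square)
qed

text \<open>The squared modulus is exactly \<open>1 - 2 * p * (1 - p) * (1 - cos x)\<close>, and
  \<open>1 + u \<le> exp u\<close>.\<close>

lemma norm_bern_char_le_exp: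
  assumes p: "p \<in> {0..1}"
  shows "norm (bern_char p x) \<le> exp (- (p * (1 - p) * (1 - cos x)))"
proof -
  have "bern_char p x = iexp (- p * x) * (p * iexp x + (1 - p))"
  proof -
    have "iexp ((1 - p) * x) = iexp (- p * x) * iexp x"
    proof -
      have "(1 - p) * x = - p * x + x" by (simp add: algebra_simps)
      then show ?thesis by (simp only: iexp_add)
    qed
    then show ?thesis unfolding bern_char_def by (simp only: distrib_left mult_ac of_real_diff of_real_1)
  qed
  then have "norm (bern_char p x) = norm (p * iexp x + (1 - p))"
    by (simp add: norm_mult)
  also have "\<dots> = sqrt ((p * cos x + (1 - p))\<^sup>2 + (p * sin x)\<^sup>2)"
    by (simp add: cmod_def Re_exp Im_exp)
  also have "(p * cos x + (1 - p))\<^sup>2 + (p * sin x)\<^sup>2 = 1 - 2 * (p * (1 - p) * (1 - cos x))"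
  proof -
    have "(p * sin x)\<^sup>2 = p\<^sup>2 * (1 - (cos x)\<^sup>2)" by (simp add: power_mult_distrib sin_squared_eq)
    then show ?thesis by (simp add: power2_eq_square algebra_simps)
  qed
  also have "\<dots> \<le> exp (- 2 * (p * (1 - p) * (1 - cos x)))"
    using exp_ge_add_one_self[of "- 2 * (p * (1 - p) * (1 - cos x))"] by simp
  also have "\<dots> = (exp (- (p * (1 - p) * (1 - cos x))))\<^sup>2"
    by (simp add: power2_eq_square exp_add[symmetric])
  finally show ?thesis by simp
qed

lemma norm_bern_char_le_1:
  assumes "p \<in> {0..1}"
  shows "norm (bern_char p x) \<le> 1"
proof -
  have "0 \<le> p * (1 - p) * (1 - cos x)" using assms by (intro mult_nonneg_nonneg) auto
  then show ?thesis using norm_bern_char_le_exp[OF assms, of x] by (meson exp_le_one_iff neg_le_0_iff_le order_trans)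
qed

lemma norm_bern_char_le:
  assumes p: "p \<in> {0..1}" "v \<le> p * (1 - p)" and x: "\<bar>x\<bar> \<le> 3 * pi / 2" and v: "0 \<le> v"
  shows "norm (bern_char p x) \<le> exp (- (v / 32 * x\<^sup>2))"
proof -
  have "v / 32 * x\<^sup>2 \<le> p * (1 - p) * (1 - cos x)"
    using mult_mono[OF p(2) one_minus_cos_ge[OF x]] p v by auto
  then show ?thesis using norm_bern_char_le_exp[OF p(1), of x] by (meson exp_le_cancel_iff neg_le_iff_le order_trans)
qed

lemma abs_exp_minus_linear:
  fixes y :: real
  assumes "0 \<le> y"
  shows "\<bar>exp (- y) - (1 - y)\<bar> \<le> y\<^sup>2"
proof -
  have "1 - y \<le> exp (- y)" using exp_ge_add_one_self[of "- y"] by simp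
  moreover have "exp (- y) \<le> 1 - y + y\<^sup>2"
  proof -
    \<comment> \<open>The product \<open>(1 + y) * (1 - y + y^2)\<close> equals
      \<open>1 + y^3\<close>.\<close>
    have "0 \<le> (1 + y) * (1 - y + y\<^sup>2) - 1"
      using assms by (simp add: algebra_simps power2_eq_square)
    then have "1 / (1 + y) \<le> 1 - y + y\<^sup>2" using assms by (simp add: divide_le_eq mult.commute)
    moreover have "exp (- y) \<le> 1 / (1 + y)"
      using exp_ge_add_one_self[of y] assms by (simp add: exp_minus field_simps)
    ultimately show ?thesis by linarith
  qed
  ultimately show ?thesis by linarith
qed

text \<open>Centring removes the linear Taylor term and the quadratic terms agree, so both functions
  differ from \<open>1 - p * (1 - p) * x^2 / 2\<close> by cubic errors, with constants
  \<open>1 / 6\<close> and \<open>1 / 4\<close>.\<close>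

lemma bern_char_gaussian:
  assumes p: "p \<in> {0..1}" and x: "\<bar>x\<bar> \<le> 1"
  shows "norm (bern_char p x - exp (- (p * (1 - p) * x\<^sup>2 / 2))) \<le> \<bar>x\<bar> ^ 3"
proof -
  define T where "T = (\<lambda>y::real. 1 + \<i> * y - y\<^sup>2 / 2)"
  have T: "norm (iexp y - T y) \<le> \<bar>y\<bar> ^ 3 / 6" for y
  proof -
    have "(\<Sum>k\<le>2. (\<i> * y) ^ k / fact k) = T y"
      by (simp add: T_def numeral_2_eq_2 power2_eq_square mult_ac)
    then show ?thesis using iexp_approx1[of y 2] by (simp add: fact_numeral)
  qed
  have cube: "\<bar>y\<bar> ^ 3 \<le> \<bar>x\<bar> ^ 3" if "\<bar>y\<bar> \<le> \<bar>x\<bar>" for y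
    using that by (intro power_mono) auto
  have T1: "norm (iexp ((1 - p) * x) - T ((1 - p) * x)) \<le> \<bar>x\<bar> ^ 3 / 6"
  proof (rule order_trans[OF T])
    have "\<bar>(1 - p) * x\<bar> \<le> \<bar>x\<bar>" using p by (simp add: abs_mult mult_left_le_one_le)
    from cube[OF this] show "\<bar>(1 - p) * x\<bar> ^ 3 / 6 \<le> \<bar>x\<bar> ^ 3 / 6" by (rule divide_right_mono) simp
  qed
  have T2: "norm (iexp (- p * x) - T (- p * x)) \<le> \<bar>x\<bar> ^ 3 / 6"
  proof (rule order_trans[OF T])
    have "\<bar>- p * x\<bar> \<le> \<bar>x\<bar>" using p by (simp add: abs_mult mult_left_le_one_le)
    from cube[OF this] show "\<bar>- p * x\<bar> ^ 3 / 6 \<le> \<bar>x\<bar> ^ 3 / 6" by (rule divide_right_mono) simp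
  qed
  have "p * T ((1 - p) * x) + (1 - p) * T (- p * x) = complex_of_real (1 - p * (1 - p) * x\<^sup>2 / 2)"
    unfolding T_def by (simp add: power2_eq_square field_simps)
  then have "bern_char p x - complex_of_real (1 - p * (1 - p) * x\<^sup>2 / 2)
      = p * (iexp ((1 - p) * x) - T ((1 - p) * x)) + (1 - p) * (iexp (- p * x) - T (- p * x))"
    unfolding bern_char_def by (simp add: algebra_simps)
  also have "norm \<dots> \<le> p * (\<bar>x\<bar> ^ 3 / 6) + (1 - p) * (\<bar>x\<bar> ^ 3 / 6)"
  proof (rule norm_triangle_le, rule add_mono)
    show "norm (p * (iexp ((1 - p) * x) - T ((1 - p) * x))) \<le> p * (\<bar>x\<bar> ^ 3 / 6)"
      unfolding norm_mult norm_of_real using T1 p by (intro mult_mono) auto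
    show "norm ((1 - p) * (iexp (- p * x) - T (- p * x))) \<le> (1 - p) * (\<bar>x\<bar> ^ 3 / 6)"
    proof -
      have "norm (complex_of_real (1 - p)) * norm (iexp (- p * x) - T (- p * x)) \<le> (1 - p) * (\<bar>x\<bar> ^ 3 / 6)"
        unfolding norm_of_real using T2 p by (intro mult_mono) auto
      then show ?thesis by (simp only: norm_mult of_real_diff of_real_1)
    qed
  qed
  also have "\<dots> = \<bar>x\<bar> ^ 3 / 6" by (simp only: distrib_right[symmetric]) simp
  finally have 1: "norm (bern_char p x - complex_of_real (1 - p * (1 - p) * x\<^sup>2 / 2)) \<le> \<bar>x\<bar> ^ 3 / 6" .
  define y where "y = p * (1 - p) * x\<^sup>2 / 2"
  have pq: "0 \<le> p * (1 - p)" "p * (1 - p) \<le> 1" using p by (auto simp: mult_le_one)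
  have y: "0 \<le> y" "y \<le> x\<^sup>2 / 2"
    using pq mult_right_mono[OF pq(2), of "x\<^sup>2"] by (auto simp: y_def)
  have "norm (complex_of_real (exp (- y)) - complex_of_real (1 - y)) \<le> y\<^sup>2"
    using abs_exp_minus_linear[OF y(1)] by (simp only: of_real_diff[symmetric] norm_of_real)
  also have "\<dots> \<le> (x\<^sup>2 / 2)\<^sup>2" using y by (intro power_mono)
  also have "\<dots> = \<bar>x\<bar> ^ 3 * (\<bar>x\<bar> / 4)" by (simp add: power2_eq_square power3_eq_cube)
  also have "\<dots> \<le> \<bar>x\<bar> ^ 3 * (1 / 4)" using x by (intro mult_left_mono) auto
  finally have 2: "norm (complex_of_real (1 - y) - complex_of_real (exp (- y))) \<le> \<bar>x\<bar> ^ 3 / 4"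
    by (simp add: norm_minus_commute)
  have "norm (bern_char p x - complex_of_real (exp (- y))) \<le> \<bar>x\<bar> ^ 3 / 6 + \<bar>x\<bar> ^ 3 / 4"
    by (rule norm_triangle_le[of _ _, of "bern_char p x - complex_of_real (1 - y)" "complex_of_real (1 - y) - complex_of_real (exp (- y))", simplified])
       (use 1 2 in \<open>simp add: y_def\<close>)
  also have "\<dots> \<le> \<bar>x\<bar> ^ 3" by simp
  finally show ?thesis by (simp add: y_def)
qed

section \<open>Local bounds and the local limit theorem\<close>

lemma has_bochner_integral_gaussian:
  assumes "a > 0"
  shows "has_bochner_integral lborel (\<lambda>x. exp (- (a * x\<^sup>2))) (sqrt (pi / a))"
proof -
  define s where "s = sqrt (1 / (2 * a))"
  have s: "s > 0" "s\<^sup>2 = 1 / (2 * a)" using assms by (auto simp: s_def)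
  have "sqrt (pi / a) * normal_density 0 s x = exp (- (a * x\<^sup>2))" for x
    unfolding normal_density_def using assms by (simp add: s)
  moreover have "has_bochner_integral lborel (\<lambda>x. sqrt (pi / a) * normal_density 0 s x) (sqrt (pi / a) * 1)"
    using s by (intro has_bochner_integral_mult_right) (auto simp: has_bochner_integral_iff)
  ultimately show ?thesis by simp
qed


lemma prod_bern_char_le:
  assumes p: "\<And>j. j \<in> A \<Longrightarrow> p j \<in> {0..1} \<and> v \<le> p j * (1 - p j)" and v: "0 \<le> v"
    and x: "\<And>j. j \<in> A \<Longrightarrow> \<bar>x j\<bar> \<le> 3 * pi / 2" and fin: "finite A"
  shows "norm (\<Prod>j\<in>A. bern_char (p j) (x j)) \<le> exp (- (v / 32 * (\<Sum>j\<in>A. (x j)\<^sup>2)))"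
proof -
  have "norm (\<Prod>j\<in>A. bern_char (p j) (x j)) = (\<Prod>j\<in>A. norm (bern_char (p j) (x j)))"
    by (rule prod_norm[symmetric])
  also have "\<dots> \<le> (\<Prod>j\<in>A. exp (- (v / 32 * (x j)\<^sup>2)))"
    using p v x by (intro prod_mono conjI norm_ge_zero norm_bern_char_le) auto
  also have "\<dots> = exp (- (v / 32 * (\<Sum>j\<in>A. (x j)\<^sup>2)))"
    using fin by (simp add: exp_sum[symmetric] sum_distrib_left sum_negf)
  finally show ?thesis .
qed

text \<open>Fourier inversion, with the phase bounded by 1 and the characteristic functions by a
  Gaussian. The bound does not depend on \<open>N\<close>, so it can be applied to the steps outside
  a block whatever happens inside.\<close>

lemma bern_card_le:
  assumes p: "\<And>j. j \<in> A \<Longrightarrow> p j \<in> {0..1} \<and> v \<le> p j * (1 - p j)" and v: "0 < v"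
    and fin: "finite A" and A: "0 < card A"
  shows "(\<Sum>S | S \<subseteq> A \<and> card S = N. bern p A S) \<le> sqrt (32 / v) / sqrt (real (card A))"
proof -
  define a where "a = v / 32 * real (card A)"
  have a: "a > 0" using v A by (simp add: a_def)
  note gauss = has_bochner_integral_gaussian[OF a]
  define f where "f = (\<lambda>x. iexp (((\<Sum>j\<in>A. p j) - real N) * x) * (\<Prod>j\<in>A. bern_char (p j) (x + 0)))"
  have f: "(\<integral>x. indicator {- pi..pi} x *\<^sub>R f x \<partial>lborel)
      = complex_of_real (2 * pi * (\<Sum>S | S \<subseteq> A \<and> card S = N. bern p A S))"
    unfolding f_def using bern_fourier[OF fin, of p N "\<lambda>_. 0"] by simp
  have "continuous_on {- pi..pi} f"
    unfolding f_def bern_char_def by (intro continuous_intros)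
  then have int: "integrable lborel (\<lambda>x. indicator {- pi..pi} x *\<^sub>R f x)"
    by (rule borel_integrable_atLeastAtMost'[unfolded set_integrable_def])
  have nonneg: "0 \<le> (\<Sum>S | S \<subseteq> A \<and> card S = N. bern p A S)"
    using p by (intro sum_nonneg bern_nonneg) auto
  have "2 * pi * (\<Sum>S | S \<subseteq> A \<and> card S = N. bern p A S) = norm (\<integral>x. indicator {- pi..pi} x *\<^sub>R f x \<partial>lborel)"
    unfolding f norm_of_real using nonneg by simp
  also have "\<dots> \<le> (\<integral>x. norm (indicator {- pi..pi} x *\<^sub>R f x) \<partial>lborel)"
    by (rule integral_norm_bound)
  also have "\<dots> \<le> (\<integral>x. exp (- (a * x\<^sup>2)) \<partial>lborel)"
  proof (rule integral_mono)
    show "integrable lborel (\<lambda>x. norm (indicator {- pi..pi} x *\<^sub>R f x))" using int by (rule integrable_norm)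
    show "integrable lborel (\<lambda>x. exp (- (a * x\<^sup>2)))" using gauss by (simp add: has_bochner_integral_iff)
    fix x
    show "norm (indicator {- pi..pi} x *\<^sub>R f x) \<le> exp (- (a * x\<^sup>2))"
    proof (cases "x \<in> {- pi..pi}")
      case True
      then have "\<bar>x + 0\<bar> \<le> 3 * pi / 2" by auto
      then have "norm (\<Prod>j\<in>A. bern_char (p j) (x + 0)) \<le> exp (- (v / 32 * (\<Sum>j\<in>A. (x + 0)\<^sup>2)))"
        using p v fin by (intro prod_bern_char_le) auto
      then show ?thesis using True by (simp add: f_def norm_mult a_def mult.assoc)
    qed simp
  qed
  also have "\<dots> = sqrt (pi / a)" using gauss by (simp add: has_bochner_integral_iff)
  also have "\<dots> = sqrt pi * (sqrt (32 / v) / sqrt (real (card A)))"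
    unfolding a_def using v A by (simp add: real_sqrt_divide real_sqrt_mult)
  also have "\<dots> \<le> (2 * pi) * (sqrt (32 / v) / sqrt (real (card A)))"
  proof (rule mult_right_mono)
    have "sqrt pi \<le> pi" using pi_gt3 by (intro real_le_lsqrt) (auto simp: power2_eq_square)
    then show "sqrt pi \<le> 2 * pi" using pi_gt3 by linarith
  qed (use v in auto)
  finally show ?thesis by (simp only: mult_le_cancel_left_pos mult_pos_pos pi_gt_zero zero_less_numeral)
qed

lemma bern_fourier_scaled:
  assumes fin: "finite A" and r: "r > 0"
  shows "complex_of_real r * (\<Sum>S | S \<subseteq> A \<and> card S = N. bern p A S * iexp (((\<Sum>j\<in>S. w j) - (\<Sum>j\<in>A. p j * w j)) / r))
    = (\<integral>x. indicator {- pi * r..pi * r} x *\<^sub>R (iexp (((\<Sum>j\<in>A. p j) - real N) / r * x)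
        * (\<Prod>j\<in>A. bern_char (p j) ((x + w j) / r))) \<partial>lborel) / (2 * pi)"
proof -
  define f where "f = (\<lambda>x. indicator {- pi..pi} x *\<^sub>R (iexp (((\<Sum>j\<in>A. p j) - real N) * x) * (\<Prod>j\<in>A. bern_char (p j) (x + w j / r))))"
  have scale: "(\<Sum>j\<in>S. w j / r) - (\<Sum>j\<in>A. p j * (w j / r)) = ((\<Sum>j\<in>S. w j) - (\<Sum>j\<in>A. p j * w j)) / r" for S
    by (simp add: sum_divide_distrib diff_divide_distrib)
  have "complex_of_real r * (\<integral>x. f x \<partial>lborel)
      = complex_of_real r * (2 * pi * (\<Sum>S | S \<subseteq> A \<and> card S = N. bern p A S * iexp (((\<Sum>j\<in>S. w j) - (\<Sum>j\<in>A. p j * w j)) / r)))"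
    using bern_fourier[OF fin, of p N "\<lambda>j. w j / r"] unfolding scale f_def by (simp only:)
  moreover have "(\<integral>x. f x \<partial>lborel) = (1 / r) *\<^sub>R (\<integral>x. f (0 + 1 / r * x) \<partial>lborel)"
    using lborel_integral_real_affine[of "1 / r" f 0] r by simp
  moreover have "f (0 + 1 / r * x) = indicator {- pi * r..pi * r} x *\<^sub>R (iexp (((\<Sum>j\<in>A. p j) - real N) / r * x)
        * (\<Prod>j\<in>A. bern_char (p j) ((x + w j) / r)))" for x
  proof -
    have "indicator {- pi..pi} (0 + 1 / r * x) = (indicator {- pi * r..pi * r} x :: real)"
      using r by (auto simp: indicator_def field_simps)
    moreover have "((\<Sum>j\<in>A. p j) - real N) * (0 + 1 / r * x) = ((\<Sum>j\<in>A. p j) - real N) / r * x" by simp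
    moreover have "0 + 1 / r * x + w j / r = (x + w j) / r" for j by (simp add: add_divide_distrib)
    ultimately show ?thesis unfolding f_def by (simp only:)
  qed
  ultimately show ?thesis using r by (simp add: scaleR_conv_of_real)
qed

text \<open>A local limit theorem that treats the number of selected indices and a linear statistic
  of them together: the weights displace the frequency, and the exponent is the limit of the
  variance-weighted sum of \<open>(x + w)^2\<close>. The last assumption makes the phase tend to
  1.\<close>

lemma bern_local_limit:
  fixes A :: "nat \<Rightarrow> 'i set" and p w :: "nat \<Rightarrow> 'i \<Rightarrow> real" and N :: "nat \<Rightarrow> nat" and r :: "nat \<Rightarrow> real"
  assumes fin: "\<And>n. finite (A n)" and r: "\<And>n. r n > 0" "filterlim r at_top sequentially"
    and p: "\<And>n j. j \<in> A n \<Longrightarrow> p n j \<in> {0..1} \<and> v \<le> p n j * (1 - p n j)" and v: "v > 0"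
    and w: "\<And>n j. j \<in> A n \<Longrightarrow> \<bar>w n j\<bar> \<le> C" and C: "C \<ge> 0"
    and A: "\<And>n. real (card (A n)) \<le> K * (r n)\<^sup>2" "\<And>n. \<kappa> * (r n)\<^sup>2 \<le> real (card (A n))" and \<kappa>: "\<kappa> > 0"
    and a0: "(\<lambda>n. (\<Sum>j\<in>A n. p n j * (1 - p n j)) / (r n)\<^sup>2) \<longlonglongrightarrow> a0"
    and a1: "(\<lambda>n. (\<Sum>j\<in>A n. p n j * (1 - p n j) * w n j) / (r n)\<^sup>2) \<longlonglongrightarrow> a1"
    and a2: "(\<lambda>n. (\<Sum>j\<in>A n. p n j * (1 - p n j) * (w n j)\<^sup>2) / (r n)\<^sup>2) \<longlonglongrightarrow> a2"
    and N: "(\<lambda>n. ((\<Sum>j\<in>A n. p n j) - real (N n)) / r n) \<longlonglongrightarrow> 0"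
  shows "(\<lambda>n. complex_of_real (r n) * (\<Sum>S | S \<subseteq> A n \<and> card S = N n.
        bern (p n) (A n) S * iexp (((\<Sum>j\<in>S. w n j) - (\<Sum>j\<in>A n. p n j * w n j)) / r n)))
    \<longlonglongrightarrow> complex_of_real (\<integral>x. exp (- (a0 * x\<^sup>2 + 2 * a1 * x + a2) / 2) \<partial>lborel) / (2 * pi)"
proof -
  define f where "f = (\<lambda>n x. indicator {- pi * r n..pi * r n} x *\<^sub>R (iexp (((\<Sum>j\<in>A n. p n j) - real (N n)) / r n * x)
        * (\<Prod>j\<in>A n. bern_char (p n j) ((x + w n j) / r n))))"
  define g where "g = (\<lambda>x. complex_of_real (exp (- (a0 * x\<^sup>2 + 2 * a1 * x + a2) / 2)))"
  have small: "\<forall>\<^sub>F n in sequentially. B / r n < e" if "e > 0" for B e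
  proof -
    have "(\<lambda>n. B / r n) \<longlonglongrightarrow> 0" using r(2) by (intro tendsto_divide_0[OF tendsto_const]) (rule filterlim_at_top_imp_at_infinity)
    then show ?thesis by (rule order_tendstoD) (rule that)
  qed
  \<comment> \<open>From \<open>n0\<close> on the displaced arguments stay within
    \<open>3 * pi / 2\<close>, the range of \<open>one_minus_cos_ge\<close>.\<close>
  obtain n0 where n0: "\<And>n. n \<ge> n0 \<Longrightarrow> C / r n < pi / 2"
    using small[of "pi / 2" C] by (auto simp: eventually_sequentially)
  have lim: "(\<lambda>n. f n x) \<longlonglongrightarrow> g x" for x
  proof -
    define B where "B = \<bar>x\<bar> + C"
    have B: "0 \<le> B" "\<And>n j. j \<in> A n \<Longrightarrow> \<bar>(x + w n j) / r n\<bar> \<le> B / r n"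
    proof -
      fix n j assume j: "j \<in> A n"
      have "\<bar>x + w n j\<bar> \<le> B" using w[OF j] by (simp add: B_def)
      then show "\<bar>(x + w n j) / r n\<bar> \<le> B / r n" using r(1)[of n] by (simp add: divide_right_mono)
    qed (use C in \<open>simp add: B_def\<close>)
    define h where "h = (\<lambda>n. \<Prod>j\<in>A n. complex_of_real (exp (- (p n j * (1 - p n j) * ((x + w n j) / r n)\<^sup>2 / 2))))"
    have gen: "- (q * ((x + u) / s)\<^sup>2 / 2) = - (q / s\<^sup>2 * x\<^sup>2 + 2 * (q * u / s\<^sup>2) * x + q * u\<^sup>2 / s\<^sup>2) / 2"
      for q u s :: real
      by (simp add: power_divide power2_sum add_divide_distrib algebra_simps power2_eq_square)
    have hlim: "h \<longlonglongrightarrow> g x"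
    proof -
      have heq: "h n = complex_of_real (exp (- ((\<Sum>j\<in>A n. p n j * (1 - p n j)) / (r n)\<^sup>2 * x\<^sup>2
          + 2 * ((\<Sum>j\<in>A n. p n j * (1 - p n j) * w n j) / (r n)\<^sup>2) * x
          + (\<Sum>j\<in>A n. p n j * (1 - p n j) * (w n j)\<^sup>2) / (r n)\<^sup>2) / 2))" for n
      proof -
        have "(\<Sum>j\<in>A n. - (p n j * (1 - p n j) * ((x + w n j) / r n)\<^sup>2 / 2))
            = - ((\<Sum>j\<in>A n. p n j * (1 - p n j)) / (r n)\<^sup>2 * x\<^sup>2
          + 2 * ((\<Sum>j\<in>A n. p n j * (1 - p n j) * w n j) / (r n)\<^sup>2) * x
          + (\<Sum>j\<in>A n. p n j * (1 - p n j) * (w n j)\<^sup>2) / (r n)\<^sup>2) / 2"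
          unfolding sum_divide_distrib sum_distrib_left sum_distrib_right sum.distrib[symmetric] sum_negf[symmetric]
          by (intro sum.cong refl gen)
        then show ?thesis unfolding h_def using fin by (simp only: of_real_prod[symmetric] exp_sum[symmetric])
      qed
      moreover have "(\<lambda>n. complex_of_real (exp (- ((\<Sum>j\<in>A n. p n j * (1 - p n j)) / (r n)\<^sup>2 * x\<^sup>2
          + 2 * ((\<Sum>j\<in>A n. p n j * (1 - p n j) * w n j) / (r n)\<^sup>2) * x
          + (\<Sum>j\<in>A n. p n j * (1 - p n j) * (w n j)\<^sup>2) / (r n)\<^sup>2) / 2)))
          \<longlonglongrightarrow> complex_of_real (exp (- (a0 * x\<^sup>2 + 2 * a1 * x + a2) / 2))"
        by (intro tendsto_intros a0 a1 a2) auto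
      ultimately show ?thesis
        unfolding g_def by (elim Lim_transform_eventually) (simp only: heq eventually_True)
    qed
    \<comment> \<open>Replacing the factors one at a time costs at most \<open>(B / r n)^3\<close>
      each; there are at most \<open>K * (r n)^2\<close> factors, so the total is of order
      \<open>1 / r n\<close>.\<close>
    have close: "(\<lambda>n. (\<Prod>j\<in>A n. bern_char (p n j) ((x + w n j) / r n)) - h n) \<longlonglongrightarrow> 0"
    proof (rule Lim_null_comparison)
      show "(\<lambda>n. K * B ^ 3 / r n) \<longlonglongrightarrow> 0"
        using r(2) by (intro tendsto_divide_0[OF tendsto_const]) (rule filterlim_at_top_imp_at_infinity)
      show "\<forall>\<^sub>F n in sequentially. norm ((\<Prod>j\<in>A n. bern_char (p n j) ((x + w n j) / r n)) - h n) \<le> K * B ^ 3 / r n"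
        using small[of 1 B, simplified]
      proof eventually_elim
        case (elim n)
        have "norm ((\<Prod>j\<in>A n. bern_char (p n j) ((x + w n j) / r n)) - h n)
            \<le> (\<Sum>j\<in>A n. norm (bern_char (p n j) ((x + w n j) / r n) - complex_of_real (exp (- (p n j * (1 - p n j) * ((x + w n j) / r n)\<^sup>2 / 2)))))"
          unfolding h_def
        proof (rule norm_prod_diff)
          fix j assume j: "j \<in> A n"
          show "norm (bern_char (p n j) ((x + w n j) / r n)) \<le> 1"
            using p[OF j] by (intro norm_bern_char_le_1) auto
          have "0 \<le> p n j * (1 - p n j) * ((x + w n j) / r n)\<^sup>2 / 2" using p[OF j] by simp
          then show "norm (complex_of_real (exp (- (p n j * (1 - p n j) * ((x + w n j) / r n)\<^sup>2 / 2)))) \<le> 1"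
            by (simp only: norm_of_real abs_exp_cancel exp_le_one_iff neg_le_0_iff_le)
        qed
        also have "\<dots> \<le> (\<Sum>j\<in>A n. (B / r n) ^ 3)"
        proof (rule sum_mono)
          fix j assume j: "j \<in> A n"
          have "norm (bern_char (p n j) ((x + w n j) / r n) - complex_of_real (exp (- (p n j * (1 - p n j) * ((x + w n j) / r n)\<^sup>2 / 2))))
              \<le> \<bar>(x + w n j) / r n\<bar> ^ 3"
            using p[OF j] B(2)[OF j] elim by (intro bern_char_gaussian) auto
          also have "\<dots> \<le> (B / r n) ^ 3" using B(2)[OF j] by (intro power_mono) auto
          finally show "norm (bern_char (p n j) ((x + w n j) / r n) - complex_of_real (exp (- (p n j * (1 - p n j) * ((x + w n j) / r n)\<^sup>2 / 2))))
              \<le> (B / r n) ^ 3" .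
        qed
        also have "\<dots> = real (card (A n)) * (B / r n) ^ 3" by simp
        also have "\<dots> \<le> K * (r n)\<^sup>2 * (B / r n) ^ 3"
          using A(1)[of n] B(1) r(1)[of n] by (intro mult_right_mono) auto
        also have "\<dots> = K * B ^ 3 / r n"
          using r(1)[of n] by (simp add: power_divide power2_eq_square power3_eq_cube)
        finally show ?case .
      qed
    qed
    have prodlim: "(\<lambda>n. \<Prod>j\<in>A n. bern_char (p n j) ((x + w n j) / r n)) \<longlonglongrightarrow> g x"
      using tendsto_add[OF close hlim] by simp
    have "(\<lambda>n. iexp (((\<Sum>j\<in>A n. p n j) - real (N n)) / r n * x)) \<longlonglongrightarrow> iexp (0 * x)"
      by (intro tendsto_intros N)
    from tendsto_mult[OF this prodlim]
    have "(\<lambda>n. iexp (((\<Sum>j\<in>A n. p n j) - real (N n)) / r n * x) * (\<Prod>j\<in>A n. bern_char (p n j) ((x + w n j) / r n))) \<longlonglongrightarrow> g x"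
      by simp
    moreover have "\<forall>\<^sub>F n in sequentially. iexp (((\<Sum>j\<in>A n. p n j) - real (N n)) / r n * x) * (\<Prod>j\<in>A n. bern_char (p n j) ((x + w n j) / r n)) = f n x"
      using small[OF pi_gt_zero, of "\<bar>x\<bar>"]
    proof eventually_elim
      case (elim n)
      then have "\<bar>x\<bar> < pi * r n" using r(1)[of n] by (simp add: divide_less_eq)
      then have "x \<in> {- pi * r n..pi * r n}" by (simp add: abs_less_iff)
      then have "indicator {- pi * r n..pi * r n} x = (1 :: real)" by (rule indicator_simps)
      then show ?case by (simp only: f_def scaleR_one)
    qed
    ultimately show ?thesis by (rule Lim_transform_eventually)
  qed
  define a where "a = v / 32 * (\<kappa> / 2)"
  have a: "a > 0" using v \<kappa> by (simp add: a_def)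
  define D where "D = exp (v / 32 * (K * C\<^sup>2))"
  \<comment> \<open>A Gaussian majorant uniform in \<open>n\<close>: the displacement by
    \<open>w\<close> costs only the constant factor \<open>D\<close> and half of the
    exponent.\<close>
  have dom: "norm (f (n + n0) x) \<le> D * exp (- (a * x\<^sup>2))" for n x
  proof (cases "x \<in> {- pi * r (n + n0)..pi * r (n + n0)}")
    case True
    define m where "m = n + n0"
    have rm: "r m > 0" by (rule r)
    have Cr: "C / r m < pi / 2" using n0[of m] by (simp add: m_def)
    have arg: "\<bar>(x + w m j) / r m\<bar> \<le> 3 * pi / 2" if j: "j \<in> A m" for j
    proof -
      have "\<bar>x + w m j\<bar> \<le> pi * r m + C" using True w[OF j] by (auto simp: m_def)
      then have "\<bar>(x + w m j) / r m\<bar> \<le> (pi * r m + C) / r m" using rm by (simp add: divide_right_mono)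
      also have "\<dots> = pi + C / r m" using rm by (simp add: add_divide_distrib)
      finally show ?thesis using Cr by linarith
    qed
    have "norm (f m x) = norm (\<Prod>j\<in>A m. bern_char (p m j) ((x + w m j) / r m))"
      using True by (simp add: f_def norm_mult m_def)
    also have "\<dots> \<le> exp (- (v / 32 * (\<Sum>j\<in>A m. ((x + w m j) / r m)\<^sup>2)))"
      using p v arg fin by (intro prod_bern_char_le) auto
    also have "\<dots> \<le> exp (- (v / 32 * (\<kappa> * (x\<^sup>2 / 2) - K * C\<^sup>2)))"
    proof -
      have "\<kappa> * (x\<^sup>2 / 2) - K * C\<^sup>2 \<le> (real (card (A m)) / (r m)\<^sup>2) * (x\<^sup>2 / 2) - (real (card (A m)) / (r m)\<^sup>2) * C\<^sup>2"
      proof -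
        have "\<kappa> \<le> real (card (A m)) / (r m)\<^sup>2" "real (card (A m)) / (r m)\<^sup>2 \<le> K"
          using A[of m] rm by (auto simp: divide_le_eq le_divide_eq)
        from mult_right_mono[OF this(1), of "x\<^sup>2 / 2"] mult_right_mono[OF this(2), of "C\<^sup>2"]
        show ?thesis using zero_le_power2[of x] zero_le_power2[of C] by linarith
      qed
      also have "\<dots> = (\<Sum>j\<in>A m. (x\<^sup>2 / 2 - C\<^sup>2) / (r m)\<^sup>2)"
        by (simp add: diff_divide_distrib right_diff_distrib)
      also have "\<dots> \<le> (\<Sum>j\<in>A m. ((x + w m j) / r m)\<^sup>2)"
      proof (rule sum_mono)
        fix j assume j: "j \<in> A m"
        have "(w m j)\<^sup>2 \<le> C\<^sup>2" using w[OF j] C by (simp add: abs_le_square_iff[symmetric])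
        \<comment> \<open>Half of this square is \<open>(x + w)^2 - (x^2 / 2 - w^2)\<close>.\<close>
        moreover have "0 \<le> (x + 2 * w m j)\<^sup>2" by simp
        ultimately have "x\<^sup>2 / 2 - C\<^sup>2 \<le> (x + w m j)\<^sup>2"
          by (simp add: power2_eq_square algebra_simps)
        then show "(x\<^sup>2 / 2 - C\<^sup>2) / (r m)\<^sup>2 \<le> ((x + w m j) / r m)\<^sup>2"
          by (simp add: power_divide divide_right_mono)
      qed
      finally show ?thesis using v by simp
    qed
    also have "\<dots> = D * exp (- (a * x\<^sup>2))" by (simp add: D_def a_def exp_add[symmetric] algebra_simps)
    finally show ?thesis by (simp add: m_def)
  next
    case False
    then show ?thesis by (simp add: f_def D_def)
  qed
  have meas[measurable]: "f n \<in> borel_measurable lborel" for n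
    unfolding f_def bern_char_def by measurable
  have [measurable]: "g \<in> borel_measurable lborel" unfolding g_def by measurable
  have "(\<lambda>n. \<integral>x. f (n + n0) x \<partial>lborel) \<longlonglongrightarrow> (\<integral>x. g x \<partial>lborel)"
  proof (rule integral_dominated_convergence[where w = "\<lambda>x. D * exp (- (a * x\<^sup>2))"])
    show "integrable lborel (\<lambda>x. D * exp (- (a * x\<^sup>2)))"
      using has_bochner_integral_gaussian[OF a] by (simp add: has_bochner_integral_iff)
    show "AE x in lborel. (\<lambda>n. f (n + n0) x) \<longlonglongrightarrow> g x"
      by (intro AE_I2 LIMSEQ_ignore_initial_segment lim)
  qed (use dom in auto)
  then have "(\<lambda>n. \<integral>x. f n x \<partial>lborel) \<longlonglongrightarrow> (\<integral>x. g x \<partial>lborel)"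
    by (rule LIMSEQ_offset)
  then have "(\<lambda>n. (\<integral>x. f n x \<partial>lborel) / (2 * pi)) \<longlonglongrightarrow> (\<integral>x. g x \<partial>lborel) / (2 * pi)"
    by (intro tendsto_intros) auto
  moreover have "(\<integral>x. g x \<partial>lborel) = complex_of_real (\<integral>x. exp (- (a0 * x\<^sup>2 + 2 * a1 * x + a2) / 2) \<partial>lborel)"
    unfolding g_def by (rule integral_complex_of_real)
  ultimately show ?thesis
    unfolding bern_fourier_scaled[OF fin r(1)] f_def by simp
qed

text \<open>Completing the square. The expression \<open>a2 - a1^2 / a0\<close> is the variance of
  the linear statistic that remains after regression on the number of selected indices.\<close>

lemma gaussian_shift_integral:
  assumes "a0 > 0"
  shows "(\<integral>x. exp (- (a0 * x\<^sup>2 + 2 * a1 * x + a2) / 2) \<partial>lborel)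
    = exp (- (a2 - a1\<^sup>2 / a0) / 2) * sqrt (2 * pi / a0)"
proof -
  have g: "has_bochner_integral lborel (\<lambda>x. exp (- (a0 / 2 * x\<^sup>2))) (sqrt (pi / (a0 / 2)))"
    by (rule has_bochner_integral_gaussian) (use assms in simp)
  have eq: "- (a0 * (- a1 / a0 + 1 * x)\<^sup>2 + 2 * a1 * (- a1 / a0 + 1 * x) + a2) / 2
      = - (a2 - a1\<^sup>2 / a0) / 2 + - (a0 / 2 * x\<^sup>2)" for x
    using assms by (simp add: power2_eq_square field_simps)
  have "(\<integral>x. exp (- (a0 * x\<^sup>2 + 2 * a1 * x + a2) / 2) \<partial>lborel)
      = (\<integral>x. exp (- (a2 - a1\<^sup>2 / a0) / 2) * exp (- (a0 / 2 * x\<^sup>2)) \<partial>lborel)"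
    by (subst lborel_integral_real_affine[where c = 1 and t = "- a1 / a0"]) (simp_all only: eq exp_add, simp)
  also have "\<dots> = exp (- (a2 - a1\<^sup>2 / a0) / 2) * sqrt (2 * pi / a0)"
    using g by (simp add: has_bochner_integral_iff mult.commute)
  finally show ?thesis .
qed

section \<open>Oscillation and conditioning\<close>

lemma Hoeffding_two_point:
  fixes p h :: real
  assumes p: "p \<in> {0..1}" and h: "0 \<le> h"
  shows "p * exp (h * (1 - p)) + (1 - p) * exp (- h * p) \<le> exp (h\<^sup>2 / 8)"
proof -
  have "1 * 1 \<le> 1 + p * (exp h - 1)" using p h by simp
  then have pos: "0 < 1 + p * (exp h - 1)" by linarith
  have "p * exp (h * (1 - p)) + (1 - p) * exp (- h * p) = exp (- h * p) * (1 + p * (exp h - 1))"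
    by (simp add: right_diff_distrib exp_diff exp_minus field_simps)
  also have "\<dots> = exp (- h * p + ln (1 + p * (exp h - 1)))"
    using pos by (simp only: exp_add exp_ln)
  also have "\<dots> \<le> exp (h\<^sup>2 / 8)"
    using Hoeffdings_lemma_aux[OF h, of p] p by simp
  finally show ?thesis .
qed

lemma sum_Pow_insert:
  fixes f :: "'i set \<Rightarrow> 'c :: comm_monoid_add"
  assumes "finite A" "x \<notin> A"
  shows "(\<Sum>S\<in>Pow (insert x A). f S) = (\<Sum>S\<in>Pow A. f S) + (\<Sum>S\<in>Pow A. f (insert x S))"
proof -
  have "(\<Sum>S\<in>Pow (insert x A). f S) = (\<Sum>S\<in>Pow A. f S) + (\<Sum>S\<in>insert x ` Pow A. f S)"
    unfolding Pow_insert using assms by (intro sum.union_disjoint) auto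
  also have "(\<Sum>S\<in>insert x ` Pow A. f S) = (\<Sum>S\<in>Pow A. f (insert x S))"
    by (subst sum.reindex) (use assms in \<open>auto simp: inj_on_def\<close>)
  finally show ?thesis .
qed

lemma bern_insert:
  assumes "finite A" "x \<notin> A" "S \<subseteq> A"
  shows "bern p (insert x A) S = (1 - p x) * bern p A S"
    and "bern p (insert x A) (insert x S) = p x * bern p A S"
proof -
  have S: "finite S" "x \<notin> S" using assms finite_subset by auto
  have "insert x A - S = insert x (A - S)" "insert x A - insert x S = A - S" using S assms by auto
  then show "bern p (insert x A) S = (1 - p x) * bern p A S"
    and "bern p (insert x A) (insert x S) = p x * bern p A S"
    using assms S by (simp_all add: bern_def mult_ac)
qed

text \<open>The hitting probability is dominated by the exponential supermartingale
  \<open>exp (h x) + exp (- h x)\<close>, by peeling off the first step.\<close>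

lemma bern_hitting_aux:
  fixes p :: "nat \<Rightarrow> real"
  assumes "\<And>j. s \<le> j \<Longrightarrow> j < s + d \<Longrightarrow> p j \<in> {0..1}" and h: "0 \<le> h"
  shows "(\<Sum>S\<in>Pow {s..<s + d}. bern p {s..<s + d} S *
      of_bool (\<exists>k\<in>{s..s + d}. \<bar>x + (real (card (S \<inter> {s..<k})) - (\<Sum>j=s..<k. p j))\<bar> \<ge> l))
    \<le> exp (- h * l + real d * (h\<^sup>2 / 8)) * (exp (h * x) + exp (- h * x))"
  using assms(1)
proof (induction d arbitrary: s x)
  case 0
  have hit: "1 \<le> exp (- h * l) * (exp (h * x) + exp (- h * x))" if "\<bar>x\<bar> \<ge> l"
  proof -
    have "1 \<le> exp (- h * l) * exp (h * \<bar>x\<bar>)"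
      using mult_left_mono[OF that h] by (simp add: exp_add[symmetric])
    also have "\<dots> \<le> exp (- h * l) * (exp (h * x) + exp (- h * x))"
      by (intro mult_left_mono) (auto simp: abs_if)
    finally show ?thesis .
  qed
  show ?case
  proof (cases "\<bar>x\<bar> \<ge> l")
    case True
    then show ?thesis using hit by (simp add: bern_def)
  qed (simp add: bern_def)
next
  case (Suc d)
  define J where "J = {Suc s..<s + Suc d}"
  have I: "{s..<s + Suc d} = insert s J" "finite J" "s \<notin> J" by (auto simp: J_def)
  have ps: "p s \<in> {0..1}" by (rule Suc.prems) auto
  show ?case
  proof (cases "\<bar>x\<bar> \<ge> l")
    case True
    have "(\<Sum>S\<in>Pow {s..<s + Suc d}. bern p {s..<s + Suc d} S *
        of_bool (\<exists>k\<in>{s..s + Suc d}. \<bar>x + (real (card (S \<inter> {s..<k})) - (\<Sum>j=s..<k. p j))\<bar> \<ge> l))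
        \<le> (\<Sum>S\<in>Pow {s..<s + Suc d}. bern p {s..<s + Suc d} S)"
      by (intro sum_mono mult_right_le_one_le bern_nonneg Suc.prems) auto
    also have "\<dots> = 1" by (rule sum_bern) simp
    also have "1 \<le> exp (- h * l + real (Suc d) * (h\<^sup>2 / 8)) * exp (h * \<bar>x\<bar>)"
    proof -
      have "0 \<le> real (Suc d) * (h\<^sup>2 / 8)" by simp
      then show ?thesis using mult_left_mono[OF True h] unfolding exp_add[symmetric] one_le_exp_iff by linarith
    qed
    also have "\<dots> \<le> exp (- h * l + real (Suc d) * (h\<^sup>2 / 8)) * (exp (h * x) + exp (- h * x))"
      by (intro mult_left_mono) (auto simp: abs_if)
    finally show ?thesis .
  next
    case False
    \<comment> \<open>The hitting event of the remaining steps, started from \<open>y\<close> after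
      the first step.\<close>
    define E where "E = (\<lambda>y S. of_bool (\<exists>k\<in>{Suc s..Suc s + d}. \<bar>y + (real (card (S \<inter> {Suc s..<k})) - (\<Sum>j=Suc s..<k. p j))\<bar> \<ge> l) :: real)"
    have ev: "of_bool (\<exists>k\<in>{s..s + Suc d}. \<bar>x + (real (card (S \<inter> {s..<k})) - (\<Sum>j=s..<k. p j))\<bar> \<ge> l) = E (x - p s) S"
      "of_bool (\<exists>k\<in>{s..s + Suc d}. \<bar>x + (real (card (insert s S \<inter> {s..<k})) - (\<Sum>j=s..<k. p j))\<bar> \<ge> l) = E (x + 1 - p s) S"
      if S: "S \<subseteq> J" for S
    proof -
      have k: "S \<inter> {s..<k} = S \<inter> {Suc s..<k}" "insert s S \<inter> {s..<k} = insert s (S \<inter> {Suc s..<k})"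
        "(\<Sum>j=s..<k. p j) = p s + (\<Sum>j=Suc s..<k. p j)"
        "card (insert s (S \<inter> {Suc s..<k})) = Suc (card (S \<inter> {Suc s..<k}))" if "k \<ge> Suc s" for k
        using that S I(3) by (auto simp: J_def sum.atLeast_Suc_lessThan card_insert_if Suc_le_eq)
      have ks: "{s..s + Suc d} = insert s {Suc s..Suc s + d}" by auto
      show "of_bool (\<exists>k\<in>{s..s + Suc d}. \<bar>x + (real (card (S \<inter> {s..<k})) - (\<Sum>j=s..<k. p j))\<bar> \<ge> l) = E (x - p s) S"
        unfolding E_def ks using False k(1,3) by (auto simp: algebra_simps intro!: bexI)
      show "of_bool (\<exists>k\<in>{s..s + Suc d}. \<bar>x + (real (card (insert s S \<inter> {s..<k})) - (\<Sum>j=s..<k. p j))\<bar> \<ge> l) = E (x + 1 - p s) S"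
        unfolding E_def ks using False k(2,3,4) by (auto simp: algebra_simps intro!: bexI)
    qed
    have J: "J = {Suc s..<Suc s + d}" by (simp add: J_def)
    have IH: "(\<Sum>S\<in>Pow J. bern p J S * E y S) \<le> exp (- h * l + real d * (h\<^sup>2 / 8)) * (exp (h * y) + exp (- h * y))" for y
      unfolding J E_def by (rule Suc.IH) (use Suc.prems in auto)
    have "(\<Sum>S\<in>Pow {s..<s + Suc d}. bern p {s..<s + Suc d} S *
        of_bool (\<exists>k\<in>{s..s + Suc d}. \<bar>x + (real (card (S \<inter> {s..<k})) - (\<Sum>j=s..<k. p j))\<bar> \<ge> l))
        = (\<Sum>S\<in>Pow J. (1 - p s) * (bern p J S * E (x - p s) S)) + (\<Sum>S\<in>Pow J. p s * (bern p J S * E (x + 1 - p s) S))"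
      unfolding I(1) sum_Pow_insert[OF I(2,3)]
    proof (intro arg_cong2[where f = "(+)"] sum.cong refl)
      fix S assume "S \<in> Pow J"
      then have S: "S \<subseteq> J" by simp
      show "bern p (insert s J) S * of_bool (\<exists>k\<in>{s..s + Suc d}. \<bar>x + (real (card (S \<inter> {s..<k})) - (\<Sum>j=s..<k. p j))\<bar> \<ge> l)
          = (1 - p s) * (bern p J S * E (x - p s) S)"
        unfolding ev(1)[OF S] bern_insert(1)[OF I(2,3) S] by (rule mult.assoc)
      show "bern p (insert s J) (insert s S) * of_bool (\<exists>k\<in>{s..s + Suc d}. \<bar>x + (real (card (insert s S \<inter> {s..<k})) - (\<Sum>j=s..<k. p j))\<bar> \<ge> l)
          = p s * (bern p J S * E (x + 1 - p s) S)"
        unfolding ev(2)[OF S] bern_insert(2)[OF I(2,3) S] by (rule mult.assoc)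
    qed
    also have "\<dots> = (1 - p s) * (\<Sum>S\<in>Pow J. bern p J S * E (x - p s) S) + p s * (\<Sum>S\<in>Pow J. bern p J S * E (x + 1 - p s) S)"
      by (simp add: sum_distrib_left)
    also have "\<dots> \<le> (1 - p s) * (exp (- h * l + real d * (h\<^sup>2 / 8)) * (exp (h * (x - p s)) + exp (- h * (x - p s))))
        + p s * (exp (- h * l + real d * (h\<^sup>2 / 8)) * (exp (h * (x + 1 - p s)) + exp (- h * (x + 1 - p s))))"
      using ps by (intro add_mono mult_left_mono IH) auto
    \<comment> \<open>The part with \<open>- h\<close> is again a two-point sum, for the reflected
      parameter \<open>1 - p s\<close>, so that one inequality covers both signs.\<close>
    also have "\<dots> = exp (- h * l + real d * (h\<^sup>2 / 8))
        * (exp (h * x) * (p s * exp (h * (1 - p s)) + (1 - p s) * exp (- h * p s))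
          + exp (- h * x) * ((1 - p s) * exp (h * (1 - (1 - p s))) + (1 - (1 - p s)) * exp (- h * (1 - p s))))"
    proof -
      have "exp (h * (x - p s)) = exp (h * x) * exp (- h * p s)"
        "exp (- h * (x - p s)) = exp (- h * x) * exp (h * (1 - (1 - p s)))"
        "exp (h * (x + 1 - p s)) = exp (h * x) * exp (h * (1 - p s))"
        "exp (- h * (x + 1 - p s)) = exp (- h * x) * exp (- h * (1 - p s))"
        by (simp_all add: exp_add[symmetric] algebra_simps)
      then show ?thesis by (simp only: distrib_left distrib_right mult_ac add_ac) (simp add: algebra_simps)
    qed
    also have "\<dots> \<le> exp (- h * l + real d * (h\<^sup>2 / 8)) * (exp (h * x) * exp (h\<^sup>2 / 8) + exp (- h * x) * exp (h\<^sup>2 / 8))"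
      using Hoeffding_two_point[OF ps h] Hoeffding_two_point[of "1 - p s", OF _ h] ps
      by (intro mult_left_mono add_mono) auto
    also have "\<dots> = exp (- h * l + real (Suc d) * (h\<^sup>2 / 8)) * (exp (h * x) + exp (- h * x))"
    proof -
      have "- h * l + real (Suc d) * (h\<^sup>2 / 8) = (- h * l + real d * (h\<^sup>2 / 8)) + h\<^sup>2 / 8"
        by (simp add: algebra_simps)
      then show ?thesis by (simp only: exp_add distrib_left distrib_right mult_ac)
    qed
    finally show ?thesis .
  qed
qed

lemma bern_maximal:
  fixes p :: "nat \<Rightarrow> real"
  assumes p: "\<And>j. j < e \<Longrightarrow> p j \<in> {0..1}" and se: "s < e" and l: "0 \<le> l" "real (e - s) \<le> D"
  shows "(\<Sum>S\<in>Pow {s..<e}. bern p {s..<e} S *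
      of_bool (\<exists>k\<in>{s..e}. \<bar>real (card (S \<inter> {s..<k})) - (\<Sum>j=s..<k. p j)\<bar> \<ge> l))
    \<le> 2 * exp (- 2 * l\<^sup>2 / D)"
proof -
  define d where "d = e - s"
  have d: "e = s + d" "0 < d" using se by (auto simp: d_def)
  \<comment> \<open>Minimises the exponent \<open>- h * l + d * h^2 / 8\<close>.\<close>
  define h where "h = 4 * l / real d"
  have "(\<Sum>S\<in>Pow {s..<s + d}. bern p {s..<s + d} S *
      of_bool (\<exists>k\<in>{s..s + d}. \<bar>0 + (real (card (S \<inter> {s..<k})) - (\<Sum>j=s..<k. p j))\<bar> \<ge> l))
      \<le> exp (- h * l + real d * (h\<^sup>2 / 8)) * (exp (h * 0) + exp (- h * 0))"
    by (rule bern_hitting_aux) (use p d l in \<open>auto simp: h_def\<close>)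
  also have "- h * l + real d * (h\<^sup>2 / 8) = - 2 * l\<^sup>2 / real d"
    using d(2) by (simp add: h_def power2_eq_square)
  also have "exp (- 2 * l\<^sup>2 / real d) * (exp (h * 0) + exp (- h * 0)) \<le> 2 * exp (- 2 * l\<^sup>2 / D)"
  proof -
    have "2 * l\<^sup>2 / D \<le> 2 * l\<^sup>2 / real d"
      using d l(2) by (intro divide_left_mono) (auto simp: d_def)
    then show ?thesis by simp
  qed
  finally show ?thesis by (simp add: d(1))
qed

section \<open>Removing the conditioning on the total\<close>

lemma sum_Pow_split:
  assumes "I \<subseteq> A"
  shows "(\<Sum>S\<in>Pow A. f S) = (\<Sum>S1\<in>Pow I. \<Sum>S2\<in>Pow (A - I). f (S1 \<union> S2))"
  unfolding sum.cartesian_product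
  by (rule sum.reindex_bij_witness[where i = "\<lambda>(S1, S2). S1 \<union> S2" and j = "\<lambda>S. (S \<inter> I, S - I)"])
     (use assms in \<open>auto simp: Int_Un_distrib Un_Diff intro!: arg_cong[where f = f]\<close>)

lemma bern_union:
  assumes "finite A" "I \<subseteq> A" "S1 \<subseteq> I" "S2 \<subseteq> A - I"
  shows "bern p A (S1 \<union> S2) = bern p I S1 * bern p (A - I) S2"
proof -
  have fin: "finite S1" "finite S2" "finite I" using assms by (meson finite_Diff finite_subset)+
  have "A - (S1 \<union> S2) = (I - S1) \<union> ((A - I) - S2)" using assms by auto
  moreover have "S1 \<inter> S2 = {}" "(I - S1) \<inter> ((A - I) - S2) = {}" using assms by auto
  ultimately show ?thesis
    unfolding bern_def using fin assms(1) by (simp add: prod.union_disjoint)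
qed

text \<open>Given the selection inside the block \<open>I\<close>, the condition on the total fixes
  the number selected outside, and by independence this has probability at most \<open>B\<close>.
  Division by the probability of the condition then loses only a constant factor if that probability
  is of the same order as \<open>B\<close>.\<close>

lemma bern_conditioned_event_le:
  assumes fin: "finite A" and I: "I \<subseteq> A" and p: "\<And>j. j \<in> A \<Longrightarrow> p j \<in> {0..1}"
    and Q: "\<And>N. (\<Sum>S | S \<subseteq> A - I \<and> card S = N. bern p (A - I) S) \<le> B"
  shows "(\<Sum>S | S \<subseteq> A \<and> card S = N. bern p A S * of_bool (E (S \<inter> I)))
    \<le> (\<Sum>S\<in>Pow I. bern p I S * of_bool (E S)) * B"
proof -
  have finI: "finite I" "finite (A - I)" using fin I finite_subset by auto
  have "(\<Sum>S | S \<subseteq> A \<and> card S = N. bern p A S * of_bool (E (S \<inter> I)))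
      = (\<Sum>S\<in>Pow A. bern p A S * of_bool (E (S \<inter> I)) * of_bool (card S = N))"
    by (rule sum.mono_neutral_cong_left) (use fin in auto)
  also have "\<dots> = (\<Sum>S1\<in>Pow I. \<Sum>S2\<in>Pow (A - I). bern p I S1 * of_bool (E S1) * (bern p (A - I) S2 * of_bool (card S1 + card S2 = N)))"
    unfolding sum_Pow_split[OF I]
  proof (intro sum.cong refl)
    fix S1 S2 assume S: "S1 \<in> Pow I" "S2 \<in> Pow (A - I)"
    then have "(S1 \<union> S2) \<inter> I = S1" "card (S1 \<union> S2) = card S1 + card S2"
      using finI by (auto intro!: card_Un_disjoint dest: finite_subset)
    then show "bern p A (S1 \<union> S2) * of_bool (E ((S1 \<union> S2) \<inter> I)) * of_bool (card (S1 \<union> S2) = N)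
        = bern p I S1 * of_bool (E S1) * (bern p (A - I) S2 * of_bool (card S1 + card S2 = N))"
      using bern_union[OF fin I, of S1 S2 p] S by (simp add: mult_ac)
  qed
  also have "\<dots> = (\<Sum>S1\<in>Pow I. bern p I S1 * of_bool (E S1) * (\<Sum>S2\<in>Pow (A - I). bern p (A - I) S2 * of_bool (card S1 + card S2 = N)))"
    by (simp add: sum_distrib_left)
  also have "\<dots> \<le> (\<Sum>S1\<in>Pow I. bern p I S1 * of_bool (E S1) * B)"
  proof (intro sum_mono mult_left_mono)
    fix S1 assume S1: "S1 \<in> Pow I"
    have "(\<Sum>S2\<in>Pow (A - I). bern p (A - I) S2 * of_bool (card S1 + card S2 = N))
        \<le> (\<Sum>S2 | S2 \<subseteq> A - I \<and> card S2 = N - card S1. bern p (A - I) S2)"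
    proof -
      have "(\<Sum>S2\<in>Pow (A - I). bern p (A - I) S2 * of_bool (card S1 + card S2 = N))
          = (\<Sum>S2 | S2 \<subseteq> A - I \<and> card S1 + card S2 = N. bern p (A - I) S2)"
        by (rule sum.mono_neutral_cong_right) (use finI in auto)
      \<comment> \<open>Only an inequality, since for \<open>card S1 > N\<close> the left sum is
        empty while the truncated difference is 0.\<close>
      also have "\<dots> \<le> (\<Sum>S2 | S2 \<subseteq> A - I \<and> card S2 = N - card S1. bern p (A - I) S2)"
        using finI p by (intro sum_mono2 bern_nonneg) auto
      finally show ?thesis .
    qed
    also have "\<dots> \<le> B" by (rule Q)
    finally show "(\<Sum>S2\<in>Pow (A - I). bern p (A - I) S2 * of_bool (card S1 + card S2 = N)) \<le> B" .
    show "0 \<le> bern p I S1 * of_bool (E S1)"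
      using S1 I p by (intro mult_nonneg_nonneg bern_nonneg) auto
  qed
  finally show ?thesis by (simp add: sum_distrib_right)
qed

lemma integral_q_volume:
  fixes g :: "nat set \<Rightarrow> 'b :: {banach, second_countable_topology}" and z q :: real
  assumes q: "q > 0" and z: "z > 0" and p: "\<And>j. p j = z * q ^ j / (1 + z * q ^ j)"
  shows "(\<integral>\<pi>. g (down_steps \<pi>) \<partial>q_volume q a b)
    = (\<Sum>S | S \<subseteq> {..<a + b} \<and> card S = a. bern p {..<a + b} S *\<^sub>R g S)
      /\<^sub>R (\<Sum>S | S \<subseteq> {..<a + b} \<and> card S = a. bern p {..<a + b} S)"
proof -
  define A where "A = {..<a + b}"
  define Y where "Y = young_diagrams a b"
  \<comment> \<open>Collects the factors shared by all diagrams: the number of down-steps is always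
    \<open>a\<close>, and the power of \<open>q\<close> comes from the sum of their positions for
    the empty diagram.\<close>
  define k where "k = z ^ a * q ^ (\<Sum>i<a. a - 1 - i) / (\<Prod>j\<in>A. 1 + z * q ^ j)"
  have pos: "1 + z * q ^ j > 0" for j using q z by (simp add: add_pos_pos)
  have k: "k > 0" unfolding k_def using q z pos by (intro divide_pos_pos mult_pos_pos prod_pos) auto
  have weight: "bern p A (down_steps \<pi>) = k * q ^ diagram_size \<pi>" if \<pi>: "\<pi> \<in> Y" for \<pi>
  proof -
    define S where "S = down_steps \<pi>"
    have S: "S \<subseteq> A" "card S = a" "finite S" "finite A"
      using down_steps_subset card_down_steps \<pi> finite_subset[of S A] by (auto simp: S_def A_def Y_def)
    have len: "length \<pi> = a" using \<pi> by (simp add: Y_def young_diagrams_def)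
    have "(\<Sum>j\<in>S. j) = (\<Sum>i<a. down_step \<pi> i)"
      unfolding S_def down_steps_def len using inj_on_down_step \<pi> by (subst sum.reindex) (auto simp: Y_def)
    also have "\<dots> = diagram_size \<pi> + (\<Sum>i<a. a - 1 - i)"
      unfolding down_step_def len sum.distrib
      by (simp add: len diagram_size_def sum_list_sum_nth lessThan_atLeast0)
    finally have sumS: "(\<Sum>j\<in>S. j) = diagram_size \<pi> + (\<Sum>i<a. a - 1 - i)" .
    have "1 - p j = 1 / (1 + z * q ^ j)" for j using pos[of j] by (simp add: p field_simps)
    then have "bern p A S = (\<Prod>j\<in>S. z * q ^ j) / (\<Prod>j\<in>S. 1 + z * q ^ j) * (1 / (\<Prod>j\<in>A - S. 1 + z * q ^ j))"
      unfolding bern_def by (simp add: p prod_dividef)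
    also have "\<dots> = (\<Prod>j\<in>S. z * q ^ j) / (\<Prod>j\<in>A. 1 + z * q ^ j)"
      using prod.subset_diff[OF S(1,4), of "\<lambda>j. 1 + z * q ^ j"] by (simp add: mult.commute)
    also have "(\<Prod>j\<in>S. z * q ^ j) = z ^ a * q ^ (\<Sum>j\<in>S. j)"
      by (simp add: prod.distrib S(2) power_sum)
    finally show ?thesis by (simp add: S_def[symmetric] sumS k_def power_add)
  qed
  have bij: "bij_betw down_steps Y {S. S \<subseteq> A \<and> card S = a}"
    unfolding Y_def A_def by (rule bij_betw_down_steps)
  define Z where "Z = partition_function q a b"
  have Z: "Z > 0" unfolding Z_def by (rule partition_function_pos[OF q])
  have den: "(\<Sum>S | S \<subseteq> A \<and> card S = a. bern p A S) = k * Z"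
  proof -
    have "(\<Sum>S | S \<subseteq> A \<and> card S = a. bern p A S) = (\<Sum>\<pi>\<in>Y. bern p A (down_steps \<pi>))"
      by (rule sum.reindex_bij_betw[OF bij, symmetric])
    also have "\<dots> = k * Z" by (simp add: weight Z_def partition_function_def Y_def[symmetric] sum_distrib_left)
    finally show ?thesis .
  qed
  have "(\<integral>\<pi>. g (down_steps \<pi>) \<partial>q_volume q a b) = (\<Sum>\<pi>\<in>Y. (q ^ diagram_size \<pi> / Z) *\<^sub>R g (down_steps \<pi>))"
    unfolding q_volume_def Z_def Y_def using q partition_function_pos[OF q, of a b]
    by (intro lebesgue_integral_point_measure_finite finite_young_diagrams) auto
  also have "\<dots> = (\<Sum>\<pi>\<in>Y. (bern p A (down_steps \<pi>) *\<^sub>R g (down_steps \<pi>)) /\<^sub>R (k * Z))"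
    using k by (intro sum.cong refl) (simp add: weight field_simps)
  also have "\<dots> = (\<Sum>S | S \<subseteq> A \<and> card S = a. (bern p A S *\<^sub>R g S) /\<^sub>R (k * Z))"
    by (rule sum.reindex_bij_betw[OF bij])
  also have "\<dots> = (\<Sum>S | S \<subseteq> A \<and> card S = a. bern p A S *\<^sub>R g S) /\<^sub>R (k * Z)"
    by (simp add: scaleR_sum_right)
  finally show ?thesis unfolding A_def[symmetric] den .
qed

section \<open>The Ornstein-Uhlenbeck bridge\<close>

definition triangle :: "real \<Rightarrow> real" where
  "triangle t = max 0 (min t (1 - t))"

text \<open>Primitives of the Haar functions normalised in L2. The primitive of the constant
  function is absent, since it belongs to Brownian motion but not to the bridge.\<close>

definition schauder :: "nat \<times> nat \<Rightarrow> real \<Rightarrow> real" where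
  "schauder = (\<lambda>(n, k) t. (1 / sqrt 2) ^ n * triangle (2 ^ n * t - real k))"

text \<open>The extension by 0 lets the self-similarity \<open>bridge_cov_self_similar\<close> hold
  for all real arguments.\<close>

definition bridge_cov :: "real \<Rightarrow> real \<Rightarrow> real" where
  "bridge_cov s t = (if s \<in> {0..1} \<and> t \<in> {0..1} then min s t - s * t else 0)"

definition level :: "nat \<Rightarrow> (nat \<times> nat) set" where
  "level n = Pair n ` {..<2 ^ n}"

lemma finite_level: "finite (level n)"
  by (simp add: level_def)

lemma card_level: "card (level n) = 2 ^ n"
  by (simp add: level_def card_image inj_on_def)

lemma sum_level: "(\<Sum>j\<in>level n. f j) = (\<Sum>k<2 ^ n. f (n, k))"
  unfolding level_def by (subst sum.reindex) (auto simp: inj_on_def)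

lemma triangle_bounds: "0 \<le> triangle t" "triangle t \<le> 1"
  by (auto simp: triangle_def)

lemma triangle_eq_0: "t \<notin> {0<..<1} \<Longrightarrow> triangle t = 0"
  by (auto simp: triangle_def)

lemma continuous_on_schauder: "continuous_on S (schauder j)"
  unfolding schauder_def triangle_def by (cases j) (auto intro!: continuous_intros)

lemma sum_lessThan_double:
  fixes f :: "nat \<Rightarrow> real"
  shows "(\<Sum>k<2 * m. f k) = (\<Sum>k<m. f k) + (\<Sum>k<m. f (m + k))"
proof -
  have "(\<Sum>k<2 * m. f k) = (\<Sum>k<m. f k) + (\<Sum>k=m..<2 * m. f k)"
    by (subst sum.atLeastLessThan_concat[of 0 m "2 * m", symmetric, unfolded atLeast0LessThan]) auto
  also have "(\<Sum>k=m..<2 * m. f k) = (\<Sum>k<m. f (m + k))"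
    using sum.shift_bounds_nat_ivl[of f 0 m m] by (simp add: mult_2 atLeast0LessThan add.commute)
  finally show ?thesis .
qed

text \<open>The hats of level \<open>n + 1\<close> in the left and in the right half of the interval
  are copies of those of level \<open>n\<close>, each product halved by the normalisation.\<close>

lemma level_kernel_Suc:
  "(\<Sum>j\<in>level (Suc n). schauder j s * schauder j t)
   = ((\<Sum>j\<in>level n. schauder j (2 * s) * schauder j (2 * t))
     + (\<Sum>j\<in>level n. schauder j (2 * s - 1) * schauder j (2 * t - 1))) / 2"
proof -
  have sq: "(1 / sqrt 2) ^ Suc n * x * ((1 / sqrt 2) ^ Suc n * y) = ((1 / sqrt 2) ^ n * x * ((1 / sqrt 2) ^ n * y)) / 2"
    for x y :: real
    by (simp add: field_simps)
  have a: "schauder (Suc n, k) s * schauder (Suc n, k) t = (schauder (n, k) (2 * s) * schauder (n, k) (2 * t)) / 2"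
    for k s t
    unfolding schauder_def split_conv sq by (simp add: mult_ac)
  have b: "schauder (Suc n, 2 ^ n + k) s * schauder (Suc n, 2 ^ n + k) t
      = (schauder (n, k) (2 * s - 1) * schauder (n, k) (2 * t - 1)) / 2" for k s t
  proof -
    have "2 ^ Suc n * x - real (2 ^ n + k) = 2 ^ n * (2 * x - 1) - real k" for x
      by (simp add: algebra_simps)
    then show ?thesis unfolding schauder_def split_conv sq by (simp only:)
  qed
  have "(\<Sum>j\<in>level (Suc n). schauder j s * schauder j t)
      = (\<Sum>k<2 * 2 ^ n. schauder (Suc n, k) s * schauder (Suc n, k) t)"
    unfolding sum_level by simp
  also have "\<dots> = (\<Sum>k<2 ^ n. schauder (Suc n, k) s * schauder (Suc n, k) t)
      + (\<Sum>k<2 ^ n. schauder (Suc n, 2 ^ n + k) s * schauder (Suc n, 2 ^ n + k) t)"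
    by (rule sum_lessThan_double)
  finally show ?thesis
    unfolding b unfolding a sum_level by (simp add: sum_divide_distrib add_divide_distrib)
qed

text \<open>The Schauder kernels satisfy the same recursion, which halves the error in each step, so that
  completeness of the Haar system is not needed.\<close>

lemma bridge_cov_self_similar:
  "bridge_cov s t = triangle s * triangle t + (bridge_cov (2 * s) (2 * t) + bridge_cov (2 * s - 1) (2 * t - 1)) / 2"
proof -
  have *: "bridge_cov s t = triangle s * triangle t + (bridge_cov (2 * s) (2 * t) + bridge_cov (2 * s - 1) (2 * t - 1)) / 2"
    if "s \<le> t" for s t
  proof -
    consider "s < 0" | "1 < t" | "0 \<le> s" "t \<le> 1 / 2" | "0 \<le> s" "s \<le> 1 / 2" "1 / 2 < t" "t \<le> 1" | "1 / 2 < s" "t \<le> 1"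
      by linarith
    then show ?thesis
    proof cases
      case 3
      then show ?thesis
        using that by (cases "t = 1 / 2"; cases "s = 1 / 2")
          (auto simp: bridge_cov_def triangle_def min_def max_def field_simps)
    next
      case 4
      then show ?thesis
        using that by (cases "s = 1 / 2")
          (auto simp: bridge_cov_def triangle_def min_def max_def field_simps)
    next
      case 5
      then show ?thesis
        using that by (auto simp: bridge_cov_def triangle_def min_def max_def field_simps)
    qed (use that in \<open>auto simp: bridge_cov_def triangle_def min_def max_def\<close>)
  qed
  have sym: "bridge_cov s t = bridge_cov t s" for s t
    by (auto simp: bridge_cov_def min.commute mult.commute)
  show ?thesis
  proof (cases "s \<le> t")
    case False
    then show ?thesis using *[of t s] sym by (simp add: mult.commute)
  qed (rule *)
qed

text \<open>The covariance of the partial sum of the Gaussian series over the levels below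
  \<open>N\<close>.\<close>

definition bridge_kernel :: "nat \<Rightarrow> real \<Rightarrow> real \<Rightarrow> real" where
  "bridge_kernel N s t = (\<Sum>n<N. \<Sum>j\<in>level n. schauder j s * schauder j t)"

lemma bridge_kernel_Suc:
  "bridge_kernel (Suc N) s t = triangle s * triangle t
    + (bridge_kernel N (2 * s) (2 * t) + bridge_kernel N (2 * s - 1) (2 * t - 1)) / 2"
proof -
  have "bridge_kernel (Suc N) s t
      = (\<Sum>j\<in>level 0. schauder j s * schauder j t) + (\<Sum>n<N. \<Sum>j\<in>level (Suc n). schauder j s * schauder j t)"
    unfolding bridge_kernel_def by (rule sum.lessThan_Suc_shift)
  moreover have "(\<Sum>j\<in>level 0. schauder j s * schauder j t) = triangle s * triangle t"
    by (simp add: sum_level schauder_def)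
  ultimately show ?thesis
    by (simp add: level_kernel_Suc bridge_kernel_def sum.distrib sum_divide_distrib add_divide_distrib)
qed

lemma bridge_kernel_outside:
  assumes "s \<notin> {0<..<1}"
  shows "bridge_kernel N s t = 0" "bridge_cov s t = 0"
proof -
  have "schauder j s = 0" if "j \<in> level n" for j n
  proof -
    obtain k where k: "j = (n, k)" "k < 2 ^ n" using \<open>j \<in> level n\<close> by (auto simp: level_def)
    have "real k + 1 \<le> 2 ^ n"
      using k(2) by (metis Suc_leI add.commute of_nat_Suc of_nat_le_iff of_nat_numeral of_nat_power)
    have "2 ^ n * s - real k \<notin> {0<..<1}"
    proof (cases "s \<le> 0")
      case True
      then have "2 ^ n * s \<le> 0" by (simp add: mult_nonneg_nonpos)
      then show ?thesis by auto
    next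
      case False
      then have "1 \<le> s" using assms by auto
      then have "2 ^ n * 1 \<le> 2 ^ n * s" by (intro mult_left_mono) auto
      then have "1 \<le> 2 ^ n * s - real k" using \<open>real k + 1 \<le> 2 ^ n\<close> by linarith
      then show ?thesis by auto
    qed
    then show ?thesis by (simp add: schauder_def k triangle_eq_0)
  qed
  then show "bridge_kernel N s t = 0" by (simp add: bridge_kernel_def)
  show "bridge_cov s t = 0" using assms by (force simp: bridge_cov_def)
qed

text \<open>In the recursion only the copy for the half containing \<open>s\<close> contributes; the
  other error vanishes by \<open>bridge_kernel_outside\<close>, and the factor \<open>1 / 2\<close>
  remains.\<close>

lemma bridge_kernel_error: "\<bar>bridge_cov s t - bridge_kernel N s t\<bar> \<le> (1 / 2) ^ N"
proof (induction N arbitrary: s t)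
  case 0
  have "\<bar>min s t - s * t\<bar> \<le> 1" if "s \<in> {0..1}" "t \<in> {0..1}"
  proof -
    have "s * t \<le> s" "s * t \<le> t" "0 \<le> s * t"
      using that by (auto simp: mult_left_le mult_left_le_one_le)
    then show ?thesis using that by (auto simp: min_def)
  qed
  then show ?case by (simp add: bridge_kernel_def bridge_cov_def)
next
  case (Suc N)
  have eq: "bridge_cov s t - bridge_kernel (Suc N) s t
      = ((bridge_cov (2 * s) (2 * t) - bridge_kernel N (2 * s) (2 * t))
        + (bridge_cov (2 * s - 1) (2 * t - 1) - bridge_kernel N (2 * s - 1) (2 * t - 1))) / 2"
    unfolding bridge_kernel_Suc by (subst bridge_cov_self_similar) (simp add: field_simps)
  show ?case
  proof (cases "s \<le> 1 / 2")
    case True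
    then have "bridge_cov (2 * s - 1) (2 * t - 1) - bridge_kernel N (2 * s - 1) (2 * t - 1) = 0"
      using bridge_kernel_outside[of "2 * s - 1"] by auto
    then show ?thesis using Suc.IH[of "2 * s" "2 * t"] by (simp add: eq)
  next
    case False
    then have "bridge_cov (2 * s) (2 * t) - bridge_kernel N (2 * s) (2 * t) = 0"
      using bridge_kernel_outside[of "2 * s"] by auto
    then show ?thesis using Suc.IH[of "2 * s - 1" "2 * t - 1"] by (simp add: eq)
  qed
qed

lemma bridge_kernel_tendsto: "(\<lambda>N. bridge_kernel N s t) \<longlonglongrightarrow> bridge_cov s t"
proof -
  have "(\<lambda>N. bridge_cov s t - bridge_kernel N s t) \<longlonglongrightarrow> 0"
    by (rule Lim_null_comparison[OF _ LIMSEQ_realpow_zero[of "1 / 2"]])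
       (auto simp: bridge_kernel_error)
  from tendsto_diff[OF tendsto_const[of "bridge_cov s t"] this] show ?thesis by simp
qed

definition bridge_level :: "nat \<Rightarrow> real \<Rightarrow> (nat \<times> nat \<Rightarrow> real) \<Rightarrow> real" where
  "bridge_level n t \<omega> = (\<Sum>j\<in>level n. \<omega> j * schauder j t)"

text \<open>Coefficients are cut at \<open>(5 / 4) ^ n\<close>; a coefficient of modulus
  \<open>z\<close> above this level satisfies \<open>z \<le> (4 / 5) ^ (3 * n) * z ^ 4\<close>. As a
  level has \<open>2 ^ n\<close> coefficients, any base strictly between 2^(1/6) and 2^(1/2) in
  place of \<open>5 / 4\<close> makes both expected sums over \<open>n\<close> finite.\<close>

definition level_bound :: "nat \<Rightarrow> (nat \<times> nat \<Rightarrow> real) \<Rightarrow> real" where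
  "level_bound n \<omega> = (5 / 4 / sqrt 2) ^ n + ((4 / 5) ^ 3 / sqrt 2) ^ n * (\<Sum>j\<in>level n. \<omega> j ^ 4)"

lemma level_bound_nonneg: "0 \<le> level_bound n \<omega>"
  unfolding level_bound_def
  by (intro add_nonneg_nonneg mult_nonneg_nonneg sum_nonneg zero_le_power zero_le_even_power) auto

text \<open>The fourth powers control the maximum of the coefficients of a level, whose hats have disjoint
  supports.\<close>

lemma bridge_level_bound: "\<bar>bridge_level n t \<omega>\<bar> \<le> level_bound n \<omega>"
proof -
  define k0 where "k0 = nat \<lfloor>2 ^ n * t\<rfloor>"
  have off: "schauder (n, k) t = 0" if "k \<noteq> k0" for k
  proof -
    have "2 ^ n * t - real k \<notin> {0<..<1}"
    proof
      assume "2 ^ n * t - real k \<in> {0<..<1}"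
      then have "\<lfloor>2 ^ n * t\<rfloor> = int k" by (simp add: floor_eq_iff)
      then show False using that by (simp add: k0_def)
    qed
    then show ?thesis by (simp add: schauder_def triangle_eq_0)
  qed
  have eq: "bridge_level n t \<omega> = (\<Sum>k\<in>{..<2 ^ n} \<inter> {k0}. \<omega> (n, k) * schauder (n, k) t)"
    unfolding bridge_level_def sum_level
    by (rule sum.mono_neutral_right) (auto simp: off)
  show ?thesis
  proof (cases "k0 < 2 ^ n")
    case False
    then show ?thesis using eq level_bound_nonneg by simp
  next
    case True
    define z where "z = \<bar>\<omega> (n, k0)\<bar>"
    have z: "z \<le> (5 / 4) ^ n + ((4 / 5) ^ 3) ^ n * z ^ 4"
    proof (cases "z \<le> (5 / 4) ^ n")
      case True
      then show ?thesis by (simp add: z_def add_increasing2)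
    next
      case False
      have "((4 / 5 :: real) ^ 3) ^ n = ((4 / 5) ^ n) ^ 3"
        by (simp only: power_mult[symmetric] mult.commute)
      then have "((4 / 5 :: real) ^ 3) ^ n * ((5 / 4) ^ n) ^ 3 = ((4 / 5) ^ n * (5 / 4) ^ n) ^ 3"
        by (simp only: power_mult_distrib)
      also have "\<dots> = 1" by (simp add: power_mult_distrib[symmetric])
      finally have "z = z * (((4 / 5) ^ 3) ^ n * ((5 / 4) ^ n) ^ 3)" by simp
      also have "\<dots> \<le> z * (((4 / 5) ^ 3) ^ n * z ^ 3)"
        using False by (intro mult_left_mono power_mono) (auto simp: z_def)
      also have "\<dots> = ((4 / 5) ^ 3) ^ n * z ^ 4" by (simp add: power_numeral_reduce)
      finally show ?thesis by (simp add: add_increasing)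
    qed
    have "\<bar>bridge_level n t \<omega>\<bar> = z * ((1 / sqrt 2) ^ n * triangle (2 ^ n * t - real k0))"
      using True by (simp add: eq z_def schauder_def abs_mult triangle_bounds)
    also have "\<dots> \<le> z * ((1 / sqrt 2) ^ n * 1)"
      by (intro mult_left_mono triangle_bounds) (auto simp: z_def)
    also have "\<dots> \<le> ((5 / 4) ^ n + ((4 / 5) ^ 3) ^ n * z ^ 4) * (1 / sqrt 2) ^ n"
      using z by (simp add: mult_right_mono)
    also have "\<dots> = (5 / 4 / sqrt 2) ^ n + ((4 / 5) ^ 3 / sqrt 2) ^ n * z ^ 4"
      by (simp add: power_divide field_simps)
    also have "z ^ 4 = \<omega> (n, k0) ^ 4" by (simp add: z_def)
    also have "\<omega> (n, k0) ^ 4 \<le> (\<Sum>j\<in>level n. \<omega> j ^ 4)"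
      using True finite_level by (intro member_le_sum) (auto simp: level_def)
    finally show ?thesis by (simp add: level_bound_def)
  qed
qed

section \<open>The Schauder series with independent Gaussian coefficients\<close>

definition gauss_space :: "(nat \<times> nat \<Rightarrow> real) measure" where
  "gauss_space = PiM UNIV (\<lambda>_. std_normal_distribution)"

lemma product_prob_space_normal: "product_prob_space (\<lambda>_. std_normal_distribution)"
proof -
  interpret N: prob_space std_normal_distribution
    by (rule real_distribution.axioms(1)[OF real_dist_normal_dist])
  show ?thesis by standard
qed

lemma prob_space_gauss_space: "prob_space gauss_space"
  unfolding gauss_space_def
  by (rule prob_space_PiM) (rule real_distribution.axioms(1)[OF real_dist_normal_dist])

lemma measurable_gauss_coordinate [measurable]: "(\<lambda>\<omega>. \<omega> j) \<in> borel_measurable gauss_space"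
  using measurable_component_singleton[of j UNIV "\<lambda>_. std_normal_distribution"]
  by (simp add: gauss_space_def cong: measurable_cong_sets)

lemma measurable_bridge_level [measurable]: "bridge_level n t \<in> borel_measurable gauss_space"
  unfolding bridge_level_def by measurable

lemma measurable_level_bound [measurable]: "level_bound n \<in> borel_measurable gauss_space"
  unfolding level_bound_def by measurable

lemma char_gauss_combination:
  assumes "finite J"
  shows "(\<integral>\<omega>. iexp (\<Sum>j\<in>J. w j * \<omega> j) \<partial>gauss_space) = complex_of_real (exp (- (\<Sum>j\<in>J. (w j)\<^sup>2) / 2))"
proof -
  interpret product_prob_space "\<lambda>_::nat \<times> nat. std_normal_distribution" UNIV
    using product_prob_space_normal by (simp add: product_prob_space_def product_prob_space_axioms_def)
  have "(\<integral>\<omega>. iexp (\<Sum>j\<in>J. w j * \<omega> j) \<partial>gauss_space)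
      = (\<integral>\<omega>. iexp (\<Sum>j\<in>J. w j * restrict \<omega> J j) \<partial>gauss_space)"
    by (intro Bochner_Integration.integral_cong refl) simp
  also have "\<dots> = (\<integral>x. iexp (\<Sum>j\<in>J. w j * x j) \<partial>distr gauss_space (std_normal_on J) (\<lambda>x. restrict x J))"
  proof (rule integral_distr[symmetric])
    show "(\<lambda>x. restrict x J) \<in> gauss_space \<rightarrow>\<^sub>M std_normal_on J"
      unfolding gauss_space_def by (rule measurable_restrict_subset) simp
    have [measurable]: "(\<lambda>l. l k) \<in> borel_measurable (std_normal_on J)" if "k \<in> J" for k
      using measurable_component_singleton[OF that, of "\<lambda>_. std_normal_distribution"]
      by (simp cong: measurable_cong_sets)
    show "(\<lambda>x. iexp (\<Sum>j\<in>J. w j * x j)) \<in> borel_measurable (std_normal_on J)"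
      by measurable
  qed
  also have "distr gauss_space (std_normal_on J) (\<lambda>x. restrict x J) = std_normal_on J"
    unfolding gauss_space_def using assms by (intro distr_PiM_restrict_finite) auto
  also have "(\<integral>x. iexp (\<Sum>j\<in>J. w j * x j) \<partial>std_normal_on J)
      = (\<integral>x. (\<Prod>j\<in>J. iexp (w j * x j)) \<partial>std_normal_on J)"
    using assms by (simp add: exp_sum[symmetric] sum_distrib_left)
  also have "\<dots> = (\<Prod>j\<in>J. (\<integral>x. iexp (w j * x) \<partial>std_normal_distribution))"
    by (rule product_integral_prod[OF assms])
       (use M.integrable_iexp[of "\<lambda>x. w _ * x"] in \<open>simp cong: measurable_cong_sets\<close>)
  also have "\<dots> = (\<Prod>j\<in>J. complex_of_real (exp (- (w j)\<^sup>2 / 2)))"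
    using fun_cong[OF char_std_normal_distribution] by (simp add: char_def)
  also have "\<dots> = complex_of_real (exp (\<Sum>j\<in>J. - (w j)\<^sup>2 / 2))"
    using assms by (simp add: exp_sum)
  also have "(\<Sum>j\<in>J. - (w j)\<^sup>2 / 2) = - (\<Sum>j\<in>J. (w j)\<^sup>2) / 2"
    by (simp add: sum_divide_distrib sum_negf)
  finally show ?thesis .
qed

lemma nn_integral_gauss_fourth_moment: "(\<integral>\<^sup>+\<omega>. ennreal (\<omega> j ^ 4) \<partial>gauss_space) = 3"
proof -
  interpret product_prob_space "\<lambda>_::nat \<times> nat. std_normal_distribution" UNIV
    using product_prob_space_normal by (simp add: product_prob_space_def product_prob_space_axioms_def)
  have "(\<integral>\<^sup>+\<omega>. ennreal (\<omega> j ^ 4) \<partial>gauss_space)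
      = (\<integral>\<^sup>+x. ennreal (x ^ 4) \<partial>distr gauss_space std_normal_distribution (\<lambda>\<omega>. \<omega> j))"
    unfolding gauss_space_def
    by (rule nn_integral_distr[symmetric, OF measurable_component_singleton]) auto
  also have "distr gauss_space std_normal_distribution (\<lambda>\<omega>. \<omega> j) = std_normal_distribution"
    unfolding gauss_space_def by (rule PiM_component) simp
  also have "(\<integral>\<^sup>+x. ennreal (x ^ 4) \<partial>std_normal_distribution) = ennreal (\<integral>x. x ^ 4 \<partial>std_normal_distribution)"
    by (rule nn_integral_eq_integral) (auto intro: integrable_std_normal_distribution_moment)
  also have "(\<integral>x. x ^ 4 \<partial>std_normal_distribution) = 3"
    using std_normal_distribution_even_moments(1)[of 2] by (simp add: fact_numeral)
  finally show ?thesis by simp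
qed

text \<open>Summability phrased as finiteness of an \<open>ennreal\<close> sum, so that it is a
  measurable event and follows almost surely from a finite expectation.\<close>

definition good_series :: "(nat \<times> nat \<Rightarrow> real) \<Rightarrow> bool" where
  "good_series \<omega> \<longleftrightarrow> (\<Sum>n. ennreal (level_bound n \<omega>)) < \<infinity>"

lemma measurable_good_series [measurable]: "Measurable.pred gauss_space good_series"
  unfolding good_series_def by measurable

lemma AE_good_series: "AE \<omega> in gauss_space. good_series \<omega>"
proof -
  interpret prob_space gauss_space by (rule prob_space_gauss_space)
  define x y :: real where "x = 5 / 4 / sqrt 2" and "y = (4 / 5) ^ 3 / sqrt 2"
  have s2: "sqrt 2 * sqrt 2 = 2" "5 / 4 < sqrt 2" "sqrt 2 < 3 / 2"
    by (simp, rule real_less_rsqrt, simp add: power2_eq_square)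
       (rule real_less_lsqrt, simp_all add: power2_eq_square)
  have x: "0 \<le> x" "x < 1" using s2 by (auto simp: x_def)
  have y: "0 \<le> y" "2 * y < 1"
  proof -
    have "2 * y = sqrt 2 * (4 / 5) ^ 3" using s2(1) by (simp add: y_def field_simps)
    also have "\<dots> < 1" using s2(3) by (simp add: power3_eq_cube)
    finally show "2 * y < 1" .
  qed (simp add: y_def)
  have int: "(\<integral>\<^sup>+\<omega>. ennreal (level_bound n \<omega>) \<partial>gauss_space) = ennreal (x ^ n + 3 * (2 * y) ^ n)" for n
  proof -
    have "ennreal (level_bound n \<omega>) = ennreal (x ^ n) + ennreal (y ^ n) * (\<Sum>j\<in>level n. ennreal (\<omega> j ^ 4))" for \<omega>
      unfolding level_bound_def x_def[symmetric] y_def[symmetric] using x(1) y(1)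
      by (simp add: sum_ennreal ennreal_plus ennreal_mult sum_nonneg)
    then have "(\<integral>\<^sup>+\<omega>. ennreal (level_bound n \<omega>) \<partial>gauss_space)
        = ennreal (x ^ n) + ennreal (y ^ n) * (\<Sum>j\<in>level n. (3 :: ennreal))"
      by (simp add: nn_integral_add nn_integral_cmult nn_integral_sum nn_integral_gauss_fourth_moment emeasure_space_1 del: sum_ennreal)
    also have "(\<Sum>j\<in>level n. (3 :: ennreal)) = ennreal (3 * 2 ^ n)"
      by (simp add: card_level ennreal_mult ennreal_power[symmetric] mult.commute)
    also have "ennreal (x ^ n) + ennreal (y ^ n) * ennreal (3 * 2 ^ n) = ennreal (x ^ n + 3 * (2 * y) ^ n)"
      using x(1) y(1) by (simp add: ennreal_mult[symmetric] ennreal_plus[symmetric] power_mult_distrib mult_ac del: ennreal_plus)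
    finally show ?thesis .
  qed
  have summ: "summable (\<lambda>n. x ^ n + 3 * (2 * y) ^ n)"
    using x y by (intro summable_add summable_mult summable_geometric) auto
  have "(\<integral>\<^sup>+\<omega>. (\<Sum>n. ennreal (level_bound n \<omega>)) \<partial>gauss_space) = (\<Sum>n. ennreal (x ^ n + 3 * (2 * y) ^ n))"
    by (simp add: nn_integral_suminf int)
  also have "\<dots> = ennreal (\<Sum>n. x ^ n + 3 * (2 * y) ^ n)"
    by (rule suminf_ennreal_eq) (use x y summ in \<open>auto intro: summable_sums\<close>)
  finally have "(\<integral>\<^sup>+\<omega>. (\<Sum>n. ennreal (level_bound n \<omega>)) \<partial>gauss_space) \<noteq> \<infinity>" by simp
  then have "AE \<omega> in gauss_space. (\<Sum>n. ennreal (level_bound n \<omega>)) \<noteq> \<infinity>"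
    by (intro nn_integral_PInf_AE) auto
  then show ?thesis by eventually_elim (simp add: good_series_def top.not_eq_extremum)
qed

lemma summable_level_bound: "good_series \<omega> \<Longrightarrow> summable (\<lambda>n. level_bound n \<omega>)"
  unfolding good_series_def by (intro summable_suminf_not_top level_bound_nonneg) auto

text \<open>The value 0 on the exceptional null set makes every path continuous, as
  \<open>measurable_to_cadlag\<close> requires.\<close>

definition bridge :: "real \<Rightarrow> (nat \<times> nat \<Rightarrow> real) \<Rightarrow> real" where
  "bridge t \<omega> = (if good_series \<omega> then (\<Sum>n. bridge_level n t \<omega>) else 0)"

lemma measurable_bridge [measurable]: "bridge t \<in> borel_measurable gauss_space"
  unfolding bridge_def by measurable

lemma continuous_on_bridge: "continuous_on UNIV (\<lambda>t. bridge t \<omega>)"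
proof (cases "good_series \<omega>")
  case True
  have "uniform_limit UNIV (\<lambda>N t. \<Sum>n<N. bridge_level n t \<omega>) (\<lambda>t. \<Sum>n. bridge_level n t \<omega>) sequentially"
    by (rule Weierstrass_m_test[OF _ summable_level_bound[OF True]]) (simp add: bridge_level_bound)
  then have "continuous_on UNIV (\<lambda>t. \<Sum>n. bridge_level n t \<omega>)"
    by (rule uniform_limit_theorem[rotated])
       (auto simp: bridge_level_def intro!: always_eventually continuous_intros continuous_on_schauder)
  then show ?thesis by (simp add: bridge_def True)
qed (simp add: bridge_def)

text \<open>The partial sums are finite Gaussian combinations with covariance
  \<open>bridge_kernel\<close>, and their characteristic functions converge to both sides.\<close>

lemma char_bridge:
  assumes "finite J"
  shows "(\<integral>\<omega>. iexp (\<Sum>i\<in>J. u i * bridge (\<tau> i) \<omega>) \<partial>gauss_space)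
    = complex_of_real (exp (- (\<Sum>i\<in>J. \<Sum>k\<in>J. u i * u k * bridge_cov (\<tau> i) (\<tau> k)) / 2))"
proof (rule LIMSEQ_unique)
  interpret prob_space gauss_space by (rule prob_space_gauss_space)
  define L where "L = (\<lambda>N. \<Union>n<N. level n)"
  have L: "finite (L N)" for N by (simp add: L_def finite_level)
  have sumL: "(\<Sum>j\<in>L N. f j) = (\<Sum>n<N. \<Sum>j\<in>level n. f j)" for N and f :: "nat \<times> nat \<Rightarrow> real"
    unfolding L_def by (rule sum.UNION_disjoint) (auto simp: finite_level, auto simp: level_def)
  let ?P = "\<lambda>N \<omega>. \<Sum>i\<in>J. u i * (\<Sum>n<N. bridge_level n (\<tau> i) \<omega>)"
  show "(\<lambda>N. \<integral>\<omega>. iexp (?P N \<omega>) \<partial>gauss_space) \<longlonglongrightarrow> (\<integral>\<omega>. iexp (\<Sum>i\<in>J. u i * bridge (\<tau> i) \<omega>) \<partial>gauss_space)"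
  proof (rule integral_dominated_convergence[where w = "\<lambda>_. 1"])
    show "AE \<omega> in gauss_space. (\<lambda>N. iexp (?P N \<omega>)) \<longlonglongrightarrow> iexp (\<Sum>i\<in>J. u i * bridge (\<tau> i) \<omega>)"
      using AE_good_series
    proof eventually_elim
      case (elim \<omega>)
      have "(\<lambda>N. \<Sum>n<N. bridge_level n (\<tau> i) \<omega>) \<longlonglongrightarrow> bridge (\<tau> i) \<omega>" for i
      proof -
        have "summable (\<lambda>n. bridge_level n (\<tau> i) \<omega>)"
          by (rule summable_comparison_test'[OF summable_level_bound[OF elim]]) (simp add: bridge_level_bound)
        then show ?thesis using elim by (simp add: bridge_def summable_LIMSEQ)
      qed
      then show ?case by (intro tendsto_intros)
    qed
  qed auto
  have "(\<integral>\<omega>. iexp (?P N \<omega>) \<partial>gauss_space)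
      = complex_of_real (exp (- (\<Sum>i\<in>J. \<Sum>k\<in>J. u i * u k * bridge_kernel N (\<tau> i) (\<tau> k)) / 2))" for N
  proof -
    have "?P N \<omega> = (\<Sum>i\<in>J. \<Sum>j\<in>L N. u i * (\<omega> j * schauder j (\<tau> i)))" for \<omega>
      unfolding bridge_level_def sumL[symmetric] by (simp add: sum_distrib_left)
    also have "\<dots> \<omega> = (\<Sum>j\<in>L N. (\<Sum>i\<in>J. u i * schauder j (\<tau> i)) * \<omega> j)" for \<omega>
      by (subst sum.swap) (simp add: sum_distrib_left sum_distrib_right mult_ac)
    finally have "(\<integral>\<omega>. iexp (?P N \<omega>) \<partial>gauss_space)
        = complex_of_real (exp (- (\<Sum>j\<in>L N. (\<Sum>i\<in>J. u i * schauder j (\<tau> i))\<^sup>2) / 2))"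
      using char_gauss_combination[OF L[of N], of "\<lambda>j. \<Sum>i\<in>J. u i * schauder j (\<tau> i)"] by simp
    also have "(\<Sum>j\<in>L N. (\<Sum>i\<in>J. u i * schauder j (\<tau> i))\<^sup>2)
        = (\<Sum>j\<in>L N. \<Sum>i\<in>J. \<Sum>k\<in>J. u i * u k * (schauder j (\<tau> i) * schauder j (\<tau> k)))"
      by (simp add: power2_eq_square sum_product mult_ac)
    also have "\<dots> = (\<Sum>i\<in>J. \<Sum>k\<in>J. \<Sum>j\<in>L N. u i * u k * (schauder j (\<tau> i) * schauder j (\<tau> k)))"
      by (subst sum.swap) (intro sum.cong refl sum.swap)
    also have "\<dots> = (\<Sum>i\<in>J. \<Sum>k\<in>J. u i * u k * bridge_kernel N (\<tau> i) (\<tau> k))"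
      unfolding bridge_kernel_def sumL[symmetric] by (simp add: sum_distrib_left)
    finally show ?thesis .
  qed
  moreover have "(\<lambda>N. complex_of_real (exp (- (\<Sum>i\<in>J. \<Sum>k\<in>J. u i * u k * bridge_kernel N (\<tau> i) (\<tau> k)) / 2)))
      \<longlonglongrightarrow> complex_of_real (exp (- (\<Sum>i\<in>J. \<Sum>k\<in>J. u i * u k * bridge_cov (\<tau> i) (\<tau> k)) / 2))"
    by (intro tendsto_intros bridge_kernel_tendsto) auto
  ultimately show "(\<lambda>N. \<integral>\<omega>. iexp (?P N \<omega>) \<partial>gauss_space)
      \<longlonglongrightarrow> complex_of_real (exp (- (\<Sum>i\<in>J. \<Sum>k\<in>J. u i * u k * bridge_cov (\<tau> i) (\<tau> k)) / 2))"
    by simp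
qed

text \<open>Levy uniqueness identifies the distribution. The case \<open>v = 0\<close> is separate
  because it has no density; it occurs at the endpoints of the bridge.\<close>

lemma gaussian_from_char:
  assumes M: "prob_space M" and X[measurable]: "X \<in> borel_measurable M" and v: "0 \<le> v"
    and char: "\<And>u. (\<integral>\<omega>. iexp (u * X \<omega>) \<partial>M) = complex_of_real (exp (- u\<^sup>2 * v / 2))"
  shows "gaussian_rv M X" "integrable M X" "(\<integral>\<omega>. X \<omega> \<partial>M) = 0"
    "integrable M (\<lambda>\<omega>. (X \<omega>)\<^sup>2)" "(\<integral>\<omega>. (X \<omega>)\<^sup>2 \<partial>M) = v"
proof -
  interpret prob_space M by fact
  interpret D: real_distribution "distr M borel X" by (simp add: real_distribution_distr)
  have charD: "char (distr M borel X) u = complex_of_real (exp (- u\<^sup>2 * v / 2))" for u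
    using char[of u] by (simp add: char_def integral_distr)
  have "gaussian_rv M X \<and> integrable M X \<and> (\<integral>\<omega>. X \<omega> \<partial>M) = 0 \<and> integrable M (\<lambda>\<omega>. (X \<omega>)\<^sup>2)
      \<and> (\<integral>\<omega>. (X \<omega>)\<^sup>2 \<partial>M) = v"
  proof (cases "v = 0")
    case True
    interpret R: prob_space "return borel (0::real)" by (rule prob_space_return) simp
    have R: "real_distribution (return borel (0::real))"
      by (simp add: real_distribution_def real_distribution_axioms_def R.prob_space_axioms)
    have "distr M borel X = return borel 0"
    proof (rule Levy_uniqueness[OF D.real_distribution_axioms R], rule ext)
      show "char (distr M borel X) u = char (return borel 0) u" for u
        by (simp add: charD True) (simp add: char_def integral_return)
    qed
    moreover have "AE x in return borel 0. x = (0::real)" by (subst AE_return) auto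
    ultimately have "AE x in distr M borel X. x = 0" by (simp only:)
    then have 0: "AE \<omega> in M. X \<omega> = 0" by (simp add: AE_distr_iff)
    have "integrable M X" "integrable M (\<lambda>\<omega>. (X \<omega>)\<^sup>2)"
      using 0 integrable_cong_AE[of X M "\<lambda>_. 0"] integrable_cong_AE[of "\<lambda>\<omega>. (X \<omega>)\<^sup>2" M "\<lambda>_. 0"] by auto
    moreover have "(\<integral>\<omega>. X \<omega> \<partial>M) = 0" "(\<integral>\<omega>. (X \<omega>)\<^sup>2 \<partial>M) = 0"
      using 0 integral_cong_AE[of X M "\<lambda>_. 0"] integral_cong_AE[of "\<lambda>\<omega>. (X \<omega>)\<^sup>2" M "\<lambda>_. 0"] by auto
    ultimately show ?thesis using 0 True by (auto simp: gaussian_rv_def)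
  next
    case False
    define \<sigma> where "\<sigma> = sqrt v"
    have \<sigma>: "\<sigma> > 0" "\<sigma>\<^sup>2 = v" using v False by (auto simp: \<sigma>_def)
    interpret N: prob_space std_normal_distribution
      by (rule real_distribution.axioms(1)[OF real_dist_normal_dist])
    have "distributed std_normal_distribution lborel (\<lambda>x. x) std_normal_density"
      by (auto simp: distributed_def distr_id2 cong: distr_cong)
    then have scaled: "distributed std_normal_distribution lborel (\<lambda>x. 0 + \<sigma> * x) (normal_density (0 + \<sigma> * 0) (\<bar>\<sigma>\<bar> * 1))"
      using \<sigma> by (intro N.normal_density_affine) auto
    have dens: "distr std_normal_distribution borel (\<lambda>x. \<sigma> * x) = density lborel (normal_density 0 \<sigma>)"
    proof -
      have "distr std_normal_distribution lborel (\<lambda>x. \<sigma> * x) = density lborel (normal_density 0 \<sigma>)"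
        using scaled \<sigma> by (simp add: distributed_def)
      moreover have "distr std_normal_distribution lborel (\<lambda>x. \<sigma> * x) = distr std_normal_distribution borel (\<lambda>x. \<sigma> * x)"
        by (rule distr_cong) auto
      ultimately show ?thesis by simp
    qed
    interpret S: real_distribution "distr std_normal_distribution borel (\<lambda>x. \<sigma> * x)"
      by (rule N.real_distribution_distr) simp
    have "distr M borel X = distr std_normal_distribution borel (\<lambda>x. \<sigma> * x)"
    proof (rule Levy_uniqueness[OF D.real_distribution_axioms S.real_distribution_axioms], rule ext)
      fix u
      have "char (distr std_normal_distribution borel (\<lambda>x. \<sigma> * x)) u = char std_normal_distribution (u * \<sigma>)"
        by (simp add: char_def integral_distr mult.assoc)
      then show "char (distr M borel X) u = char (distr std_normal_distribution borel (\<lambda>x. \<sigma> * x)) u"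
        by (simp add: charD char_std_normal_distribution power_mult_distrib \<sigma>)
    qed
    then have eq: "distr M borel X = density lborel (normal_density 0 \<sigma>)" using dens by simp
    have "distr M lborel X = distr M borel X" by (rule distr_cong) auto
    then have D: "distributed M lborel X (normal_density 0 \<sigma>)"
      using eq by (simp add: distributed_def)
    have "gaussian_rv M X" using D \<sigma>(1) X unfolding gaussian_rv_def by blast
    moreover have "integrable M X" "integrable M (\<lambda>\<omega>. (X \<omega>)\<^sup>2)"
      using distributed_integrable[OF D, of "\<lambda>x. x"] distributed_integrable[OF D, of "\<lambda>x. x\<^sup>2"]
        integrable_normal_moment_nz_1[OF \<sigma>(1), of 0] integrable_normal_moment[OF \<sigma>(1), of 0 2]
      by auto
    moreover have "(\<integral>\<omega>. X \<omega> \<partial>M) = 0" "(\<integral>\<omega>. (X \<omega>)\<^sup>2 \<partial>M) = v"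
      using distributed_integral[OF D, of "\<lambda>x. x"] distributed_integral[OF D, of "\<lambda>x. x\<^sup>2"]
        integral_normal_moment_nz_1[OF \<sigma>(1), of 0] integral_normal_moment_even[OF \<sigma>(1), of 0 1] \<sigma>(2)
      by auto
    ultimately show ?thesis by blast
  qed
  then show "gaussian_rv M X" "integrable M X" "(\<integral>\<omega>. X \<omega> \<partial>M) = 0"
    "integrable M (\<lambda>\<omega>. (X \<omega>)\<^sup>2)" "(\<integral>\<omega>. (X \<omega>)\<^sup>2 \<partial>M) = v" by auto
qed

section \<open>From the Brownian bridge to the Ornstein-Uhlenbeck covariance\<close>

definition OU_cov :: "real \<Rightarrow> real \<Rightarrow> real \<Rightarrow> real" where
  "OU_cov c s t = sinh (c * min s t) * sinh (c * (1 - max s t)) / (c * sinh c)"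

text \<open>The covariance has the form \<open>u s * v t\<close> for \<open>s \<le> t\<close>, with \<open>u s = sinh (c s) / c\<close> and
  \<open>v t = sinh (c (1 - t)) / sinh c\<close>. It is therefore that of \<open>u + v\<close> times a Brownian bridge run with
  the clock \<open>u / (u + v)\<close>.\<close>

definition OU_scale :: "real \<Rightarrow> real \<Rightarrow> real" where
  "OU_scale c t = sinh (c * t) / c + sinh (c * (1 - t)) / sinh c"

definition OU_clock :: "real \<Rightarrow> real \<Rightarrow> real" where
  "OU_clock c t = sinh (c * t) / c / OU_scale c t"

definition OU_path :: "real \<Rightarrow> real \<Rightarrow> (nat \<times> nat \<Rightarrow> real) \<Rightarrow> real" where
  "OU_path c t \<omega> = OU_scale c t * bridge (OU_clock c t) \<omega>"

lemma sinh_ratio_mono: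
  fixes c s t :: real
  assumes "c \<noteq> 0" "s \<le> t"
  shows "sinh (c * s) / c \<le> sinh (c * t) / c" "sinh (c * s) / sinh c \<le> sinh (c * t) / sinh c"
proof -
  show "sinh (c * s) / c \<le> sinh (c * t) / c"
    using assms by (cases "c > 0") (auto simp: divide_right_mono divide_right_mono_neg mult_left_mono mult_left_mono_neg)
  show "sinh (c * s) / sinh c \<le> sinh (c * t) / sinh c"
    using assms by (cases "c > 0") (auto simp: divide_right_mono divide_right_mono_neg mult_left_mono mult_left_mono_neg)
qed

lemma OU_components:
  assumes "c \<noteq> 0" "t \<in> {0..1}"
  shows "0 \<le> sinh (c * t) / c" "0 \<le> sinh (c * (1 - t)) / sinh c" "0 < OU_scale c t"
proof -
  show a: "0 \<le> sinh (c * t) / c" and b: "0 \<le> sinh (c * (1 - t)) / sinh c"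
    using sinh_ratio_mono(1)[OF assms(1), of 0 t] sinh_ratio_mono(2)[OF assms(1), of 0 "1 - t"] assms(2) by auto
  show "0 < OU_scale c t"
  proof (cases "t = 0")
    case True
    then show ?thesis using assms by (simp add: OU_scale_def)
  next
    case False
    then have "0 < sinh (c * t) / c" using assms by (cases "c > 0") (auto simp: field_simps mult_neg_pos)
    then show ?thesis using b by (simp add: OU_scale_def add_pos_nonneg)
  qed
qed

lemma ratio_mono:
  fixes a b a' b' :: real
  assumes "0 < a + b" "0 < a' + b'" "a * b' \<le> a' * b"
  shows "a / (a + b) \<le> a' / (a' + b')"
  using assms by (simp add: pos_divide_le_eq pos_le_divide_eq) (simp add: algebra_simps)

lemma ratio_in_unit:
  fixes a b :: real
  assumes "0 \<le> a" "0 \<le> b" "0 < a + b"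
  shows "a / (a + b) \<in> {0..1}"
  using assms by simp

lemma OU_clock_eq: "OU_clock c t = sinh (c * t) / c / (sinh (c * t) / c + sinh (c * (1 - t)) / sinh c)"
  by (simp only: OU_clock_def OU_scale_def)

lemma OU_clock_in: "c \<noteq> 0 \<Longrightarrow> t \<in> {0..1} \<Longrightarrow> OU_clock c t \<in> {0..1}"
  using OU_components[of c t] unfolding OU_clock_eq OU_scale_def by (intro ratio_in_unit)

lemma OU_cov_eq:
  assumes c: "c \<noteq> 0" and "s \<in> {0..1}" "t \<in> {0..1}"
  shows "OU_scale c s * OU_scale c t * bridge_cov (OU_clock c s) (OU_clock c t) = OU_cov c s t"
proof -
  have *: "OU_scale c s * OU_scale c t * bridge_cov (OU_clock c s) (OU_clock c t) = OU_cov c s t"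
    if st: "s \<le> t" "s \<in> {0..1}" "t \<in> {0..1}" for s t
  proof -
    note gs = OU_components[OF c st(2)] and gt = OU_components[OF c st(3)]
    \<comment> \<open>Cross-multiplied form of the monotonicity of the clock:
      \<open>sinh (c * t) / c\<close> increases and \<open>sinh (c * (1 - t)) / sinh c\<close>
      decreases in \<open>t\<close>.\<close>
    have "sinh (c * s) / c * (sinh (c * (1 - t)) / sinh c) \<le> sinh (c * t) / c * (sinh (c * (1 - s)) / sinh c)"
      using sinh_ratio_mono[OF c, of s t] sinh_ratio_mono[OF c, of "1 - t" "1 - s"] gs gt st(1)
      by (intro mult_mono) auto
    then have "OU_clock c s \<le> OU_clock c t"
      using gs(3) gt(3) unfolding OU_clock_eq OU_scale_def by (intro ratio_mono)
    then have "bridge_cov (OU_clock c s) (OU_clock c t) = OU_clock c s * (1 - OU_clock c t)"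
      using OU_clock_in[OF c st(2)] OU_clock_in[OF c st(3)] by (simp add: bridge_cov_def min_def algebra_simps)
    then have "OU_scale c s * OU_scale c t * bridge_cov (OU_clock c s) (OU_clock c t)
        = (OU_scale c s * OU_clock c s) * (OU_scale c t - OU_scale c t * OU_clock c t)"
      by (simp only:) (simp add: algebra_simps)
    also have "\<dots> = sinh (c * s) / c * (sinh (c * (1 - t)) / sinh c)"
      using gs(3) gt(3) by (simp add: OU_clock_def) (simp add: OU_scale_def)
    finally show ?thesis using st(1) by (simp add: OU_cov_def min_def max_def)
  qed
  have sym: "bridge_cov s t = bridge_cov t s" "OU_cov c s t = OU_cov c t s" for s t
    by (auto simp: bridge_cov_def OU_cov_def min.commute max.commute mult.commute)
  show ?thesis
  proof (cases "s \<le> t")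
    case False
    then show ?thesis using *[of t s] assms sym by (simp add: mult.commute)
  qed (use * assms in auto)
qed

lemma continuous_on_OU_path:
  assumes "c \<noteq> 0"
  shows "continuous_on {0..1} (\<lambda>t. OU_path c t \<omega>)"
proof -
  have "continuous_on {0..1} (OU_scale c)"
    unfolding OU_scale_def using assms by (intro continuous_intros) auto
  moreover have "continuous_on {0..1} (OU_clock c)"
    unfolding OU_clock_def using assms OU_components(3)[OF assms] calculation
    by (intro continuous_intros) (auto simp: less_imp_neq[symmetric] dest: less_imp_neq)
  moreover have "continuous_on {0..1} (\<lambda>t. bridge (OU_clock c t) \<omega>)"
    by (rule continuous_on_compose2[OF continuous_on_bridge]) (use calculation in auto)
  ultimately show ?thesis unfolding OU_path_def by (intro continuous_intros)
qed

lemma measurable_OU_path [measurable]: "OU_path c t \<in> borel_measurable gauss_space"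
  unfolding OU_path_def by measurable

lemma char_OU_path:
  assumes "c \<noteq> 0" "finite J" "\<And>i. i \<in> J \<Longrightarrow> \<tau> i \<in> {0..1}"
  shows "(\<integral>\<omega>. iexp (\<Sum>i\<in>J. u i * OU_path c (\<tau> i) \<omega>) \<partial>gauss_space)
    = complex_of_real (exp (- (\<Sum>i\<in>J. \<Sum>k\<in>J. u i * u k * OU_cov c (\<tau> i) (\<tau> k)) / 2))"
proof -
  have "(\<Sum>i\<in>J. \<Sum>k\<in>J. (u i * OU_scale c (\<tau> i)) * (u k * OU_scale c (\<tau> k))
        * bridge_cov (OU_clock c (\<tau> i)) (OU_clock c (\<tau> k)))
      = (\<Sum>i\<in>J. \<Sum>k\<in>J. u i * u k * OU_cov c (\<tau> i) (\<tau> k))"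
    using assms(3) by (intro sum.cong refl) (simp add: OU_cov_eq[OF assms(1), symmetric] mult_ac)
  then show ?thesis
    using char_bridge[OF assms(2), of "\<lambda>i. u i * OU_scale c (\<tau> i)" "\<lambda>i. OU_clock c (\<tau> i)"]
    by (simp add: OU_path_def mult.assoc)
qed


lemma OU_path_in_to_cadlag:
  assumes "c \<noteq> 0" "t \<in> {0..1}"
  shows "path_of (to_cadlag (\<lambda>s. OU_path c s \<omega>)) t = OU_path c t \<omega>"
  using assms by (intro path_to_cadlag is_cadlag_continuous_on continuous_on_OU_path)

lemma measurable_OU_cadlag:
  "c \<noteq> 0 \<Longrightarrow> (\<lambda>\<omega>. to_cadlag (\<lambda>t. OU_path c t \<omega>)) \<in> borel_measurable gauss_space"
  by (intro measurable_to_cadlag continuous_on_OU_path measurable_OU_path)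

section \<open>The law of the bridge on path space\<close>

definition OU_law :: "real \<Rightarrow> cadlag measure" where
  "OU_law c = distr gauss_space borel (\<lambda>\<omega>. to_cadlag (\<lambda>t. OU_path c t \<omega>))"

lemma prob_space_OU_law: "c \<noteq> 0 \<Longrightarrow> prob_space (OU_law c)"
  unfolding OU_law_def
  by (intro prob_space.prob_space_distr prob_space_gauss_space measurable_OU_cadlag)

lemma sets_OU_law [measurable_cong]: "sets (OU_law c) = sets borel"
  by (simp add: OU_law_def)

lemma measurable_path_OU_law: "t \<in> {0..1} \<Longrightarrow> (\<lambda>x. path_of x t) \<in> borel_measurable (OU_law c)"
  using measurable_path_of by (simp cong: measurable_cong_sets add: sets_OU_law)

lemma char_OU_law:
  assumes c: "c \<noteq> 0" and J: "finite J" "J \<subseteq> {0..1}"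
  shows "(\<integral>x. iexp (v * (\<Sum>t\<in>J. u t * path_of x t)) \<partial>OU_law c)
    = complex_of_real (exp (- v\<^sup>2 * (\<Sum>s\<in>J. \<Sum>t\<in>J. u s * u t * OU_cov c s t) / 2))"
proof -
  have [measurable]: "(\<lambda>x. path_of x t) \<in> borel_measurable borel" if "t \<in> J" for t
    using measurable_path_of that J by auto
  have "(\<integral>x. iexp (v * (\<Sum>t\<in>J. u t * path_of x t)) \<partial>OU_law c)
      = (\<integral>\<omega>. iexp (v * (\<Sum>t\<in>J. u t * path_of (to_cadlag (\<lambda>t. OU_path c t \<omega>)) t)) \<partial>gauss_space)"
    unfolding OU_law_def by (rule integral_distr[OF measurable_OU_cadlag[OF c]]) measurable
  also have "\<dots> = (\<integral>\<omega>. iexp (\<Sum>t\<in>J. (v * u t) * OU_path c t \<omega>) \<partial>gauss_space)"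
  proof (intro Bochner_Integration.integral_cong refl)
    fix \<omega>
    have "v * (\<Sum>t\<in>J. u t * path_of (to_cadlag (\<lambda>t. OU_path c t \<omega>)) t) = (\<Sum>t\<in>J. (v * u t) * OU_path c t \<omega>)"
      unfolding sum_distrib_left
      using J(2) by (intro sum.cong refl) (auto simp: OU_path_in_to_cadlag[OF c] subset_iff)
    then show "iexp (v * (\<Sum>t\<in>J. u t * path_of (to_cadlag (\<lambda>t. OU_path c t \<omega>)) t)) = iexp (\<Sum>t\<in>J. (v * u t) * OU_path c t \<omega>)"
      by simp
  qed
  also have "\<dots> = complex_of_real (exp (- (\<Sum>s\<in>J. \<Sum>t\<in>J. (v * u s) * (v * u t) * OU_cov c s t) / 2))"
    by (rule char_OU_path[OF c J(1), of "\<lambda>t. t" "\<lambda>t. v * u t"]) (use J(2) in auto)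
  also have "(\<Sum>s\<in>J. \<Sum>t\<in>J. (v * u s) * (v * u t) * OU_cov c s t) = v\<^sup>2 * (\<Sum>s\<in>J. \<Sum>t\<in>J. u s * u t * OU_cov c s t)"
    by (simp add: sum_distrib_left power2_eq_square mult_ac)
  finally show ?thesis by simp
qed

text \<open>The modulus of a characteristic function is at most 1, which forces its exponent to be
  nonpositive; this takes the place of an algebraic proof of positive definiteness.\<close>

lemma OU_variance_nonneg:
  assumes c: "c \<noteq> 0" and J: "finite J" "J \<subseteq> {0..1}"
  shows "0 \<le> (\<Sum>s\<in>J. \<Sum>t\<in>J. u s * u t * OU_cov c s t)"
proof -
  have "norm (\<integral>x. iexp (1 * (\<Sum>t\<in>J. u t * path_of x t)) \<partial>OU_law c) \<le> 1"
    by (rule norm_integral_iexp_le[OF prob_space_OU_law[OF c]])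
  then show ?thesis unfolding char_OU_law[OF c J] by simp
qed

lemma OU_bridge_law_OU_law:
  assumes c: "c \<noteq> 0"
  shows "OU_bridge_law c (OU_law c)"
proof -
  note P = prob_space_OU_law[OF c]
  have gauss: "gaussian_rv (OU_law c) X" "integrable (OU_law c) X" "(\<integral>x. X x \<partial>OU_law c) = 0"
      "integrable (OU_law c) (\<lambda>x. (X x)\<^sup>2)" "(\<integral>x. (X x)\<^sup>2 \<partial>OU_law c) = (\<Sum>s\<in>J. \<Sum>t\<in>J. u s * u t * OU_cov c s t)"
    if "finite J" "J \<subseteq> {0..1}" "X = (\<lambda>x. \<Sum>t\<in>J. u t * path_of x t)" for J u X
  proof -
    have "X \<in> borel_measurable (OU_law c)"
      unfolding that(3) using that(2) measurable_path_OU_law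
      by (intro borel_measurable_sum borel_measurable_times) auto
    moreover have "(\<integral>x. iexp (v * X x) \<partial>OU_law c)
        = complex_of_real (exp (- v\<^sup>2 * (\<Sum>s\<in>J. \<Sum>t\<in>J. u s * u t * OU_cov c s t) / 2))" for v
      unfolding that(3) by (rule char_OU_law[OF c that(1,2)])
    ultimately show "gaussian_rv (OU_law c) X" "integrable (OU_law c) X" "(\<integral>x. X x \<partial>OU_law c) = 0"
      "integrable (OU_law c) (\<lambda>x. (X x)\<^sup>2)" "(\<integral>x. (X x)\<^sup>2 \<partial>OU_law c) = (\<Sum>s\<in>J. \<Sum>t\<in>J. u s * u t * OU_cov c s t)"
      using gaussian_from_char[OF P _ OU_variance_nonneg[OF c that(1,2), of u]] by blast+
  qed
  have one: "integrable (OU_law c) (\<lambda>x. (path_of x t)\<^sup>2)" "(\<integral>x. path_of x t \<partial>OU_law c) = 0"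
      "(\<integral>x. (path_of x t)\<^sup>2 \<partial>OU_law c) = OU_cov c t t"
    if "t \<in> {0..1}" for t
    using gauss(3,4,5)[of "{t}" "\<lambda>x. path_of x t" "\<lambda>_. 1"] that by auto
  have sym: "OU_cov c s t = OU_cov c t s" for s t
    by (simp add: OU_cov_def min.commute max.commute)
  have two: "(\<integral>x. path_of x s * path_of x t \<partial>OU_law c) = OU_cov c s t"
    if s: "s \<in> {0..1}" and t: "t \<in> {0..1}" for s t
  \<comment> \<open>For \<open>s = t\<close> the index set \<open>{s, t}\<close> would collapse and
    count the time once, so polarisation is applied only to distinct times.\<close>
  proof (cases "s = t")
    case True
    then show ?thesis using one(3)[OF s] by (simp add: power2_eq_square)
  next
    case False
    note g = gauss(4,5)[of "{s, t}" "\<lambda>x. path_of x s + path_of x t" "\<lambda>_. 1"]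
    have int: "integrable (OU_law c) (\<lambda>x. (path_of x s + path_of x t)\<^sup>2)"
      and val: "(\<integral>x. (path_of x s + path_of x t)\<^sup>2 \<partial>OU_law c) = OU_cov c s s + 2 * OU_cov c s t + OU_cov c t t"
      using g False s t sym[of t s] by auto
    have "(\<integral>x. path_of x s * path_of x t \<partial>OU_law c)
        = (\<integral>x. ((path_of x s + path_of x t)\<^sup>2 - (path_of x s)\<^sup>2 - (path_of x t)\<^sup>2) / 2 \<partial>OU_law c)"
      by (intro Bochner_Integration.integral_cong refl) (simp add: power2_eq_square algebra_simps)
    also have "\<dots> = OU_cov c s t"
      using int one[OF s] one[OF t] val by simp
    finally show ?thesis .
  qed
  show ?thesis
    unfolding OU_bridge_law_def gaussian_process_def
  proof (intro conjI allI impI ballI)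
    show "gaussian_rv (OU_law c) (\<lambda>\<omega>. \<Sum>t\<in>J. u t * path_of \<omega> t)" if "finite J \<and> J \<subseteq> {0..1}" for J u
      using gauss(1)[of J _ u] that by blast
    show "(\<integral>x. path_of x s * path_of x t \<partial>OU_law c) = sinh (c * s) * sinh (c * (1 - t)) / (c * sinh c)"
      if "0 \<le> s \<and> s \<le> t \<and> t \<le> 1" for s t
      using two[of s t] that by (simp add: OU_cov_def min_def max_def)
  qed (use P one(2) in \<open>auto simp: sets_OU_law\<close>)
qed

section \<open>The limit profile\<close>

text \<open>The fugacity is the solution \<open>z\<close> of \<open>occ_integral 1 - occ_integral 0 = \<rho>\<close>, where \<open>occ\<close> is the
  limiting probability of a down-step.\<close>

definition fugacity :: "real \<Rightarrow> real \<Rightarrow> real" where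
  "fugacity \<rho> c = (exp (2 * c * \<rho>) - 1) / (1 - exp (- 2 * c * (1 - \<rho>)))"

definition occ :: "real \<Rightarrow> real \<Rightarrow> real \<Rightarrow> real" where
  "occ \<rho> c t = fugacity \<rho> c * exp (- 2 * c * t) / (1 + fugacity \<rho> c * exp (- 2 * c * t))"

definition occ_integral :: "real \<Rightarrow> real \<Rightarrow> real \<Rightarrow> real" where
  "occ_integral \<rho> c t = - ln (1 + fugacity \<rho> c * exp (- 2 * c * t)) / (2 * c)"

text \<open>The limiting variance of the unconditioned walk up to time \<open>t\<close>, after
  division by \<open>n\<close>. It has this closed form because \<open>occ\<close> solves the
  logistic equation with derivative \<open>- 2 * c * (occ * (1 - occ))\<close>.\<close>

definition clock :: "real \<Rightarrow> real \<Rightarrow> real \<Rightarrow> real" where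
  "clock \<rho> c t = (occ \<rho> c 0 - occ \<rho> c t) / c"

text \<open>Each of at most \<open>N\<close> cells contributes an error of at most
  \<open>M / N\<close>, so the total stays bounded as \<open>N\<close> grows and disappears on the
  scale \<open>sqrt N\<close>.\<close>

lemma Riemann_sum_error:
  fixes g G :: "real \<Rightarrow> real"
  assumes G: "\<And>t. (G has_real_derivative g t) (at t)"
    and lip: "\<And>s t. \<bar>g s - g t\<bar> \<le> M * \<bar>s - t\<bar>" and N: "N > 0" and k: "k \<le> N"
  shows "\<bar>(\<Sum>j<k. g (real j / real N)) - real N * (G (real k / real N) - G 0)\<bar> \<le> M"
proof -
  have M: "0 \<le> M" using lip[of 0 1] by simp
  have step: "\<bar>g (real j / real N) - real N * (G (real (Suc j) / real N) - G (real j / real N))\<bar> \<le> M / real N" for j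
  proof -
    obtain x where x: "real j / real N < x" "x < real (Suc j) / real N"
      "G (real (Suc j) / real N) - G (real j / real N) = (real (Suc j) / real N - real j / real N) * g x"
      using MVT2[of "real j / real N" "real (Suc j) / real N" G g] G N by (auto simp: divide_strict_right_mono)
    have gap: "real (Suc j) / real N - real j / real N = 1 / real N" by (simp add: diff_divide_distrib[symmetric])
    have "real N * (G (real (Suc j) / real N) - G (real j / real N)) = g x"
      unfolding x(3) gap using N by simp
    then have "\<bar>g (real j / real N) - real N * (G (real (Suc j) / real N) - G (real j / real N))\<bar> \<le> M * \<bar>real j / real N - x\<bar>"
      using lip by simp
    also have "\<dots> \<le> M * (1 / real N)" using x gap M by (intro mult_left_mono) auto
    finally show ?thesis by simp
  qed
  have tele: "real N * (G (real k / real N) - G 0) = (\<Sum>j<k. real N * (G (real (Suc j) / real N) - G (real j / real N)))"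
    unfolding sum_distrib_left[symmetric] by (subst sum_lessThan_telescope) simp
  have "\<bar>(\<Sum>j<k. g (real j / real N)) - real N * (G (real k / real N) - G 0)\<bar>
      \<le> (\<Sum>j<k. \<bar>g (real j / real N) - real N * (G (real (Suc j) / real N) - G (real j / real N))\<bar>)"
    unfolding tele sum_subtractf[symmetric] by (rule sum_abs)
  also have "\<dots> \<le> (\<Sum>j<k. M / real N)" by (intro sum_mono step)
  also have "\<dots> = real k / real N * M" by simp
  also have "\<dots> \<le> 1 * M" using N k M by (intro mult_right_mono) auto
  finally show ?thesis by simp
qed

lemma lipschitz_from_deriv:
  fixes g g' :: "real \<Rightarrow> real"
  assumes "\<And>t. (g has_real_derivative g' t) (at t)" "\<And>t. \<bar>g' t\<bar> \<le> M"
  shows "\<bar>g s - g t\<bar> \<le> M * \<bar>s - t\<bar>"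
  using field_differentiable_bound[of UNIV g g' M t s] assms by (simp add: abs_minus_commute)

lemma abs_scaled_le:
  fixes k v :: real
  shows "0 \<le> v \<Longrightarrow> v \<le> 1 \<Longrightarrow> \<bar>k * v\<bar> \<le> \<bar>k\<bar>"
  by (simp add: abs_mult mult_left_le)

lemma scaled_ratio:
  fixes x h0 hs ht h1 :: real
  assumes "x \<noteq> 0" "h0 \<noteq> 0" "h1 \<noteq> 0" "c \<noteq> 0" "S \<noteq> 0"
  shows "(x * u / (h0 * hs) / c) * (x * v / (ht * h1) / c) / (x * S / (h0 * h1) / c) = x / (hs * ht) * (u * v / (c * S))"
  using assms by (simp add: field_simps)

lemma half_product:
  fixes R x y :: real
  shows "(1 / sqrt 2 * (R / x)) * (1 / sqrt 2 * (R / y)) = 1 / 2 * ((R * R) / (x * y))"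
proof -
  have "(1 / sqrt 2 * (R / x)) * (1 / sqrt 2 * (R / y)) = (1 / sqrt 2 * (1 / sqrt 2)) * ((R * R) / (x * y))"
    by (simp add: mult_ac)
  also have "1 / sqrt 2 * (1 / sqrt 2) = 1 / (2::real)" by simp
  finally show ?thesis .
qed

locale box_profile =
  fixes \<rho> c :: real
  assumes \<rho>: "0 < \<rho>" "\<rho> < 1" and c: "c \<noteq> 0"
begin

abbreviation "z \<equiv> fugacity \<rho> c"

lemma fugacity_pos: "z > 0"
proof (cases "c > 0")
  case True
  then have "exp (2 * c * \<rho>) > 1" "exp (- 2 * c * (1 - \<rho>)) < 1" using \<rho> by auto
  then show ?thesis by (simp add: fugacity_def)
next
  case False
  then have "c < 0" using c by simp
  then have "exp (2 * c * \<rho>) < 1" "exp (- 2 * c * (1 - \<rho>)) > 1" using \<rho> by (auto simp: mult_neg_pos)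
  then show ?thesis by (simp add: fugacity_def divide_neg_neg)
qed

lemma denom_pos: "1 + z * exp x > 0"
  using fugacity_pos by (simp add: add_pos_pos)

lemma occ_bounds: "0 < occ \<rho> c t" "occ \<rho> c t < 1"
  using denom_pos[of "- 2 * c * t"] fugacity_pos by (auto simp: occ_def divide_less_eq)

lemma occ_deriv: "(occ \<rho> c has_real_derivative (- 2 * c * (occ \<rho> c t * (1 - occ \<rho> c t)))) (at t)"
proof -
  define y where "y = z * exp (- 2 * c * t)"
  have y: "1 + y > 0" using denom_pos[of "- 2 * c * t"] by (simp add: y_def)
  have "((\<lambda>t. z * exp (- 2 * c * t) / (1 + z * exp (- 2 * c * t))) has_real_derivative
      ((- 2 * c * y) * (1 + y) - y * (- 2 * c * y)) / ((1 + y) * (1 + y))) (at t)"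
    using denom_pos[of "- 2 * c * t"] unfolding y_def
    by (auto intro!: derivative_eq_intros simp: algebra_simps)
  moreover have "((- 2 * c * y) * (1 + y) - y * (- 2 * c * y)) / ((1 + y) * (1 + y)) = - 2 * c * (y / (1 + y) * (1 - y / (1 + y)))"
    using y by (simp add: field_simps)
  ultimately show ?thesis unfolding occ_def[abs_def] y_def by simp
qed

lemma occ_integral_deriv: "(occ_integral \<rho> c has_real_derivative occ \<rho> c t) (at t)"
proof -
  define y where "y = z * exp (- 2 * c * t)"
  have y: "1 + y > 0" using denom_pos[of "- 2 * c * t"] by (simp add: y_def)
  have "((\<lambda>t. z * exp (- 2 * c * t)) has_real_derivative - 2 * c * y) (at t)"
    unfolding y_def by (auto intro!: derivative_eq_intros simp: mult_ac)
  then have "((\<lambda>t. 1 + z * exp (- 2 * c * t)) has_real_derivative 0 + - 2 * c * y) (at t)"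
    by (intro DERIV_add DERIV_const)
  then have "((\<lambda>t. ln (1 + z * exp (- 2 * c * t))) has_real_derivative 1 / (1 + y) * (0 + - 2 * c * y)) (at t)"
    unfolding y_def by (rule DERIV_chain2[rotated]) (rule DERIV_ln_divide[OF denom_pos])
  then have "((\<lambda>t. - ln (1 + z * exp (- 2 * c * t)) / (2 * c)) has_real_derivative - (1 / (1 + y) * (0 + - 2 * c * y)) / (2 * c)) (at t)"
    by (intro DERIV_cdivide DERIV_minus)
  moreover have "- (1 / (1 + y) * (0 + - 2 * c * y)) / (2 * c) = y / (1 + y)" using c by simp
  ultimately show ?thesis unfolding occ_integral_def[abs_def] occ_def y_def by simp
qed

lemma clock_deriv: "(clock \<rho> c has_real_derivative (2 * (occ \<rho> c t * (1 - occ \<rho> c t)))) (at t)"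
  unfolding clock_def[abs_def] using c by (auto intro!: derivative_eq_intros occ_deriv)

lemma var_bounds: "0 \<le> occ \<rho> c t * (1 - occ \<rho> c t)" "occ \<rho> c t * (1 - occ \<rho> c t) \<le> 1"
  using occ_bounds[of t] by (auto simp: mult_le_one)

lemma occ_lipschitz: "\<bar>occ \<rho> c s - occ \<rho> c t\<bar> \<le> 2 * \<bar>c\<bar> * \<bar>s - t\<bar>"
  by (rule lipschitz_from_deriv[OF occ_deriv])
     (use abs_scaled_le[OF var_bounds, of "- 2 * c"] in \<open>simp only: abs_mult abs_minus_cancel abs_numeral\<close>)

lemma var_lipschitz: "\<bar>2 * (occ \<rho> c s * (1 - occ \<rho> c s)) - 2 * (occ \<rho> c t * (1 - occ \<rho> c t))\<bar> \<le> 4 * \<bar>c\<bar> * \<bar>s - t\<bar>"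
proof (rule lipschitz_from_deriv)
  show "((\<lambda>t. 2 * (occ \<rho> c t * (1 - occ \<rho> c t))) has_real_derivative
      (- 4 * c * ((occ \<rho> c t * (1 - occ \<rho> c t)) * (1 - 2 * occ \<rho> c t)))) (at t)" for t
    by (auto intro!: derivative_eq_intros occ_deriv simp: algebra_simps)
  show "\<bar>- 4 * c * ((occ \<rho> c t * (1 - occ \<rho> c t)) * (1 - 2 * occ \<rho> c t))\<bar> \<le> 4 * \<bar>c\<bar>" for t
  proof -
    have "\<bar>(1 - 2 * occ \<rho> c t) * (occ \<rho> c t * (1 - occ \<rho> c t))\<bar> \<le> \<bar>1 - 2 * occ \<rho> c t\<bar>"
      by (rule abs_scaled_le[OF var_bounds])
    also have "\<dots> \<le> 1" using occ_bounds[of t] by auto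
    finally have "\<bar>(occ \<rho> c t * (1 - occ \<rho> c t)) * (1 - 2 * occ \<rho> c t)\<bar> \<le> 1" by (simp only: mult.commute)
    then have "\<bar>4 * c\<bar> * \<bar>(occ \<rho> c t * (1 - occ \<rho> c t)) * (1 - 2 * occ \<rho> c t)\<bar> \<le> \<bar>4 * c\<bar> * 1"
      by (intro mult_left_mono) auto
    then show ?thesis by (simp add: abs_mult)
  qed
qed

lemma clock_lipschitz: "\<bar>clock \<rho> c s - clock \<rho> c t\<bar> \<le> 2 * \<bar>s - t\<bar>"
  by (rule lipschitz_from_deriv[OF clock_deriv])
     (use abs_scaled_le[OF var_bounds, of 2] in \<open>simp only: abs_numeral\<close>)

lemma occ_integral_lipschitz: "\<bar>occ_integral \<rho> c s - occ_integral \<rho> c t\<bar> \<le> 1 * \<bar>s - t\<bar>"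
  by (rule lipschitz_from_deriv[OF occ_integral_deriv]) (use occ_bounds in \<open>simp add: less_imp_le\<close>)

lemma var_lower_bound: "\<exists>v>0. \<forall>t\<in>{0..1}. v \<le> occ \<rho> c t * (1 - occ \<rho> c t)"
proof -
  have "continuous_on {0..1} (occ \<rho> c)"
    by (auto intro!: continuous_at_imp_continuous_on DERIV_isCont[OF occ_deriv])
  then have "continuous_on {0..1} (\<lambda>t. occ \<rho> c t * (1 - occ \<rho> c t))" by (intro continuous_intros)
  then have "\<exists>t0\<in>{0..1}. \<forall>t\<in>{0..1}. occ \<rho> c t0 * (1 - occ \<rho> c t0) \<le> occ \<rho> c t * (1 - occ \<rho> c t)"
    by (intro continuous_attains_inf) auto
  then obtain t0 where "\<forall>t\<in>{0..1}. occ \<rho> c t0 * (1 - occ \<rho> c t0) \<le> occ \<rho> c t * (1 - occ \<rho> c t)" by blast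
  then show ?thesis using occ_bounds[of t0] by (intro exI[of _ "occ \<rho> c t0 * (1 - occ \<rho> c t0)"]) auto
qed

lemma clock_strict: "s < t \<Longrightarrow> clock \<rho> c s < clock \<rho> c t"
proof (erule DERIV_pos_imp_increasing)
  fix x
  have "2 * (occ \<rho> c x * (1 - occ \<rho> c x)) > 0" using occ_bounds[of x] by simp
  then show "\<exists>y. (clock \<rho> c has_real_derivative y) (at x) \<and> 0 < y" using clock_deriv by blast
qed

text \<open>The denominator of the fugacity. It is negative for \<open>c < 0\<close>, hence
  \<open>scale_product\<close> works with its square.\<close>

definition "\<kappa> = 1 - exp (- 2 * c * (1 - \<rho>))"

lemma kappa: "\<kappa> \<noteq> 0" "\<kappa> * z = exp (2 * c * \<rho>) - 1"
  using \<rho> c by (auto simp: \<kappa>_def fugacity_def)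

text \<open>Connects the denominator common to the limit shape and the scale with the step
  probabilities: \<open>occ\<close> equals \<open>z * exp (- c * s)\<close> divided by
  \<open>exp (c * s) + z * exp (- c * s)\<close>.\<close>

lemma shape_denominator_eq:
  "sinh (c * s) + exp (c * (2 * \<rho> - 1)) * sinh (c * (1 - s)) = \<kappa> / 2 * (exp (c * s) + z * exp (- c * s))"
proof -
  have e: "exp (c * (2 * \<rho> - 1)) * exp (c * (1 - s)) = exp (2 * c * \<rho>) * exp (- c * s)"
    "exp (c * (2 * \<rho> - 1)) * exp (- (c * (1 - s))) = exp (- 2 * c * (1 - \<rho>)) * exp (c * s)"
    by (simp_all add: exp_add[symmetric] algebra_simps)
  have "\<kappa> / 2 * (exp (c * s) + z * exp (- c * s)) = (\<kappa> * exp (c * s) + (\<kappa> * z) * exp (- c * s)) / 2"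
    by (simp add: algebra_simps)
  also have "\<dots> = (exp (c * s) - exp (- c * s) + (exp (2 * c * \<rho>) * exp (- c * s) - exp (- 2 * c * (1 - \<rho>)) * exp (c * s))) / 2"
    unfolding kappa(2) unfolding \<kappa>_def by (simp add: left_diff_distrib)
  also have "\<dots> = sinh (c * s) + exp (c * (2 * \<rho> - 1)) * sinh (c * (1 - s))"
    unfolding e[symmetric] sinh_field_def by (simp add: right_diff_distrib add_divide_distrib diff_divide_distrib)
  finally show ?thesis by simp
qed

text \<open>The mean slope of the path is \<open>1 - 2 * occ\<close>, so the right-hand side is the
  limiting mean of the path.\<close>

lemma limit_shape_eq: "limit_shape \<rho> c t = t - 2 * (occ_integral \<rho> c t - occ_integral \<rho> c 0)"
proof -
  have s: "sinh c \<noteq> 0" using c by simp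
  have at0: "exp (c * (2 * \<rho> - 1)) * sinh c = \<kappa> / 2 * (1 + z)"
    using shape_denominator_eq[of 0] by simp
  have k: "\<kappa> / 2 = exp (c * (2 * \<rho> - 1)) * sinh c / (1 + z)"
    using at0 denom_pos[of 0] by (simp add: field_simps)
  have "(sinh (c * t) + exp (c * (2 * \<rho> - 1)) * sinh (c * (1 - t))) / sinh c
      = exp (c * (2 * \<rho> - 1)) / (1 + z) * (exp (c * t) + z * exp (- c * t))"
    unfolding shape_denominator_eq k using s by simp
  also have "exp (c * t) + z * exp (- c * t) = exp (c * t) * (1 + z * exp (- 2 * c * t))"
  proof -
    have "exp (c * t) * exp (- 2 * c * t) = exp (- c * t)" by (simp add: exp_add[symmetric])
    then show ?thesis by (simp add: algebra_simps)
  qed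
  finally have lneq: "ln ((sinh (c * t) + exp (c * (2 * \<rho> - 1)) * sinh (c * (1 - t))) / sinh c)
      = c * (2 * \<rho> - 1) - ln (1 + z) + c * t + ln (1 + z * exp (- 2 * c * t))"
    using denom_pos[of 0] denom_pos[of "- 2 * c * t"] by (simp add: ln_mult ln_div)
  show ?thesis
    unfolding limit_shape_def occ_integral_def lneq using c by (simp add: field_simps)
qed

text \<open>The limit shape ends at \<open>1 - 2 * \<rho>\<close>, which shows that
  \<open>fugacity\<close> gives the prescribed density of down-steps.\<close>

lemma occ_integral_total: "occ_integral \<rho> c 1 - occ_integral \<rho> c 0 = \<rho>"
proof -
  have "limit_shape \<rho> c 1 = 1 - 2 * \<rho>" using c by (simp add: limit_shape_def)
  then show ?thesis using limit_shape_eq[of 1] by simp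
qed

text \<open>For \<open>s = t\<close> the value is \<open>2 * occ * (1 - occ)\<close>, the derivative
  of \<open>clock\<close>.\<close>

lemma scale_product:
  "fluctuation_scale \<rho> c s * fluctuation_scale \<rho> c t
    = 2 * z / ((exp (c * s) + z * exp (- c * s)) * (exp (c * t) + z * exp (- c * t)))"
proof -
  have "(exp (2 * c * \<rho>) - 1) * (1 - exp (- 2 * c * (1 - \<rho>))) = \<kappa>\<^sup>2 * z"
    using kappa(2) by (simp add: \<kappa>_def power2_eq_square mult.assoc)
  then have root: "sqrt ((exp (2 * c * \<rho>) - 1) * (1 - exp (- 2 * c * (1 - \<rho>)))) * sqrt ((exp (2 * c * \<rho>) - 1) * (1 - exp (- 2 * c * (1 - \<rho>)))) = \<kappa>\<^sup>2 * z"
    using fugacity_pos by simp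
  have "fluctuation_scale \<rho> c s * fluctuation_scale \<rho> c t = 1 / 2 * ((\<kappa>\<^sup>2 * z)
      / ((\<kappa> / 2 * (exp (c * s) + z * exp (- c * s))) * (\<kappa> / 2 * (exp (c * t) + z * exp (- c * t)))))"
    unfolding fluctuation_scale_def shape_denominator_eq root[symmetric] by (rule half_product)
  also have "\<dots> = 2 * z / ((exp (c * s) + z * exp (- c * s)) * (exp (c * t) + z * exp (- c * t)))"
    using kappa(1) by (simp add: power2_eq_square)
  finally show ?thesis .
qed

text \<open>The left-hand side is the covariance of a Brownian motion run with \<open>clock\<close>
  and conditioned to vanish at time 1. It takes the hyperbolic form because differences of
  \<open>occ\<close> factorise with \<open>sinh (c * (y - x))\<close> in the numerator.\<close>

lemma clock_bridge_eq:
  assumes "s \<in> {0..1}" "t \<in> {0..1}"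
  shows "clock \<rho> c (min s t) - clock \<rho> c s * clock \<rho> c t / clock \<rho> c 1
    = fluctuation_scale \<rho> c s * fluctuation_scale \<rho> c t * OU_cov c s t"
proof -
  have s: "sinh c \<noteq> 0" using c by simp
  have pos: "exp x + z * exp y > 0" for x y using fugacity_pos by (simp add: add_pos_pos)
  define H where "H = (\<lambda>t. exp (c * t) + z * exp (- c * t))"
  have H: "H t > 0" for t by (simp add: H_def pos)
  have occH: "occ \<rho> c t = z * exp (- c * t) / H t" for t
  proof -
    have "H t = exp (c * t) * (1 + z * exp (- 2 * c * t))"
    proof -
      have "exp (c * t) * exp (- 2 * c * t) = exp (- c * t)" by (simp add: exp_add[symmetric])
      then show ?thesis by (simp add: H_def algebra_simps)
    qed
    moreover have "exp (- c * t) = exp (c * t) * exp (- 2 * c * t)" by (simp add: exp_add[symmetric])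
    ultimately show ?thesis by (simp add: occ_def)
  qed
  have diff: "occ \<rho> c x - occ \<rho> c y = 2 * z * sinh (c * (y - x)) / (H x * H y)" for x y
  proof -
    have e: "exp (- (c * x)) * exp (c * y) = exp (c * (y - x))" "exp (- (c * y)) * exp (c * x) = exp (- (c * (y - x)))"
      by (simp_all add: exp_add[symmetric] algebra_simps)
    have "occ \<rho> c x - occ \<rho> c y = z * (exp (- (c * x)) * H y - exp (- (c * y)) * H x) / (H x * H y)"
      unfolding occH using H[of x] H[of y] by (simp add: field_simps)
    also have "exp (- (c * x)) * H y - exp (- (c * y)) * H x = exp (- (c * x)) * exp (c * y) - exp (- (c * y)) * exp (c * x)"
      by (simp add: H_def algebra_simps)
    finally show ?thesis unfolding e by (simp add: sinh_field_def)
  qed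
  have *: "clock \<rho> c s - clock \<rho> c s * clock \<rho> c t / clock \<rho> c 1
      = fluctuation_scale \<rho> c s * fluctuation_scale \<rho> c t * (sinh (c * s) * sinh (c * (1 - t)) / (c * sinh c))" for s t
  proof -
    have c1: "clock \<rho> c 1 = 2 * z * sinh c / (H 0 * H 1) / c" unfolding clock_def diff by simp
    have c1n: "clock \<rho> c 1 \<noteq> 0" unfolding c1 using s c fugacity_pos H[of 0] H[of 1] by simp
    have ct: "clock \<rho> c 1 - clock \<rho> c t = 2 * z * sinh (c * (1 - t)) / (H t * H 1) / c"
      unfolding diff[symmetric] clock_def by (simp add: diff_divide_distrib)
    have "clock \<rho> c s - clock \<rho> c s * clock \<rho> c t / clock \<rho> c 1 = clock \<rho> c s * (clock \<rho> c 1 - clock \<rho> c t) / clock \<rho> c 1"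
      using c1n by (simp add: field_simps)
    also have "\<dots> = (2 * z * sinh (c * s) / (H 0 * H s) / c) * (2 * z * sinh (c * (1 - t)) / (H t * H 1) / c) / (2 * z * sinh c / (H 0 * H 1) / c)"
      unfolding ct unfolding c1 unfolding clock_def diff by simp
    also have "\<dots> = 2 * z / (H s * H t) * (sinh (c * s) * sinh (c * (1 - t)) / (c * sinh c))"
      by (rule scaled_ratio) (use s c fugacity_pos H[of 0] H[of 1] in auto)
    finally show ?thesis unfolding scale_product H_def by simp
  qed
  show ?thesis
  proof (cases "s \<le> t")
    case True
    then show ?thesis using *[of s t] by (simp add: OU_cov_def min_def max_def)
  next
    case False
    then show ?thesis using *[of t s] by (simp add: OU_cov_def min_def max_def mult_ac)
  qed
qed

end

section \<open>Convergence of the boundary path\<close>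

definition grid_index :: "nat \<Rightarrow> real \<Rightarrow> nat" where
  "grid_index n t = nat \<lfloor>2 * real n * t\<rfloor>"

lemma grid_index_bounds:
  assumes "t \<in> {0..1}"
  shows "real (grid_index n t) \<le> 2 * real n * t" "2 * real n * t < real (grid_index n t) + 1" "grid_index n t \<le> 2 * n"
proof -
  have nn: "0 \<le> 2 * real n * t" using assms by simp
  then have r: "real (grid_index n t) = of_int \<lfloor>2 * real n * t\<rfloor>" unfolding grid_index_def by simp
  show 1: "real (grid_index n t) \<le> 2 * real n * t" unfolding r by linarith
  show "2 * real n * t < real (grid_index n t) + 1" unfolding r by linarith
  have "2 * real n * t \<le> 2 * real n * 1" using assms by (intro mult_left_mono) auto
  then have "real (grid_index n t) \<le> real (2 * n)" using 1 by simp
  then show "grid_index n t \<le> 2 * n" by (simp only: of_nat_le_iff)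
qed

lemma grid_index_mono: "s \<le> t \<Longrightarrow> grid_index n s \<le> grid_index n t"
  unfolding grid_index_def by (intro nat_mono floor_mono mult_left_mono) auto

lemma boundary_path_eq_card:
  "boundary_path \<pi> k = int k - 2 * int (card (down_steps \<pi> \<inter> {..<k}))"
proof -
  have "boundary_path \<pi> k = (\<Sum>j<k. 1 - 2 * (if j \<in> down_steps \<pi> then 1 else 0))"
    unfolding boundary_path_def by (intro sum.cong) auto
  also have "\<dots> = int k - 2 * (\<Sum>j<k. if j \<in> down_steps \<pi> then 1 else 0)"
    by (simp add: sum_subtractf sum_distrib_left)
  also have "(\<Sum>j<k. if j \<in> down_steps \<pi> then 1 else (0::int)) = int (card (down_steps \<pi> \<inter> {..<k}))"
    by (simp add: sum.If_cases Int_commute)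
  finally show ?thesis .
qed

lemma linear_interpolation_near:
  assumes "t \<in> {0..1}"
  shows "\<bar>linear_interpolation (boundary_path \<pi>) (2 * real n * t) - real_of_int (boundary_path \<pi> (grid_index n t))\<bar> \<le> 1"
proof -
  define k where "k = grid_index n t"
  have "\<bar>boundary_path \<pi> (k + 1) - boundary_path \<pi> k\<bar> \<le> 1" by (simp add: boundary_path_def)
  then have "\<bar>real_of_int (boundary_path \<pi> (k + 1) - boundary_path \<pi> k)\<bar> \<le> 1" by linarith
  moreover have "\<bar>2 * real n * t - real k\<bar> \<le> 1" using grid_index_bounds[OF assms, of n] by (simp add: k_def)
  ultimately have "\<bar>(2 * real n * t - real k) * real_of_int (boundary_path \<pi> (k + 1) - boundary_path \<pi> k)\<bar> \<le> 1"
    unfolding abs_mult by (intro mult_le_one) auto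
  then show ?thesis by (simp add: linear_interpolation_def Let_def k_def grid_index_def)
qed

lemma sum_lessThan_of_bool:
  fixes g :: "nat \<Rightarrow> real"
  assumes "k \<le> m"
  shows "(\<Sum>j<m. g j * of_bool (j < k)) = (\<Sum>j<k. g j)"
  by (rule sum.mono_neutral_cong_right) (use assms in auto)

lemma norm_iexp_diff_le: "norm (iexp x - iexp y) \<le> \<bar>x - y\<bar>"
proof -
  have "iexp x - iexp y = iexp y * (iexp (x - y) - 1)"
    using iexp_add[of y "x - y"] by (simp add: right_diff_distrib)
  then have "norm (iexp x - iexp y) = norm (iexp (x - y) - 1)" by (simp only: norm_mult norm_exp_i_times mult_1)
  also have "\<dots> \<le> \<bar>x - y\<bar>" using iexp_approx1[of "x - y" 0] by simp
  finally show ?thesis .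
qed

lemma inverse_sqrt_tendsto: "(\<lambda>n. C / sqrt (real n)) \<longlonglongrightarrow> 0"
  by real_asymp

locale box_sequence = box_profile +
  fixes a b :: "nat \<Rightarrow> nat"
  assumes ab: "\<And>n. n \<ge> 1 \<Longrightarrow> a n + b n = 2 * n"
    and drift: "(\<lambda>n. (real (a n) - 2 * real n * \<rho>) / sqrt (real n)) \<longlonglongrightarrow> 0"
begin

definition p :: "nat \<Rightarrow> nat \<Rightarrow> real" where
  "p n j = occ \<rho> c (real j / real (2 * n))"

definition law :: "nat \<Rightarrow> nat list measure" where
  "law n = q_volume (exp (- c / real n)) (a n) (b n)"

text \<open>The probability of the conditioning event under independent steps.\<close>

definition mass :: "nat \<Rightarrow> real" where
  "mass n = (\<Sum>S | S \<subseteq> {..<2 * n} \<and> card S = a n. bern (p n) {..<2 * n} S)"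

text \<open>The path at \<open>k\<close> is \<open>k\<close> minus twice the number of down-steps,
  and the fluctuation divides by \<open>2 * sqrt n\<close>; this explains the sign and the missing
  factor 2.\<close>

definition walk :: "nat \<Rightarrow> nat set \<Rightarrow> nat \<Rightarrow> real" where
  "walk n S k = - (real (card (S \<inter> {..<k})) - (\<Sum>j<k. p n j)) / sqrt (real n)"

lemma p_bounds: "p n j \<in> {0..1}"
  using occ_bounds[of "real j / real (2 * n)"] by (simp add: p_def)

lemma prob_space_law: "prob_space (law n)"
  unfolding law_def by (rule prob_space_q_volume) simp

lemma measurable_law: "f \<in> borel_measurable (law n)" for f :: "nat list \<Rightarrow> 'b :: topological_space"
  unfolding law_def by (rule measurable_q_volume)

lemma integral_law:
  fixes g :: "nat set \<Rightarrow> 'b :: {banach, second_countable_topology}"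
  assumes n: "n \<ge> 1"
  shows "(\<integral>\<pi>. g (down_steps \<pi>) \<partial>law n)
    = (\<Sum>S | S \<subseteq> {..<2 * n} \<and> card S = a n. bern (p n) {..<2 * n} S *\<^sub>R g S) /\<^sub>R mass n"
proof -
  have "p n j = z * exp (- c / real n) ^ j / (1 + z * exp (- c / real n) ^ j)" for j
  proof -
    have "exp (- c / real n) ^ j = exp (- 2 * c * (real j / real (2 * n)))"
      using n by (simp add: exp_of_nat_mult[symmetric] mult.commute)
    then show ?thesis by (simp add: p_def occ_def)
  qed
  from integral_q_volume[OF exp_gt_zero fugacity_pos this, where g = g and a = "a n" and b = "b n"] show ?thesis
    by (simp add: law_def mass_def ab[OF n])
qed

lemma sum_p_error:
  assumes "n \<ge> 1" "k \<le> 2 * n"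
  shows "\<bar>(\<Sum>j<k. p n j) - 2 * real n * (occ_integral \<rho> c (real k / real (2 * n)) - occ_integral \<rho> c 0)\<bar> \<le> 2 * \<bar>c\<bar>"
  using Riemann_sum_error[OF occ_integral_deriv occ_lipschitz, of "2 * n" k] assms by (simp add: p_def)

text \<open>Four bounded errors: interpolation between integers, rounding of the time, the Riemann
  sum for the mean, and rounding inside the integral. The last two count twice, which gives
  \<open>4 + 4 * \<bar>c\<bar>\<close> before division by \<open>2 * sqrt n\<close>.\<close>

lemma fluctuation_near_walk:
  assumes n: "n \<ge> 1" and t: "t \<in> {0..1}"
  shows "\<bar>fluctuation \<rho> c n (boundary_path \<pi>) t - walk n (down_steps \<pi>) (grid_index n t)\<bar>
    \<le> (2 + 2 * \<bar>c\<bar>) / sqrt (real n)"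
proof -
  define k where "k = grid_index n t"
  note kb = grid_index_bounds[OF t, of n, folded k_def]
  define I where "I = linear_interpolation (boundary_path \<pi>) (2 * real n * t)"
  define N where "N = real (card (down_steps \<pi> \<inter> {..<k}))"
  define P where "P = (\<Sum>j<k. p n j)"
  define G where "G = (\<lambda>t. occ_integral \<rho> c t - occ_integral \<rho> c 0)"
  define r where "r = sqrt (real n)"
  have r: "r > 0" "r * r = real n" using n by (auto simp: r_def)
  have 1: "\<bar>I - (real k - 2 * N)\<bar> \<le> 1"
    using linear_interpolation_near[OF t, of \<pi> n] by (simp add: I_def N_def boundary_path_eq_card k_def)
  have 2: "\<bar>real k - 2 * real n * t\<bar> \<le> 1" using kb by linarith
  have 3: "\<bar>P - 2 * real n * G (real k / real (2 * n))\<bar> \<le> 2 * \<bar>c\<bar>"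
    using sum_p_error[OF n kb(3)] by (simp add: P_def G_def)
  have 4: "\<bar>2 * real n * G (real k / real (2 * n)) - 2 * real n * G t\<bar> \<le> 1"
  proof -
    have "\<bar>G (real k / real (2 * n)) - G t\<bar> \<le> \<bar>real k / real (2 * n) - t\<bar>"
      using occ_integral_lipschitz[of "real k / real (2 * n)" t] by (simp add: G_def)
    then have "2 * real n * \<bar>G (real k / real (2 * n)) - G t\<bar> \<le> 2 * real n * \<bar>real k / real (2 * n) - t\<bar>"
      by (intro mult_left_mono) auto
    also have "\<dots> = \<bar>real k - 2 * real n * t\<bar>"
    proof -
      have "2 * real n * \<bar>real k / real (2 * n) - t\<bar> = \<bar>2 * real n * (real k / real (2 * n) - t)\<bar>"
        by (simp add: abs_mult)
      also have "2 * real n * (real k / real (2 * n) - t) = real k - 2 * real n * t"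
        using n by (simp add: field_simps)
      finally show ?thesis .
    qed
    finally have "2 * real n * \<bar>G (real k / real (2 * n)) - G t\<bar> \<le> 1" using 2 by linarith
    then show ?thesis by (simp add: abs_mult flip: right_diff_distrib)
  qed
  have "fluctuation \<rho> c n (boundary_path \<pi>) t = r * (I / (2 * (r * r)) - (t - 2 * G t))"
    by (simp add: fluctuation_def I_def limit_shape_eq G_def r(2)) (simp add: r_def)
  also have "\<dots> = (I - 2 * real n * t + 4 * real n * G t) / (2 * r)"
    unfolding r(2)[symmetric] using r(1) by (simp add: field_simps)
  finally have fl: "fluctuation \<rho> c n (boundary_path \<pi>) t = (I - 2 * real n * t + 4 * real n * G t) / (2 * r)" .
  have wk: "walk n (down_steps \<pi>) k = (2 * P - 2 * N) / (2 * r)"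
    using r by (simp add: walk_def N_def P_def r_def[symmetric] field_simps)
  have "fluctuation \<rho> c n (boundary_path \<pi>) t - walk n (down_steps \<pi>) k
      = (I - 2 * real n * t + 4 * real n * G t - (2 * P - 2 * N)) / (2 * r)"
    unfolding fl wk by (simp add: diff_divide_distrib)
  also have "\<bar>\<dots>\<bar> = \<bar>I - 2 * real n * t + 4 * real n * G t - (2 * P - 2 * N)\<bar> / (2 * r)"
    using r by simp
  also have "\<dots> \<le> (4 + 4 * \<bar>c\<bar>) / (2 * r)"
    using r 1 2 3 4 by (intro divide_right_mono) linarith+
  also have "\<dots> = (2 + 2 * \<bar>c\<bar>) / r" using r by (simp add: field_simps)
  finally show ?thesis by (simp add: k_def r_def)
qed

lemma clock_0: "clock \<rho> c 0 = 0"
  by (simp add: clock_def)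

lemma variance_clock_error:
  assumes n: "n \<ge> 1" and t: "t \<in> {0..1}"
  shows "\<bar>(\<Sum>j<grid_index n t. p n j * (1 - p n j)) / real n - clock \<rho> c t\<bar> \<le> (2 * \<bar>c\<bar> + 1) / real n"
proof -
  define k where "k = grid_index n t"
  note kb = grid_index_bounds[OF t, of n, folded k_def]
  have "\<bar>(\<Sum>j<k. 2 * (p n j * (1 - p n j))) - real (2 * n) * (clock \<rho> c (real k / real (2 * n)) - clock \<rho> c 0)\<bar> \<le> 4 * \<bar>c\<bar>"
    using Riemann_sum_error[OF clock_deriv var_lipschitz, of "2 * n" k] n kb(3) by (simp add: p_def)
  then have 1: "\<bar>2 * (\<Sum>j<k. p n j * (1 - p n j)) - 2 * real n * clock \<rho> c (real k / real (2 * n))\<bar> \<le> 4 * \<bar>c\<bar>"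
    by (simp add: sum_distrib_left clock_0)
  have "\<bar>clock \<rho> c (real k / real (2 * n)) - clock \<rho> c t\<bar> \<le> 2 * \<bar>real k / real (2 * n) - t\<bar>"
    by (rule clock_lipschitz)
  then have "real n * \<bar>clock \<rho> c (real k / real (2 * n)) - clock \<rho> c t\<bar> \<le> real n * (2 * \<bar>real k / real (2 * n) - t\<bar>)"
    by (intro mult_left_mono) auto
  also have "\<dots> = \<bar>real k - 2 * real n * t\<bar>"
  proof -
    have "real n * (2 * \<bar>real k / real (2 * n) - t\<bar>) = \<bar>2 * real n * (real k / real (2 * n) - t)\<bar>"
      by (simp add: abs_mult)
    also have "2 * real n * (real k / real (2 * n) - t) = real k - 2 * real n * t"
      using n by (simp add: field_simps)
    finally show ?thesis .
  qed
  also have "\<dots> \<le> 1" using kb by linarith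
  finally have 2: "\<bar>real n * clock \<rho> c (real k / real (2 * n)) - real n * clock \<rho> c t\<bar> \<le> 1"
    by (simp add: abs_mult flip: right_diff_distrib)
  have "(\<Sum>j<k. p n j * (1 - p n j)) / real n - clock \<rho> c t = ((\<Sum>j<k. p n j * (1 - p n j)) - real n * clock \<rho> c t) / real n"
    using n by (simp add: field_simps)
  also have "\<bar>\<dots>\<bar> = \<bar>(\<Sum>j<k. p n j * (1 - p n j)) - real n * clock \<rho> c t\<bar> / real n" by simp
  also have "\<dots> \<le> (2 * \<bar>c\<bar> + 1) / real n" using 1 2 by (intro divide_right_mono) linarith+
  finally show ?thesis by (simp add: k_def)
qed

lemma variance_clock_tendsto:
  assumes t: "t \<in> {0..1}"
  shows "(\<lambda>n. (\<Sum>j<grid_index n t. p n j * (1 - p n j)) / real n) \<longlonglongrightarrow> clock \<rho> c t"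
proof -
  have "(\<lambda>n. (\<Sum>j<grid_index n t. p n j * (1 - p n j)) / real n - clock \<rho> c t) \<longlonglongrightarrow> 0"
  proof (rule Lim_null_comparison)
    show "\<forall>\<^sub>F n in sequentially. norm ((\<Sum>j<grid_index n t. p n j * (1 - p n j)) / real n - clock \<rho> c t) \<le> (2 * \<bar>c\<bar> + 1) / real n"
      using eventually_ge_at_top[of 1] by eventually_elim (use variance_clock_error[OF _ t] in simp)
    show "(\<lambda>n. (2 * \<bar>c\<bar> + 1) / real n) \<longlonglongrightarrow> 0" by real_asymp
  qed
  then show ?thesis by (rule LIM_zero_cancel)
qed

text \<open>The Riemann sum differs from \<open>2 * n * \<rho>\<close> by a bounded amount, by
  \<open>occ_integral_total\<close>, and \<open>drift\<close> controls the distance from there to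
  \<open>a n\<close>.\<close>

lemma mean_tendsto: "(\<lambda>n. ((\<Sum>j<2 * n. p n j) - real (a n)) / sqrt (real n)) \<longlonglongrightarrow> 0"
proof -
  have "(\<lambda>n. ((\<Sum>j<2 * n. p n j) - 2 * real n * \<rho>) / sqrt (real n)) \<longlonglongrightarrow> 0"
  proof (rule Lim_null_comparison[OF _ inverse_sqrt_tendsto[of "2 * \<bar>c\<bar>"]])
    show "\<forall>\<^sub>F n in sequentially. norm (((\<Sum>j<2 * n. p n j) - 2 * real n * \<rho>) / sqrt (real n)) \<le> 2 * \<bar>c\<bar> / sqrt (real n)"
      using eventually_ge_at_top[of 1]
    proof eventually_elim
      case (elim n)
      then show ?case
        using sum_p_error[of n "2 * n"] occ_integral_total by (simp add: divide_right_mono)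
    qed
  qed
  from tendsto_diff[OF this drift] show ?thesis by (simp add: diff_divide_distrib)
qed

section \<open>Finite-dimensional distributions\<close>

definition weight :: "nat \<Rightarrow> 'i set \<Rightarrow> ('i \<Rightarrow> real) \<Rightarrow> ('i \<Rightarrow> real) \<Rightarrow> nat \<Rightarrow> real" where
  "weight n J \<tau> v j = - (\<Sum>i\<in>J. v i * of_bool (j < grid_index n (\<tau> i)))"

text \<open>A down-step before several observation times enters once for each of them, with the
  coefficients that \<open>weight\<close> adds up; a linear combination of walk values thus becomes
  a statistic of the kind treated by \<open>bern_local_limit\<close>.\<close>

lemma walk_combination:
  assumes \<tau>: "\<And>i. i \<in> J \<Longrightarrow> \<tau> i \<in> {0..1}" and J: "finite J" and S: "S \<subseteq> {..<2 * n}"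
  shows "(\<Sum>i\<in>J. v i * walk n S (grid_index n (\<tau> i)))
    = ((\<Sum>j\<in>S. weight n J \<tau> v j) - (\<Sum>j<2 * n. p n j * weight n J \<tau> v j)) / sqrt (real n)"
proof -
  have finS: "finite S" using S finite_subset by blast
  have 1: "(\<Sum>j\<in>S. weight n J \<tau> v j) = - (\<Sum>i\<in>J. v i * real (card (S \<inter> {..<grid_index n (\<tau> i)})))"
  proof -
    have "(\<Sum>j\<in>S. weight n J \<tau> v j) = - (\<Sum>i\<in>J. \<Sum>j\<in>S. v i * of_bool (j < grid_index n (\<tau> i)))"
      unfolding weight_def sum_negf by (subst sum.swap) simp
    also have "(\<Sum>i\<in>J. \<Sum>j\<in>S. v i * of_bool (j < grid_index n (\<tau> i))) = (\<Sum>i\<in>J. v i * real (card (S \<inter> {..<grid_index n (\<tau> i)})))"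
    proof (intro sum.cong refl)
      fix i
      have "(\<Sum>j\<in>S. of_bool (j < grid_index n (\<tau> i)) :: real) = real (card (S \<inter> {..<grid_index n (\<tau> i)}))"
        using finS by (simp add: Int_def conj_commute)
      then show "(\<Sum>j\<in>S. v i * of_bool (j < grid_index n (\<tau> i))) = v i * real (card (S \<inter> {..<grid_index n (\<tau> i)}))"
        by (simp add: sum_distrib_left[symmetric])
    qed
    finally show ?thesis .
  qed
  have 2: "(\<Sum>j<2 * n. p n j * weight n J \<tau> v j) = - (\<Sum>i\<in>J. v i * (\<Sum>j<grid_index n (\<tau> i). p n j))"
  proof -
    have "(\<Sum>j<2 * n. p n j * weight n J \<tau> v j) = - (\<Sum>i\<in>J. \<Sum>j<2 * n. v i * (p n j * of_bool (j < grid_index n (\<tau> i))))"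
      unfolding weight_def by (subst sum.swap) (simp add: sum_negf sum_distrib_left mult_ac)
    also have "(\<Sum>i\<in>J. \<Sum>j<2 * n. v i * (p n j * of_bool (j < grid_index n (\<tau> i)))) = (\<Sum>i\<in>J. v i * (\<Sum>j<grid_index n (\<tau> i). p n j))"
      by (intro sum.cong refl)
         (simp only: sum_distrib_left[symmetric] sum_lessThan_of_bool[OF grid_index_bounds(3)[OF \<tau>]])
    finally show ?thesis .
  qed
  show ?thesis
    unfolding 1 2 walk_def
  proof -
    define C P r where "C = (\<lambda>i. real (card (S \<inter> {..<grid_index n (\<tau> i)})))"
      and "P = (\<lambda>i. \<Sum>j<grid_index n (\<tau> i). p n j)" and "r = sqrt (real n)"
    have "(\<Sum>i\<in>J. v i * (- (C i - P i) / r)) = (\<Sum>i\<in>J. (v i * P i - v i * C i) / r)"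
      by (intro sum.cong refl) (simp add: right_diff_distrib)
    also have "\<dots> = (- (\<Sum>i\<in>J. v i * C i) - - (\<Sum>i\<in>J. v i * P i)) / r"
      by (simp only: sum_divide_distrib[symmetric] sum_subtractf) simp
    finally show "(\<Sum>i\<in>J. v i * (- (real (card (S \<inter> {..<grid_index n (\<tau> i)})) - (\<Sum>j<grid_index n (\<tau> i). p n j)) / sqrt (real n)))
        = (- (\<Sum>i\<in>J. v i * real (card (S \<inter> {..<grid_index n (\<tau> i)}))) - - (\<Sum>i\<in>J. v i * (\<Sum>j<grid_index n (\<tau> i). p n j))) / sqrt (real n)"
      by (simp only: C_def P_def r_def)
  qed
qed

lemma weight_bound: "\<bar>weight n J \<tau> v j\<bar> \<le> (\<Sum>i\<in>J. \<bar>v i\<bar>)"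
proof -
  have "\<bar>weight n J \<tau> v j\<bar> \<le> (\<Sum>i\<in>J. \<bar>v i * of_bool (j < grid_index n (\<tau> i))\<bar>)"
    unfolding weight_def abs_minus_cancel by (rule sum_abs)
  also have "\<dots> \<le> (\<Sum>i\<in>J. \<bar>v i\<bar>)" by (intro sum_mono) auto
  finally show ?thesis .
qed

lemma variance_weight1:
  assumes \<tau>: "\<And>i. i \<in> J \<Longrightarrow> \<tau> i \<in> {0..1}"
  shows "(\<Sum>j<2 * n. p n j * (1 - p n j) * weight n J \<tau> v j)
    = - (\<Sum>i\<in>J. v i * (\<Sum>j<grid_index n (\<tau> i). p n j * (1 - p n j)))"
proof -
  have "(\<Sum>j<2 * n. p n j * (1 - p n j) * weight n J \<tau> v j)
      = - (\<Sum>i\<in>J. \<Sum>j<2 * n. v i * (p n j * (1 - p n j) * of_bool (j < grid_index n (\<tau> i))))"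
    unfolding weight_def by (subst sum.swap) (simp add: sum_negf sum_distrib_left mult_ac)
  also have "(\<Sum>i\<in>J. \<Sum>j<2 * n. v i * (p n j * (1 - p n j) * of_bool (j < grid_index n (\<tau> i))))
      = (\<Sum>i\<in>J. v i * (\<Sum>j<grid_index n (\<tau> i). p n j * (1 - p n j)))"
    by (intro sum.cong refl)
       (simp only: sum_distrib_left[symmetric] sum_lessThan_of_bool[OF grid_index_bounds(3)[OF \<tau>]])
  finally show ?thesis .
qed

text \<open>A step precedes both of two times exactly when it precedes the earlier one, which
  produces the covariance \<open>clock \<rho> c (min s t)\<close> in the limit.\<close>

lemma variance_weight2:
  assumes \<tau>: "\<And>i. i \<in> J \<Longrightarrow> \<tau> i \<in> {0..1}"
  shows "(\<Sum>j<2 * n. p n j * (1 - p n j) * (weight n J \<tau> v j)\<^sup>2)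
    = (\<Sum>i\<in>J. \<Sum>l\<in>J. v i * v l * (\<Sum>j<grid_index n (min (\<tau> i) (\<tau> l)). p n j * (1 - p n j)))"
proof -
  have "(weight n J \<tau> v j)\<^sup>2 = (\<Sum>i\<in>J. \<Sum>l\<in>J. v i * v l * of_bool (j < grid_index n (min (\<tau> i) (\<tau> l))))" for j
  proof -
    have "of_bool (j < grid_index n (\<tau> i)) * of_bool (j < grid_index n (\<tau> l)) = (of_bool (j < grid_index n (min (\<tau> i) (\<tau> l))) :: real)" for i l
    proof (cases "\<tau> i \<le> \<tau> l")
      case True
      then show ?thesis using grid_index_mono[OF True, of n] by (auto simp: min_def)
    next
      case False
      then show ?thesis using grid_index_mono[of "\<tau> l" "\<tau> i" n] by (auto simp: min_def)
    qed
    then show ?thesis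
      unfolding weight_def power2_eq_square minus_mult_minus sum_product
      by (intro sum.cong refl) (simp add: mult_ac)
  qed
  then have "(\<Sum>j<2 * n. p n j * (1 - p n j) * (weight n J \<tau> v j)\<^sup>2)
      = (\<Sum>j<2 * n. \<Sum>i\<in>J. \<Sum>l\<in>J. v i * v l * (p n j * (1 - p n j) * of_bool (j < grid_index n (min (\<tau> i) (\<tau> l)))))"
    by (simp add: sum_distrib_left mult_ac)
  also have "\<dots> = (\<Sum>i\<in>J. \<Sum>l\<in>J. \<Sum>j<2 * n. v i * v l * (p n j * (1 - p n j) * of_bool (j < grid_index n (min (\<tau> i) (\<tau> l)))))"
    by (subst sum.swap) (intro sum.cong refl sum.swap)
  also have "\<dots> = (\<Sum>i\<in>J. \<Sum>l\<in>J. v i * v l * (\<Sum>j<grid_index n (min (\<tau> i) (\<tau> l)). p n j * (1 - p n j)))"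
  proof (intro sum.cong refl)
    fix i l assume "i \<in> J" "l \<in> J"
    then have "min (\<tau> i) (\<tau> l) \<in> {0..1}" using \<tau>[of i] \<tau>[of l] by (auto simp: min_def)
    from grid_index_bounds(3)[OF this]
    show "(\<Sum>j<2 * n. v i * v l * (p n j * (1 - p n j) * of_bool (j < grid_index n (min (\<tau> i) (\<tau> l)))))
        = v i * v l * (\<Sum>j<grid_index n (min (\<tau> i) (\<tau> l)). p n j * (1 - p n j))"
      by (simp only: sum_distrib_left[symmetric] sum_lessThan_of_bool)
  qed
  finally show ?thesis .
qed

lemma grid_index_1: "grid_index n 1 = 2 * n"
proof -
  have "2 * real n * 1 = of_int (int (2 * n))" by simp
  then show ?thesis unfolding grid_index_def by (simp only: floor_of_int nat_int)
qed

lemma clock_1_pos: "clock \<rho> c 1 > 0"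
  using clock_strict[of 0 1] by (simp add: clock_0)

lemma weighted_local_limit:
  assumes J: "finite J" and \<tau>: "\<And>i. i \<in> J \<Longrightarrow> \<tau> i \<in> {0..1}"
  shows "(\<lambda>n. complex_of_real (sqrt (real n)) * (\<Sum>S | S \<subseteq> {..<2 * n} \<and> card S = a n.
      bern (p n) {..<2 * n} S * iexp (\<Sum>i\<in>J. v i * walk n S (grid_index n (\<tau> i)))))
    \<longlonglongrightarrow> complex_of_real (exp (- (\<Sum>i\<in>J. \<Sum>l\<in>J. v i * v l
        * (clock \<rho> c (min (\<tau> i) (\<tau> l)) - clock \<rho> c (\<tau> i) * clock \<rho> c (\<tau> l) / clock \<rho> c 1)) / 2)
      * sqrt (2 * pi / clock \<rho> c 1) / (2 * pi))"
proof -
  \<comment> \<open>Indices are shifted by one because \<open>bern_local_limit\<close> asks for a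
    positive scale at every index.\<close>
  define A where "A = (\<lambda>n. {..<2 * Suc n})"
  define w where "w = (\<lambda>n. weight (Suc n) J \<tau> v)"
  define r where "r = (\<lambda>n. sqrt (real (Suc n)))"
  have r: "r n > 0" "(r n)\<^sup>2 = real (Suc n)" for n by (auto simp: r_def)
  obtain v0 where v0: "v0 > 0" "\<And>t. t \<in> {0..1} \<Longrightarrow> v0 \<le> occ \<rho> c t * (1 - occ \<rho> c t)"
    using var_lower_bound by blast
  define a1 where "a1 = - (\<Sum>i\<in>J. v i * clock \<rho> c (\<tau> i))"
  define a2 where "a2 = (\<Sum>i\<in>J. \<Sum>l\<in>J. v i * v l * clock \<rho> c (min (\<tau> i) (\<tau> l)))"
  have pull1: "(- (\<Sum>i\<in>J. v i * s i)) / N = - (\<Sum>i\<in>J. v i * (s i / N))" for s N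
    by (simp add: sum_divide_distrib)
  have pull2: "(\<Sum>i\<in>J. \<Sum>l\<in>J. v i * v l * s i l) / N = (\<Sum>i\<in>J. \<Sum>l\<in>J. v i * v l * (s i l / N))" for s N
    by (simp add: sum_divide_distrib)
  have lim: "(\<lambda>n. complex_of_real (r n) * (\<Sum>S | S \<subseteq> A n \<and> card S = a (Suc n).
        bern (p (Suc n)) (A n) S * iexp (((\<Sum>j\<in>S. w n j) - (\<Sum>j\<in>A n. p (Suc n) j * w n j)) / r n)))
    \<longlonglongrightarrow> complex_of_real (\<integral>x. exp (- (clock \<rho> c 1 * x\<^sup>2 + 2 * a1 * x + a2) / 2) \<partial>lborel) / (2 * pi)"
  \<comment> \<open>Both \<open>K\<close> and \<open>\<kappa>\<close> are 2 since there are exactly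
    \<open>2 * (r n)^2\<close> steps.\<close>
  proof (rule bern_local_limit[where v = v0 and C = "\<Sum>i\<in>J. \<bar>v i\<bar>" and K = 2 and \<kappa> = 2])
    show "filterlim r at_top sequentially" unfolding r_def by real_asymp
    show "p (Suc n) j \<in> {0..1} \<and> v0 \<le> p (Suc n) j * (1 - p (Suc n) j)" if "j \<in> A n" for n j
    proof -
      have "real j / real (2 * Suc n) \<in> {0..1}" using that by (auto simp: A_def divide_le_eq_1)
      then show ?thesis using p_bounds[of "Suc n" j] v0(2) by (auto simp: p_def)
    qed
    show "\<bar>w n j\<bar> \<le> (\<Sum>i\<in>J. \<bar>v i\<bar>)" for n j unfolding w_def by (rule weight_bound)
    have one: "(1::real) \<in> {0..1}" by simp
    show "(\<lambda>n. (\<Sum>j\<in>A n. p (Suc n) j * (1 - p (Suc n) j)) / (r n)\<^sup>2) \<longlonglongrightarrow> clock \<rho> c 1"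
      unfolding r A_def using LIMSEQ_Suc[OF variance_clock_tendsto[OF one]] by (simp only: grid_index_1)
    show "(\<lambda>n. (\<Sum>j\<in>A n. p (Suc n) j * (1 - p (Suc n) j) * w n j) / (r n)\<^sup>2) \<longlonglongrightarrow> a1"
    proof -
      have "(\<lambda>n. - (\<Sum>i\<in>J. v i * ((\<Sum>j<grid_index (Suc n) (\<tau> i). p (Suc n) j * (1 - p (Suc n) j)) / real (Suc n)))) \<longlonglongrightarrow> a1"
        unfolding a1_def by (intro tendsto_intros LIMSEQ_Suc[OF variance_clock_tendsto] \<tau>)
      moreover have "(\<Sum>j\<in>A n. p (Suc n) j * (1 - p (Suc n) j) * w n j)
          = - (\<Sum>i\<in>J. v i * (\<Sum>j<grid_index (Suc n) (\<tau> i). p (Suc n) j * (1 - p (Suc n) j)))" for n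
        unfolding A_def w_def by (rule variance_weight1) (rule \<tau>)
      ultimately show ?thesis
        by (simp only: r pull1)
    qed
    show "(\<lambda>n. (\<Sum>j\<in>A n. p (Suc n) j * (1 - p (Suc n) j) * (w n j)\<^sup>2) / (r n)\<^sup>2) \<longlonglongrightarrow> a2"
    proof -
      have "(\<lambda>n. (\<Sum>i\<in>J. \<Sum>l\<in>J. v i * v l * ((\<Sum>j<grid_index (Suc n) (min (\<tau> i) (\<tau> l)). p (Suc n) j * (1 - p (Suc n) j)) / real (Suc n)))) \<longlonglongrightarrow> a2"
        unfolding a2_def
      proof (intro tendsto_intros LIMSEQ_Suc[OF variance_clock_tendsto])
        fix i l assume "i \<in> J" "l \<in> J"
        then show "min (\<tau> i) (\<tau> l) \<in> {0..1}" using \<tau>[of i] \<tau>[of l] by (auto simp: min_def)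
      qed
      moreover have "(\<Sum>j\<in>A n. p (Suc n) j * (1 - p (Suc n) j) * (w n j)\<^sup>2)
          = (\<Sum>i\<in>J. \<Sum>l\<in>J. v i * v l * (\<Sum>j<grid_index (Suc n) (min (\<tau> i) (\<tau> l)). p (Suc n) j * (1 - p (Suc n) j)))" for n
        unfolding A_def w_def by (rule variance_weight2) (rule \<tau>)
      ultimately show ?thesis
        by (simp only: r pull2)
    qed
    show "(\<lambda>n. ((\<Sum>j\<in>A n. p (Suc n) j) - real (a (Suc n))) / r n) \<longlonglongrightarrow> 0"
      using LIMSEQ_Suc[OF mean_tendsto] unfolding A_def r_def .
  qed (use r v0 in \<open>auto simp: A_def sum_nonneg\<close>)
  have "(\<lambda>n. complex_of_real (sqrt (real (Suc n))) * (\<Sum>S | S \<subseteq> {..<2 * Suc n} \<and> card S = a (Suc n).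
      bern (p (Suc n)) {..<2 * Suc n} S * iexp (\<Sum>i\<in>J. v i * walk (Suc n) S (grid_index (Suc n) (\<tau> i)))))
    \<longlonglongrightarrow> complex_of_real (\<integral>x. exp (- (clock \<rho> c 1 * x\<^sup>2 + 2 * a1 * x + a2) / 2) \<partial>lborel) / (2 * pi)"
  proof (rule Lim_transform_eventually[OF lim], rule always_eventually, rule allI)
    fix n
    have "(\<Sum>S | S \<subseteq> A n \<and> card S = a (Suc n).
        bern (p (Suc n)) (A n) S * iexp (((\<Sum>j\<in>S. w n j) - (\<Sum>j\<in>A n. p (Suc n) j * w n j)) / r n))
      = (\<Sum>S | S \<subseteq> {..<2 * Suc n} \<and> card S = a (Suc n).
      bern (p (Suc n)) {..<2 * Suc n} S * iexp (\<Sum>i\<in>J. v i * walk (Suc n) S (grid_index (Suc n) (\<tau> i))))"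
    proof (rule sum.cong)
      fix S assume "S \<in> {S. S \<subseteq> {..<2 * Suc n} \<and> card S = a (Suc n)}"
      then have "S \<subseteq> {..<2 * Suc n}" by blast
      from walk_combination[where J = J and \<tau> = \<tau>, OF \<tau> J this, of v]
      show "bern (p (Suc n)) (A n) S * iexp (((\<Sum>j\<in>S. w n j) - (\<Sum>j\<in>A n. p (Suc n) j * w n j)) / r n)
        = bern (p (Suc n)) {..<2 * Suc n} S * iexp (\<Sum>i\<in>J. v i * walk (Suc n) S (grid_index (Suc n) (\<tau> i)))"
        unfolding A_def w_def r_def by (simp only:)
    qed (simp add: A_def)
    then show "complex_of_real (r n) * (\<Sum>S | S \<subseteq> A n \<and> card S = a (Suc n).
        bern (p (Suc n)) (A n) S * iexp (((\<Sum>j\<in>S. w n j) - (\<Sum>j\<in>A n. p (Suc n) j * w n j)) / r n))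
      = complex_of_real (sqrt (real (Suc n))) * (\<Sum>S | S \<subseteq> {..<2 * Suc n} \<and> card S = a (Suc n).
      bern (p (Suc n)) {..<2 * Suc n} S * iexp (\<Sum>i\<in>J. v i * walk (Suc n) S (grid_index (Suc n) (\<tau> i))))"
      unfolding r_def by (simp only:)
  qed
  note this[THEN LIMSEQ_imp_Suc]
  \<comment> \<open>Regression on the total turns the Brownian covariance into that of the
    bridge.\<close>
  moreover have "a2 - a1\<^sup>2 / clock \<rho> c 1 = (\<Sum>i\<in>J. \<Sum>l\<in>J. v i * v l
        * (clock \<rho> c (min (\<tau> i) (\<tau> l)) - clock \<rho> c (\<tau> i) * clock \<rho> c (\<tau> l) / clock \<rho> c 1))"
    unfolding a1_def a2_def power2_minus
    unfolding power2_eq_square sum_product sum_divide_distrib sum_subtractf[symmetric]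
    by (intro sum.cong refl) (simp add: right_diff_distrib mult_ac)
  ultimately show ?thesis
    unfolding gaussian_shift_integral[OF clock_1_pos] by simp
qed

text \<open>The case without observation times. The limit is positive, so the conditioning event has
  probability exactly of order \<open>1 / sqrt n\<close>.\<close>

lemma mass_limit:
  "(\<lambda>n. sqrt (real n) * mass n) \<longlonglongrightarrow> sqrt (2 * pi / clock \<rho> c 1) / (2 * pi)"
proof -
  have "(\<lambda>n. complex_of_real (sqrt (real n) * mass n)) \<longlonglongrightarrow> complex_of_real (sqrt (2 * pi / clock \<rho> c 1) / (2 * pi))"
    using weighted_local_limit[of "{}" "\<lambda>_. 0" "\<lambda>_. 0"] by (simp add: mass_def)
  then show ?thesis by (simp only: tendsto_of_real_iff)
qed

lemma char_walk_tendsto: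
  assumes J: "finite J" and \<tau>: "\<And>i. i \<in> J \<Longrightarrow> \<tau> i \<in> {0..1}"
  shows "(\<lambda>n. \<integral>\<pi>. iexp (\<Sum>i\<in>J. v i * walk n (down_steps \<pi>) (grid_index n (\<tau> i))) \<partial>law n)
    \<longlonglongrightarrow> complex_of_real (exp (- (\<Sum>i\<in>J. \<Sum>l\<in>J. v i * v l
        * (clock \<rho> c (min (\<tau> i) (\<tau> l)) - clock \<rho> c (\<tau> i) * clock \<rho> c (\<tau> l) / clock \<rho> c 1)) / 2))"
proof -
  define E where "E = exp (- (\<Sum>i\<in>J. \<Sum>l\<in>J. v i * v l
        * (clock \<rho> c (min (\<tau> i) (\<tau> l)) - clock \<rho> c (\<tau> i) * clock \<rho> c (\<tau> l) / clock \<rho> c 1)) / 2)"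
  define m where "m = sqrt (2 * pi / clock \<rho> c 1) / (2 * pi)"
  have m: "m > 0" using clock_1_pos by (simp add: m_def)
  define T where "T = (\<lambda>n. \<Sum>S | S \<subseteq> {..<2 * n} \<and> card S = a n.
      bern (p n) {..<2 * n} S * iexp (\<Sum>i\<in>J. v i * walk n S (grid_index n (\<tau> i))))"
  have "(\<lambda>n. complex_of_real (sqrt (real n)) * T n) \<longlonglongrightarrow> complex_of_real (E * m)"
    unfolding T_def E_def m_def using weighted_local_limit[where J = J and \<tau> = \<tau> and v = v, OF J \<tau>] by simp
  moreover have "(\<lambda>n. complex_of_real (sqrt (real n) * mass n)) \<longlonglongrightarrow> complex_of_real m"
    using mass_limit unfolding m_def by (rule tendsto_of_real)
  ultimately have "(\<lambda>n. complex_of_real (sqrt (real n)) * T n / complex_of_real (sqrt (real n) * mass n))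
      \<longlonglongrightarrow> complex_of_real (E * m) / complex_of_real m"
    using m by (intro tendsto_divide) auto
  also have "complex_of_real (E * m) / complex_of_real m = complex_of_real E" using m by simp
  finally have "(\<lambda>n. complex_of_real (sqrt (real n)) * T n / complex_of_real (sqrt (real n) * mass n)) \<longlonglongrightarrow> complex_of_real E" .
  then show ?thesis
    unfolding E_def[symmetric]
  proof (rule Lim_transform_eventually)
    show "\<forall>\<^sub>F n in sequentially. complex_of_real (sqrt (real n)) * T n / complex_of_real (sqrt (real n) * mass n)
        = (\<integral>\<pi>. iexp (\<Sum>i\<in>J. v i * walk n (down_steps \<pi>) (grid_index n (\<tau> i))) \<partial>law n)"
      using eventually_ge_at_top[of 1]
    proof eventually_elim
      case (elim n)
      have "(\<integral>\<pi>. iexp (\<Sum>i\<in>J. v i * walk n (down_steps \<pi>) (grid_index n (\<tau> i))) \<partial>law n) = T n /\<^sub>R mass n"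
        unfolding integral_law[OF elim, of "\<lambda>S. iexp (\<Sum>i\<in>J. v i * walk n S (grid_index n (\<tau> i)))"] T_def
        by (simp only: scaleR_conv_of_real)
      then show ?case using elim by (simp add: scaleR_conv_of_real field_simps)
    qed
  qed
qed

lemma char_fluctuation_tendsto:
  assumes J: "finite J" and \<tau>: "\<And>i. i \<in> J \<Longrightarrow> \<tau> i \<in> {0..1}"
  shows "(\<lambda>n. \<integral>\<pi>. iexp (\<Sum>i\<in>J. u i * (fluctuation \<rho> c n (boundary_path \<pi>) (\<tau> i) / fluctuation_scale \<rho> c (\<tau> i))) \<partial>law n)
    \<longlonglongrightarrow> complex_of_real (exp (- (\<Sum>i\<in>J. \<Sum>l\<in>J. u i * u l * OU_cov c (\<tau> i) (\<tau> l)) / 2))"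
proof -
  define v where "v = (\<lambda>i. u i / fluctuation_scale \<rho> c (\<tau> i))"
  have var: "(\<Sum>i\<in>J. \<Sum>l\<in>J. v i * v l * (clock \<rho> c (min (\<tau> i) (\<tau> l)) - clock \<rho> c (\<tau> i) * clock \<rho> c (\<tau> l) / clock \<rho> c 1))
      = (\<Sum>i\<in>J. \<Sum>l\<in>J. u i * u l * OU_cov c (\<tau> i) (\<tau> l))"
  proof (intro sum.cong refl)
    fix i l assume il: "i \<in> J" "l \<in> J"
    have "fluctuation_scale \<rho> c (\<tau> i) \<noteq> 0" "fluctuation_scale \<rho> c (\<tau> l) \<noteq> 0"
      using fluctuation_scale_nonzero \<rho> c \<tau> il by auto
    then show "v i * v l * (clock \<rho> c (min (\<tau> i) (\<tau> l)) - clock \<rho> c (\<tau> i) * clock \<rho> c (\<tau> l) / clock \<rho> c 1) = u i * u l * OU_cov c (\<tau> i) (\<tau> l)"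
      unfolding clock_bridge_eq[OF \<tau>[OF il(1)] \<tau>[OF il(2)]] v_def by simp
  qed
  define X where "X = (\<lambda>n \<pi>. \<Sum>i\<in>J. v i * fluctuation \<rho> c n (boundary_path \<pi>) (\<tau> i))"
  define W where "W = (\<lambda>n \<pi>. \<Sum>i\<in>J. v i * walk n (down_steps \<pi>) (grid_index n (\<tau> i)))"
  define C where "C = (\<Sum>i\<in>J. \<bar>v i\<bar>) * (2 + 2 * \<bar>c\<bar>)"
  have close: "(\<lambda>n. (\<integral>\<pi>. iexp (X n \<pi>) \<partial>law n) - (\<integral>\<pi>. iexp (W n \<pi>) \<partial>law n)) \<longlonglongrightarrow> 0"
  proof (rule Lim_null_comparison[OF _ inverse_sqrt_tendsto[of C]])
    show "\<forall>\<^sub>F n in sequentially. norm ((\<integral>\<pi>. iexp (X n \<pi>) \<partial>law n) - (\<integral>\<pi>. iexp (W n \<pi>) \<partial>law n)) \<le> C / sqrt (real n)"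
      using eventually_ge_at_top[of 1]
    proof eventually_elim
      case (elim n)
      interpret prob_space "law n" by (rule prob_space_law)
      have int: "integrable (law n) (\<lambda>\<pi>. iexp (X n \<pi>))" "integrable (law n) (\<lambda>\<pi>. iexp (W n \<pi>))"
        by (intro integrable_iexp'[OF prob_space_law] measurable_law)+
      have pt: "norm (iexp (X n \<pi>) - iexp (W n \<pi>)) \<le> C / sqrt (real n)" for \<pi>
      proof -
        have "\<bar>X n \<pi> - W n \<pi>\<bar> \<le> (\<Sum>i\<in>J. \<bar>v i * (fluctuation \<rho> c n (boundary_path \<pi>) (\<tau> i) - walk n (down_steps \<pi>) (grid_index n (\<tau> i)))\<bar>)"
          unfolding X_def W_def sum_subtractf[symmetric] right_diff_distrib[symmetric] by (rule sum_abs)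
        also have "\<dots> \<le> (\<Sum>i\<in>J. \<bar>v i\<bar> * ((2 + 2 * \<bar>c\<bar>) / sqrt (real n)))"
          unfolding abs_mult by (intro sum_mono mult_left_mono fluctuation_near_walk elim \<tau>) auto
        also have "\<dots> = C / sqrt (real n)" by (simp add: C_def sum_distrib_right sum_divide_distrib)
        finally show ?thesis using norm_iexp_diff_le[of "X n \<pi>" "W n \<pi>"] by linarith
      qed
      have "norm ((\<integral>\<pi>. iexp (X n \<pi>) \<partial>law n) - (\<integral>\<pi>. iexp (W n \<pi>) \<partial>law n)) = norm (\<integral>\<pi>. iexp (X n \<pi>) - iexp (W n \<pi>) \<partial>law n)"
        using int by simp
      also have "\<dots> \<le> (\<integral>\<pi>. norm (iexp (X n \<pi>) - iexp (W n \<pi>)) \<partial>law n)" by (rule integral_norm_bound)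
      also have "\<dots> \<le> (\<integral>\<pi>. C / sqrt (real n) \<partial>law n)"
        using int pt by (intro integral_mono integrable_norm Bochner_Integration.integrable_diff) auto
      also have "\<dots> = C / sqrt (real n)" by (simp add: prob_space)
      finally show ?case .
    qed
  qed
  have "(\<lambda>n. \<integral>\<pi>. iexp (W n \<pi>) \<partial>law n) \<longlonglongrightarrow> complex_of_real (exp (- (\<Sum>i\<in>J. \<Sum>l\<in>J. u i * u l * OU_cov c (\<tau> i) (\<tau> l)) / 2))"
    using char_walk_tendsto[where J = J and \<tau> = \<tau> and v = v, OF J \<tau>] unfolding var W_def .
  from tendsto_add[OF close this]
  have "(\<lambda>n. \<integral>\<pi>. iexp (X n \<pi>) \<partial>law n) \<longlonglongrightarrow> complex_of_real (exp (- (\<Sum>i\<in>J. \<Sum>l\<in>J. u i * u l * OU_cov c (\<tau> i) (\<tau> l)) / 2))"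
    by simp
  then show ?thesis by (simp add: X_def v_def)
qed

section \<open>Oscillation of the walk on blocks\<close>

definition steady :: "nat \<Rightarrow> nat \<Rightarrow> real \<Rightarrow> nat set \<Rightarrow> bool" where
  "steady n m \<epsilon> S \<longleftrightarrow> (\<forall>i<m. \<forall>k\<in>{grid_index n (real i / real m)..grid_index n (real (Suc i) / real m)}.
     \<bar>real (card (S \<inter> {grid_index n (real i / real m)..<k})) - (\<Sum>j=grid_index n (real i / real m)..<k. p n j)\<bar>
       < \<epsilon> * sqrt (real n) / 4)"

lemma walk_increment:
  assumes "s \<le> k" and S: "finite S"
  shows "walk n S k - walk n S s = - (real (card (S \<inter> {s..<k})) - (\<Sum>j=s..<k. p n j)) / sqrt (real n)"
proof -
  have "S \<inter> {..<k} = (S \<inter> {..<s}) \<union> (S \<inter> {s..<k})" "(S \<inter> {..<s}) \<inter> (S \<inter> {s..<k}) = {}"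
    using assms by auto
  then have "card (S \<inter> {..<k}) = card (S \<inter> {..<s}) + card (S \<inter> {s..<k})"
    using S by (simp add: card_Un_disjoint)
  moreover have "(\<Sum>j<k. p n j) = (\<Sum>j<s. p n j) + (\<Sum>j=s..<k. p n j)"
    using assms sum.atLeastLessThan_concat[of 0 s k "p n"] by (simp add: atLeast0LessThan)
  ultimately show ?thesis unfolding walk_def diff_divide_distrib[symmetric] by simp
qed

lemma steady_walk:
  assumes n: "n \<ge> 1" and st: "steady n m \<epsilon> S" and S: "finite S" and i: "i < m"
    and k: "k \<in> {grid_index n (real i / real m)..grid_index n (real (Suc i) / real m)}"
  shows "\<bar>walk n S k - walk n S (grid_index n (real i / real m))\<bar> \<le> \<epsilon> / 4"
proof -
  have r: "sqrt (real n) > 0" using n by simp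
  define D where "D = real (card (S \<inter> {grid_index n (real i / real m)..<k})) - (\<Sum>j=grid_index n (real i / real m)..<k. p n j)"
  have "\<bar>D\<bar> \<le> \<epsilon> / 4 * sqrt (real n)"
    unfolding D_def using st i k by (force simp: steady_def)
  then have "\<bar>- D / sqrt (real n)\<bar> \<le> \<epsilon> / 4"
    using r by (simp add: divide_le_eq)
  then show ?thesis
    using walk_increment[of "grid_index n (real i / real m)" k S n] k S by (simp add: D_def)
qed

text \<open>The four quarters of \<open>\<epsilon>\<close> are two block increments and the
  distances between fluctuation and walk at \<open>t\<close> and at the node.\<close>

lemma steady_interp:
  assumes n: "n \<ge> 1" and m: "m \<ge> 1" and st: "steady n m \<epsilon> (down_steps \<pi>)" and t: "t \<in> {0..1}"
    and small: "(2 + 2 * \<bar>c\<bar>) / sqrt (real n) \<le> \<epsilon> / 4"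
  shows "\<bar>fluctuation \<rho> c n (boundary_path \<pi>) t - interp m (fluctuation \<rho> c n (boundary_path \<pi>)) t\<bar> \<le> \<epsilon>"
proof (rule interp_error[OF t])
  show "m > 0" using m by simp
  define S where "S = down_steps \<pi>"
  have S: "finite S" by (simp add: S_def down_steps_def)
  have r: "sqrt (real n) > 0" using n by simp
  have \<epsilon>: "0 \<le> \<epsilon>"
  proof -
    have "0 \<le> (2 + 2 * \<bar>c\<bar>) / sqrt (real n)" using r by simp
    then show ?thesis using small by linarith
  qed
  fix k assume k: "k \<le> m" "\<bar>t - real k / real m\<bar> < 1 / real m"
  have k01: "real k / real m \<in> {0..1}" using k m by auto
  define s where "s = grid_index n (real k / real m)"
  define x where "x = grid_index n t"
  have "\<bar>walk n S x - walk n S s\<bar> \<le> 2 * (\<epsilon> / 4)"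
  proof (cases "real k / real m \<le> t")
    case True
    show ?thesis
    \<comment> \<open>No block begins at the last node, but in that case \<open>t\<close> is the
      node itself.\<close>
    proof (cases "k = m")
      case True
      then have "t = real k / real m" using \<open>real k / real m \<le> t\<close> t m by auto
      then show ?thesis using \<epsilon> by (simp add: x_def s_def)
    next
      case False
      have "t \<le> real (Suc k) / real m"
        using k(2) by (simp add: add_divide_distrib)
      then have "x \<in> {s..grid_index n (real (Suc k) / real m)}"
        unfolding x_def s_def using True by (auto intro: grid_index_mono)
      then have "\<bar>walk n S x - walk n S s\<bar> \<le> \<epsilon> / 4"
        unfolding s_def by (intro steady_walk[OF n st[folded S_def] S]) (use False k in auto)
      then show ?thesis using \<epsilon> by simp
    qed
  next
    case False
    \<comment> \<open>The node lies to the right of \<open>t\<close>; both are compared with the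
      left end of the block that contains them, which costs two increments.\<close>
    then obtain l where l: "k = Suc l" using t by (cases k) auto
    define s' where "s' = grid_index n (real l / real m)"
    have "real l / real m \<le> t"
      using k(2) l by (simp add: add_divide_distrib)
    then have "x \<in> {s'..s}" unfolding x_def s_def s'_def using False by (auto intro: grid_index_mono)
    then have "\<bar>walk n S x - walk n S s'\<bar> \<le> \<epsilon> / 4" "\<bar>walk n S s - walk n S s'\<bar> \<le> \<epsilon> / 4"
      unfolding s'_def s_def l by (intro steady_walk[OF n st[folded S_def] S]; use k l in auto)+
    then show ?thesis by linarith
  qed
  moreover have "\<bar>fluctuation \<rho> c n (boundary_path \<pi>) t - walk n S x\<bar> \<le> \<epsilon> / 4"
    using fluctuation_near_walk[OF n t, of \<pi>] small unfolding S_def x_def by linarith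
  moreover have "\<bar>fluctuation \<rho> c n (boundary_path \<pi>) (real k / real m) - walk n S s\<bar> \<le> \<epsilon> / 4"
    using fluctuation_near_walk[OF n k01, of \<pi>] small unfolding S_def s_def by linarith
  ultimately show "\<bar>fluctuation \<rho> c n (boundary_path \<pi>) t - fluctuation \<rho> c n (boundary_path \<pi>) (real k / real m)\<bar> \<le> \<epsilon>"
    by linarith
qed

text \<open>A block has about \<open>2 * n / m\<close> steps, at most \<open>3 * n / m\<close> after
  rounding since \<open>n \<ge> m\<close>. With \<open>m \<ge> 3\<close> at least \<open>n\<close>
  of the \<open>2 * n\<close> steps remain outside, enough for a local bound of order
  \<open>1 / sqrt n\<close>. The exponent is \<open>2 * l^2 / D\<close> with
  \<open>l = \<epsilon> * sqrt n / 4\<close> and \<open>D = 3 * n / m\<close>.\<close>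

lemma block_oscillation_le:
  assumes n: "n \<ge> m" and m: "m \<ge> 3" and i: "i < m" and \<epsilon>: "\<epsilon> > 0"
    and v0: "v0 > 0" "\<And>t. t \<in> {0..1} \<Longrightarrow> v0 \<le> occ \<rho> c t * (1 - occ \<rho> c t)"
    and s: "s = grid_index n (real i / real m)" and e: "e = grid_index n (real (Suc i) / real m)"
  shows "(\<Sum>S | S \<subseteq> {..<2 * n} \<and> card S = N. bern (p n) {..<2 * n} S *
      of_bool (\<exists>k\<in>{s..e}. \<bar>real (card (S \<inter> {s..<k})) - (\<Sum>j=s..<k. p n j)\<bar> \<ge> \<epsilon> * sqrt (real n) / 4))
    \<le> 2 * exp (- (\<epsilon>\<^sup>2 / 24 * real m)) * (sqrt (32 / v0) / sqrt (real n))"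
proof -
  have nm: "real m > 0" "real n > 0" "real m \<le> real n" using n m by auto
  have ts: "real i / real m \<in> {0..1}" "real (Suc i) / real m \<in> {0..1}" using i m by auto
  note sb = grid_index_bounds[OF ts(1), of n, folded s] and eb = grid_index_bounds[OF ts(2), of n, folded e]
  have gap: "2 * real n * (real (Suc i) / real m) - 2 * real n * (real i / real m) = 2 * real n / real m"
    using nm by (simp add: field_simps)
  have ratio: "1 \<le> real n / real m" using nm by simp
  have len: "real e - real s \<le> 3 * (real n / real m)" "real e - real s > 0"
    using sb eb gap ratio by (auto simp: divide_inverse)
  then have se: "s < e" by simp
  define I where "I = {s..<e}"
  define A where "A = {..<2 * n}"
  have I: "I \<subseteq> A" using eb(3) by (auto simp: I_def A_def)
  have cardI: "card (A - I) = 2 * n - (e - s)"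
    using I by (subst card_Diff_subset) (auto simp: I_def A_def)
  have "3 * (real n / real m) \<le> real n"
    using m nm by (simp add: field_simps)
  then have "real (e - s) \<le> real n" using len se by (simp add: of_nat_diff)
  then have cardJ: "n \<le> card (A - I)" unfolding cardI by simp
  have p01: "p n j \<in> {0..1}" for j by (rule p_bounds)
  have pv: "p n j \<in> {0..1} \<and> v0 \<le> p n j * (1 - p n j)" if "j \<in> A" for j
  proof -
    have "real j / real (2 * n) \<in> {0..1}" using that nm by (auto simp: A_def)
    then show ?thesis using v0(2) p01 by (simp add: p_def)
  qed
  have Q: "(\<Sum>S | S \<subseteq> A - I \<and> card S = N'. bern (p n) (A - I) S) \<le> sqrt (32 / v0) / sqrt (real n)" for N'
  proof -
    have "(\<Sum>S | S \<subseteq> A - I \<and> card S = N'. bern (p n) (A - I) S) \<le> sqrt (32 / v0) / sqrt (real (card (A - I)))"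
      by (rule bern_card_le[OF _ v0(1)]) (use pv cardJ nm in \<open>auto simp: A_def\<close>)
    also have "\<dots> \<le> sqrt (32 / v0) / sqrt (real n)"
      using cardJ nm v0(1) by (intro divide_left_mono) auto
    finally show ?thesis .
  qed
  define E where "E = (\<lambda>S. \<exists>k\<in>{s..e}. \<bar>real (card (S \<inter> {s..<k})) - (\<Sum>j=s..<k. p n j)\<bar> \<ge> \<epsilon> * sqrt (real n) / 4)"
  have EI: "E (S \<inter> I) = E S" for S
  proof -
    have "S \<inter> I \<inter> {s..<k} = S \<inter> {s..<k}" if "k \<in> {s..e}" for k using that by (auto simp: I_def)
    then show ?thesis by (simp add: E_def)
  qed
  have "(\<Sum>S | S \<subseteq> A \<and> card S = N. bern (p n) A S * of_bool (E (S \<inter> I)))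
      \<le> (\<Sum>S\<in>Pow I. bern (p n) I S * of_bool (E S)) * (sqrt (32 / v0) / sqrt (real n))"
    by (rule bern_conditioned_event_le[OF _ I p01 Q]) (simp add: A_def)
  also have "\<dots> \<le> 2 * exp (- (\<epsilon>\<^sup>2 / 24 * real m)) * (sqrt (32 / v0) / sqrt (real n))"
  proof (rule mult_right_mono)
    have "(\<Sum>S\<in>Pow I. bern (p n) I S * of_bool (E S)) \<le> 2 * exp (- 2 * (\<epsilon> * sqrt (real n) / 4)\<^sup>2 / (3 * (real n / real m)))"
      unfolding I_def E_def by (rule bern_maximal) (use p01 se len \<epsilon> in \<open>auto simp: of_nat_diff\<close>)
    also have "- 2 * (\<epsilon> * sqrt (real n) / 4)\<^sup>2 / (3 * (real n / real m)) = - (\<epsilon>\<^sup>2 / 24 * real m)"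
      using nm by (simp add: power_mult_distrib power_divide)
    finally show "(\<Sum>S\<in>Pow I. bern (p n) I S * of_bool (E S)) \<le> 2 * exp (- (\<epsilon>\<^sup>2 / 24 * real m))" .
  qed (use v0 in simp)
  finally show ?thesis unfolding EI by (simp add: E_def A_def)
qed

text \<open>The union bound over the blocks costs a factor \<open>m\<close>, which the exponential
  beats. The order \<open>1 / sqrt n\<close> of the local bound outside a block cancels against that
  of \<open>mass\<close>, so the estimate is uniform in large \<open>n\<close>.\<close>

lemma unsteady_tendsto:
  fixes \<epsilon> \<eta> :: real
  assumes \<epsilon>: "\<epsilon> > 0" and \<eta>: "\<eta> > 0"
  shows "\<forall>\<^sub>F m in sequentially. \<forall>\<^sub>F n in sequentially. (\<integral>\<pi>. of_bool (\<not> steady n m \<epsilon> (down_steps \<pi>)) \<partial>law n) \<le> \<eta>"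
proof -
  obtain v0 where v0: "v0 > 0" "\<And>t. t \<in> {0..1} \<Longrightarrow> v0 \<le> occ \<rho> c t * (1 - occ \<rho> c t)"
    using var_lower_bound by blast
  define w where "w = sqrt (2 * pi / clock \<rho> c 1) / (2 * pi)"
  have w: "w > 0" using clock_1_pos by (simp add: w_def)
  \<comment> \<open>The 4 combines the factor 2 of the maximal inequality with the lower bound
    \<open>w / 2\<close> for \<open>sqrt n * mass n\<close>.\<close>
  define K where "K = 4 * sqrt (32 / v0) / w"
  define \<alpha> where "\<alpha> = \<epsilon>\<^sup>2 / 24"
  have \<alpha>: "\<alpha> > 0" using \<epsilon> by (simp add: \<alpha>_def)
  have "(\<lambda>m. K * (real m * exp (- (\<alpha> * real m)))) \<longlonglongrightarrow> K * 0"
    by (intro tendsto_mult_left) (use \<alpha> in real_asymp)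
  then have "\<forall>\<^sub>F m in sequentially. K * (real m * exp (- (\<alpha> * real m))) < \<eta>"
    using \<eta> by (intro order_tendstoD) auto
  then show ?thesis
    using eventually_ge_at_top[of 3]
  proof eventually_elim
    case (elim m)
    have "\<forall>\<^sub>F n in sequentially. w / 2 < sqrt (real n) * mass n"
      using mass_limit unfolding w_def[symmetric] by (rule order_tendstoD) (use w in simp)
    then show ?case
      using eventually_ge_at_top[of m]
    proof eventually_elim
      case (elim n)
      have n: "n \<ge> 1" using elim \<open>3 \<le> m\<close> by simp
      have "0 < sqrt (real n) * mass n" using elim(1) w by linarith
      then have mp: "0 < mass n" by (rule zero_less_mult_pos) (use n in simp)
      define A where "A = {S. S \<subseteq> {..<2 * n} \<and> card S = a n}"
      have finA: "finite A" unfolding A_def by simp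
      define B where "B = (\<lambda>i S. (\<exists>k\<in>{grid_index n (real i / real m)..grid_index n (real (Suc i) / real m)}.
        \<bar>real (card (S \<inter> {grid_index n (real i / real m)..<k})) - (\<Sum>j=grid_index n (real i / real m)..<k. p n j)\<bar> \<ge> \<epsilon> * sqrt (real n) / 4))"
      have union: "of_bool (\<not> steady n m \<epsilon> S) \<le> (\<Sum>i<m. of_bool (B i S) :: real)" for S
      proof (cases "steady n m \<epsilon> S")
        case False
        then obtain i where i: "i < m" "B i S" unfolding steady_def B_def by (auto simp: not_less)
        have "of_bool (B i S) \<le> (\<Sum>i<m. of_bool (B i S) :: real)"
          using i by (intro member_le_sum) auto
        then show ?thesis using False i by simp
      qed (simp add: sum_nonneg)
      have nonneg: "0 \<le> bern (p n) {..<2 * n} S" if "S \<in> A" for S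
        using that p_bounds by (intro bern_nonneg) (auto simp: A_def)
      have "(\<Sum>S\<in>A. bern (p n) {..<2 * n} S * of_bool (\<not> steady n m \<epsilon> S))
          \<le> (\<Sum>S\<in>A. bern (p n) {..<2 * n} S * (\<Sum>i<m. of_bool (B i S)))"
        by (intro sum_mono mult_left_mono union nonneg)
      also have "\<dots> = (\<Sum>i<m. \<Sum>S\<in>A. bern (p n) {..<2 * n} S * of_bool (B i S))"
        unfolding sum_distrib_left by (rule sum.swap)
      also have "\<dots> \<le> (\<Sum>i<m. 2 * exp (- (\<alpha> * real m)) * (sqrt (32 / v0) / sqrt (real n)))"
        unfolding A_def B_def \<alpha>_def
        by (intro sum_mono block_oscillation_le[OF elim(2) \<open>3 \<le> m\<close> _ \<epsilon> v0 refl refl]) auto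
      also have "\<dots> = real m * (2 * exp (- (\<alpha> * real m)) * (sqrt (32 / v0) / sqrt (real n)))" by simp
      finally have bad: "(\<Sum>S\<in>A. bern (p n) {..<2 * n} S * of_bool (\<not> steady n m \<epsilon> S))
          \<le> real m * (2 * exp (- (\<alpha> * real m)) * (sqrt (32 / v0) / sqrt (real n)))" .
      have "(\<integral>\<pi>. of_bool (\<not> steady n m \<epsilon> (down_steps \<pi>)) \<partial>law n)
          = (\<Sum>S\<in>A. bern (p n) {..<2 * n} S * of_bool (\<not> steady n m \<epsilon> S)) / mass n"
        unfolding integral_law[OF n, of "\<lambda>S. of_bool (\<not> steady n m \<epsilon> S) :: real"] A_def
        by (simp add: divide_inverse mult.commute)
      also have "\<dots> \<le> real m * (2 * exp (- (\<alpha> * real m)) * (sqrt (32 / v0) / sqrt (real n))) / mass n"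
        using bad mp by (intro divide_right_mono) auto
      also have "\<dots> = 2 * real m * exp (- (\<alpha> * real m)) * sqrt (32 / v0) / (sqrt (real n) * mass n)"
        by simp
      also have "\<dots> \<le> 2 * real m * exp (- (\<alpha> * real m)) * sqrt (32 / v0) / (w / 2)"
        using elim(1) w v0 n mp by (intro divide_left_mono mult_nonneg_nonneg mult_pos_pos) auto
      also have "\<dots> = K * (real m * exp (- (\<alpha> * real m)))" by (simp add: K_def)
      also have "\<dots> \<le> \<eta>" using \<open>K * (real m * exp (- (\<alpha> * real m))) < \<eta>\<close> by simp
      finally show ?case .
    qed
  qed
qed

section \<open>Comparison of paths with their interpolations\<close>

lemma continuous_on_fluctuation_scale: "continuous_on {0..1} (fluctuation_scale \<rho> c)"
  unfolding fluctuation_scale_def using shape_denominator_pos[OF c, of _ \<rho>]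
  by (intro continuous_intros) force+

lemma scale_nonzero: "t \<in> {0..1} \<Longrightarrow> fluctuation_scale \<rho> c t \<noteq> 0"
  using fluctuation_scale_nonzero \<rho> c by blast

lemma continuous_on_fluctuation: "continuous_on {0..1} (fluctuation \<rho> c n (boundary_path \<pi>))"
proof -
  have shape: "continuous_on {0..1} (limit_shape \<rho> c)"
    unfolding limit_shape_def using shape_denominator_pos[OF c, of _ \<rho>] c
    by (intro continuous_intros) force+
  have "continuous_on {0..1} (\<lambda>t. linear_interpolation (boundary_path \<pi>) (2 * real n * t))"
    by (rule continuous_on_compose2[OF continuous_on_linear_interpolation])
       (auto intro!: continuous_intros)
  then show ?thesis unfolding fluctuation_def by (intro continuous_intros shape)
qed

text \<open>Interpolation is applied before dividing by the scale, so that only the unscaled process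
  has to be controlled uniformly.\<close>

definition basis :: "nat \<Rightarrow> nat \<Rightarrow> real \<Rightarrow> real" where
  "basis m k t = fluctuation_scale \<rho> c (real k / real m) * hat m k t / fluctuation_scale \<rho> c t"

lemma continuous_on_basis: "continuous_on {0..1} (basis m k)"
  unfolding basis_def[abs_def]
  by (intro continuous_intros continuous_on_hat continuous_on_fluctuation_scale) (use scale_nonzero in auto)

lemma basis_sum:
  assumes m: "m > 0" and y: "\<And>k. k \<le> m \<Longrightarrow> y k = x (real k / real m) / fluctuation_scale \<rho> c (real k / real m)"
  shows "(\<Sum>k\<le>m. y k * basis m k t) = interp m x t / fluctuation_scale \<rho> c t"
  unfolding interp_def sum_divide_distrib
proof (intro sum.cong refl)
  fix k assume "k \<in> {..m}"
  then have "real k / real m \<in> {0..1}" using m by auto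
  then show "y k * basis m k t = x (real k / real m) * hat m k t / fluctuation_scale \<rho> c t"
    using y[of k] \<open>k \<in> {..m}\<close> scale_nonzero by (simp add: basis_def)
qed

lemma scale_bounded_below: "\<exists>R>0. \<forall>t\<in>{0..1}. 1 / \<bar>fluctuation_scale \<rho> c t\<bar> \<le> R"
proof -
  have "continuous_on {0..1} (\<lambda>t. 1 / \<bar>fluctuation_scale \<rho> c t\<bar>)"
    by (intro continuous_intros continuous_on_fluctuation_scale) (use scale_nonzero in auto)
  then have "\<exists>t0\<in>{0..1}. \<forall>t\<in>{0..1}. 1 / \<bar>fluctuation_scale \<rho> c t\<bar> \<le> 1 / \<bar>fluctuation_scale \<rho> c t0\<bar>"
    by (intro continuous_attains_sup) auto
  then obtain t0 where "t0 \<in> {0..1}" "\<forall>t\<in>{0..1}. 1 / \<bar>fluctuation_scale \<rho> c t\<bar> \<le> 1 / \<bar>fluctuation_scale \<rho> c t0\<bar>" by blast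
  then show ?thesis using scale_nonzero by (intro exI[of _ "1 / \<bar>fluctuation_scale \<rho> c t0\<bar>"]) auto
qed

lemma scaled_interp_dist:
  assumes m: "m > 0" and x: "continuous_on {0..1} x" and R: "\<And>t. t \<in> {0..1} \<Longrightarrow> 1 / \<bar>fluctuation_scale \<rho> c t\<bar> \<le> R"
    and y: "\<And>k. k \<le> m \<Longrightarrow> y k = x (real k / real m) / fluctuation_scale \<rho> c (real k / real m)"
    and e: "\<And>t. t \<in> {0..1} \<Longrightarrow> \<bar>x t - interp m x t\<bar> \<le> \<epsilon>"
  shows "dist (to_cadlag (\<lambda>t. x t / fluctuation_scale \<rho> c t)) (to_cadlag (\<lambda>t. \<Sum>k\<le>m. y k * basis m k t)) \<le> R * \<epsilon>"
proof (rule dist_to_cadlag_le)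
  show "continuous_on {0..1} (\<lambda>t. x t / fluctuation_scale \<rho> c t)"
    by (intro continuous_intros x continuous_on_fluctuation_scale) (use scale_nonzero in auto)
  show "continuous_on {0..1} (\<lambda>t. \<Sum>k\<le>m. y k * basis m k t)"
    by (intro continuous_intros continuous_on_basis)
  fix t :: real assume t: "t \<in> {0..1}"
  have sum: "(\<Sum>k\<le>m. y k * basis m k t) = interp m x t / fluctuation_scale \<rho> c t"
    by (rule basis_sum[OF m]) (rule y)
  have "x t / fluctuation_scale \<rho> c t - (\<Sum>k\<le>m. y k * basis m k t) = (1 / fluctuation_scale \<rho> c t) * (x t - interp m x t)"
    unfolding sum by (simp add: diff_divide_distrib right_diff_distrib)
  then have "\<bar>x t / fluctuation_scale \<rho> c t - (\<Sum>k\<le>m. y k * basis m k t)\<bar> = 1 / \<bar>fluctuation_scale \<rho> c t\<bar> * \<bar>x t - interp m x t\<bar>"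
    by (simp add: abs_mult)
  also have "\<dots> \<le> R * \<epsilon>" using R[OF t] e[OF t] by (intro mult_mono) (auto intro: order_trans[OF _ R[OF t]])
  finally show "\<bar>x t / fluctuation_scale \<rho> c t - (\<Sum>k\<le>m. y k * basis m k t)\<bar> \<le> R * \<epsilon>" .
qed

text \<open>Three errors of \<open>e / 3\<close>: the limit process against its interpolation, small
  by the choice of \<open>m\<close>; the finite-dimensional convergence for this \<open>m\<close>;
  and the discrete path against its interpolation, small outside the unsteady event.\<close>

lemma lipschitz_expectation_tendsto:
  fixes F :: "cadlag \<Rightarrow> real"
  assumes B: "\<And>x. \<bar>F x\<bar> \<le> B" and L0: "\<And>x y. \<bar>F x - F y\<bar> \<le> L * dist x y" and F: "continuous_on UNIV F"
  shows "(\<lambda>n. \<integral>\<pi>. F (rescaled_path \<rho> c n \<pi>) \<partial>law n) \<longlonglongrightarrow> (\<integral>\<omega>. F (to_cadlag (\<lambda>t. OU_path c t \<omega>)) \<partial>gauss_space)"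
proof (rule tendstoI)
  fix e :: real assume e: "e > 0"
  interpret N: prob_space gauss_space by (rule prob_space_gauss_space)
  have L: "\<bar>F x - F y\<bar> \<le> \<bar>L\<bar> * dist x y" for x y
    using L0[of x y] by (rule order_trans) (intro mult_right_mono, auto)
  have B0: "0 \<le> B" using B[of undefined] by linarith
  obtain R where R: "R > 0" "\<And>t. t \<in> {0..1} \<Longrightarrow> 1 / \<bar>fluctuation_scale \<rho> c t\<bar> \<le> R"
    using scale_bounded_below by blast
  have FM[measurable]: "F \<in> borel_measurable borel" using F by (rule borel_measurable_continuous_onI)
  \<comment> \<open>The last third is split again: \<open>\<epsilon>\<close> bounds the steady part
    by \<open>e / 6\<close>, and \<open>\<eta>\<close> is chosen so that the contribution
    \<open>2 * B * \<eta>\<close> of the unsteady event is at most \<open>e / 6\<close>.\<close>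
  define \<epsilon> where "\<epsilon> = e / (6 * (\<bar>L\<bar> * R + 1))"
  have LR: "0 \<le> \<bar>L\<bar> * R" using R by simp
  have \<epsilon>: "\<epsilon> > 0" unfolding \<epsilon>_def using e LR by (intro divide_pos_pos) auto
  have \<epsilon>LR: "\<bar>L\<bar> * (R * \<epsilon>) \<le> e / 6"
  proof -
    have "\<bar>L\<bar> * (R * \<epsilon>) \<le> (\<bar>L\<bar> * R + 1) * \<epsilon>" using \<epsilon> by (simp add: algebra_simps)
    also have "\<dots> = e / 6" unfolding \<epsilon>_def using LR by (simp add: field_simps)
    finally show ?thesis .
  qed
  define \<eta> where "\<eta> = e / (12 * (B + 1))"
  have \<eta>: "\<eta> > 0" unfolding \<eta>_def using e B0 by (intro divide_pos_pos) auto
  have \<eta>B: "2 * B * \<eta> \<le> e / 6"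
  proof -
    have "2 * B * \<eta> \<le> 2 * (B + 1) * \<eta>" using \<eta> by (intro mult_right_mono) auto
    also have "\<dots> = e / 6" unfolding \<eta>_def using B0 by (simp add: field_simps)
    finally show ?thesis .
  qed
  define \<Phi> where "\<Phi> = (\<lambda>m y. to_cadlag (\<lambda>t. \<Sum>k\<le>m. y k * basis m k t))"
  define Y where "Y = (\<lambda>m k \<omega>. OU_path c (real k / real m) \<omega>)"
  define X where "X = (\<lambda>m n k \<pi>. fluctuation \<rho> c n (boundary_path \<pi>) (real k / real m) / fluctuation_scale \<rho> c (real k / real m))"
  have \<Phi>Y[measurable]: "(\<lambda>\<omega>. \<Phi> m (\<lambda>k. Y m k \<omega>)) \<in> borel_measurable gauss_space" for m
    unfolding \<Phi>_def Y_def
    by (intro measurable_to_cadlag_sum[where X = "\<lambda>k. OU_path c (real k / real m)"] measurable_OU_path continuous_on_basis)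
  have pathY[measurable]: "(\<lambda>\<omega>. to_cadlag (\<lambda>t. OU_path c t \<omega>)) \<in> borel_measurable gauss_space"
    by (rule measurable_OU_cadlag[OF c])
  have "(\<lambda>m. \<integral>\<omega>. F (\<Phi> m (\<lambda>k. Y m k \<omega>)) \<partial>gauss_space) \<longlonglongrightarrow> (\<integral>\<omega>. F (to_cadlag (\<lambda>t. OU_path c t \<omega>)) \<partial>gauss_space)"
  proof (rule integral_dominated_convergence[where w = "\<lambda>_. B"])
    show "AE \<omega> in gauss_space. (\<lambda>m. F (\<Phi> m (\<lambda>k. Y m k \<omega>))) \<longlonglongrightarrow> F (to_cadlag (\<lambda>t. OU_path c t \<omega>))"
    proof (rule AE_I2)
      fix \<omega>
      \<comment> \<open>The limit path is multiplied by the scale first, so that it is interpolated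
        in the same way as the discrete process.\<close>
      define x where "x = (\<lambda>t. OU_path c t \<omega> * fluctuation_scale \<rho> c t)"
      have x: "continuous_on {0..1} x"
        unfolding x_def by (intro continuous_intros continuous_on_OU_path[OF c] continuous_on_fluctuation_scale)
      have unscale: "to_cadlag (\<lambda>t. x t / fluctuation_scale \<rho> c t) = to_cadlag (\<lambda>t. OU_path c t \<omega>)"
        unfolding to_cadlag_def by (intro arg_cong[where f = Cadlag] restrict_ext) (simp add: x_def scale_nonzero)
      have "(\<lambda>m. \<Phi> m (\<lambda>k. Y m k \<omega>)) \<longlonglongrightarrow> to_cadlag (\<lambda>t. OU_path c t \<omega>)"
      proof (rule tendstoI)
        fix d :: real assume d: "d > 0"
        have dR: "d / (2 * R) > 0" using d R by simp
        show "\<forall>\<^sub>F m in sequentially. dist (\<Phi> m (\<lambda>k. Y m k \<omega>)) (to_cadlag (\<lambda>t. OU_path c t \<omega>)) < d"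
          using interp_uniform[OF x dR] eventually_gt_at_top[of 0]
        proof eventually_elim
          case (elim m)
          have "dist (to_cadlag (\<lambda>t. x t / fluctuation_scale \<rho> c t)) (to_cadlag (\<lambda>t. \<Sum>k\<le>m. Y m k \<omega> * basis m k t)) \<le> R * (d / (2 * R))"
          proof (rule scaled_interp_dist[OF elim(2) x R(2)])
            fix k assume "k \<le> m"
            then have "real k / real m \<in> {0..1}" using elim(2) by auto
            then show "Y m k \<omega> = x (real k / real m) / fluctuation_scale \<rho> c (real k / real m)"
              by (simp add: Y_def x_def scale_nonzero)
          qed (use elim(1) in blast)+
          then show ?case using d R unfolding unscale by (simp add: \<Phi>_def dist_commute)
        qed
      qed
      then show "(\<lambda>m. F (\<Phi> m (\<lambda>k. Y m k \<omega>))) \<longlonglongrightarrow> F (to_cadlag (\<lambda>t. OU_path c t \<omega>))"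
        by (rule continuous_on_tendsto_compose[OF F]) auto
    qed
  qed (use B in auto)
  then have E1: "\<forall>\<^sub>F m in sequentially. dist (\<integral>\<omega>. F (\<Phi> m (\<lambda>k. Y m k \<omega>)) \<partial>gauss_space) (\<integral>\<omega>. F (to_cadlag (\<lambda>t. OU_path c t \<omega>)) \<partial>gauss_space) < e / 3"
    by (rule tendstoD) (use e in simp)
  obtain m where m: "m \<ge> 1"
    "dist (\<integral>\<omega>. F (\<Phi> m (\<lambda>k. Y m k \<omega>)) \<partial>gauss_space) (\<integral>\<omega>. F (to_cadlag (\<lambda>t. OU_path c t \<omega>)) \<partial>gauss_space) < e / 3"
    "\<forall>\<^sub>F n in sequentially. (\<integral>\<pi>. of_bool (\<not> steady n m \<epsilon> (down_steps \<pi>)) \<partial>law n) \<le> \<eta>"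
    using eventually_happens[OF eventually_conj[OF eventually_ge_at_top[of 1] eventually_conj[OF E1 unsteady_tendsto[OF \<epsilon> \<eta>]]]]
    by auto
  have grid: "real k / real m \<in> {0..1}" if "k \<in> {..m}" for k using that m by auto
  obtain C where C: "C \<ge> 0" "\<And>v w. dist (\<Phi> m v) (\<Phi> m w) \<le> (\<Sum>k\<le>m. C * \<bar>v k - w k\<bar>)"
    using to_cadlag_sum_lipschitz[of "basis m" m, OF continuous_on_basis] unfolding \<Phi>_def by blast
  have "(\<lambda>n. \<integral>\<pi>. F (\<Phi> m (\<lambda>k. X m n k \<pi>)) \<partial>law n) \<longlonglongrightarrow> (\<integral>\<omega>. F (\<Phi> m (\<lambda>k. Y m k \<omega>)) \<partial>gauss_space)"
  proof (rule expectation_lipschitz_tendsto[where I = "{..m}" and g = "\<lambda>y. F (\<Phi> m y)" and L = "\<bar>L\<bar> * C"])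
    show "(\<lambda>n. \<integral>\<pi>. iexp (\<Sum>k\<in>{..m}. u k * X m n k \<pi>) \<partial>law n) \<longlonglongrightarrow> (\<integral>\<omega>. iexp (\<Sum>k\<in>{..m}. u k * Y m k \<omega>) \<partial>gauss_space)" for u
    proof -
      have "(\<integral>\<omega>. iexp (\<Sum>k\<in>{..m}. u k * Y m k \<omega>) \<partial>gauss_space) = complex_of_real (exp (- (\<Sum>i\<in>{..m}. \<Sum>l\<in>{..m}.
          u i * u l * OU_cov c (real i / real m) (real l / real m)) / 2))"
        unfolding Y_def by (rule char_OU_path[OF c finite_atMost]) (rule grid)
      moreover have "(\<lambda>n. \<integral>\<pi>. iexp (\<Sum>k\<in>{..m}. u k * X m n k \<pi>) \<partial>law n) \<longlonglongrightarrow> complex_of_real (exp (- (\<Sum>i\<in>{..m}. \<Sum>l\<in>{..m}.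
          u i * u l * OU_cov c (real i / real m) (real l / real m)) / 2))"
        unfolding X_def by (rule char_fluctuation_tendsto[OF finite_atMost]) (rule grid)
      ultimately show ?thesis by (simp only:)
    qed
    show "(\<lambda>y. F (\<Phi> m y)) \<in> borel_measurable (lborel_on {..m})"
    proof (rule measurable_compose[OF _ FM])
      have "(\<lambda>y. y k) \<in> borel_measurable (lborel_on {..m})" if "k \<le> m" for k
        using measurable_component_singleton[of k "{..m}" "\<lambda>_. lborel"] that by simp
      then show "\<Phi> m \<in> borel_measurable (lborel_on {..m})"
        unfolding \<Phi>_def by (intro measurable_to_cadlag_sum[where X = "\<lambda>k y. y k"] continuous_on_basis)
    qed
    show "\<bar>F (\<Phi> m x) - F (\<Phi> m y)\<bar> \<le> (\<Sum>k\<in>{..m}. \<bar>L\<bar> * C * \<bar>x k - y k\<bar>)" for x y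
    proof -
      have "\<bar>F (\<Phi> m x) - F (\<Phi> m y)\<bar> \<le> \<bar>L\<bar> * (\<Sum>k\<le>m. C * \<bar>x k - y k\<bar>)"
        using L[of "\<Phi> m x" "\<Phi> m y"] mult_left_mono[OF C(2)[of x y], of "\<bar>L\<bar>"] by simp
      then show ?thesis by (simp add: sum_distrib_left mult.assoc)
    qed
    show "Y m k \<in> borel_measurable gauss_space" for k unfolding Y_def by (rule measurable_OU_path)
  qed (use B measurable_law prob_space_law prob_space_gauss_space in \<open>auto\<close>)
  then have E2: "\<forall>\<^sub>F n in sequentially. dist (\<integral>\<pi>. F (\<Phi> m (\<lambda>k. X m n k \<pi>)) \<partial>law n) (\<integral>\<omega>. F (\<Phi> m (\<lambda>k. Y m k \<omega>)) \<partial>gauss_space) < e / 3"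
    by (rule tendstoD) (use e in simp)
  have E3: "\<forall>\<^sub>F n in sequentially. (2 + 2 * \<bar>c\<bar>) / sqrt (real n) < \<epsilon> / 4"
    using inverse_sqrt_tendsto by (rule order_tendstoD) (use \<epsilon> in simp)
  show "\<forall>\<^sub>F n in sequentially. dist (\<integral>\<pi>. F (rescaled_path \<rho> c n \<pi>) \<partial>law n) (\<integral>\<omega>. F (to_cadlag (\<lambda>t. OU_path c t \<omega>)) \<partial>gauss_space) < e"
    using E2 E3 m(3) eventually_ge_at_top[of 1]
  proof eventually_elim
    case (elim n)
    interpret K: prob_space "law n" by (rule prob_space_law)
    have pt: "\<bar>F (rescaled_path \<rho> c n \<pi>) - F (\<Phi> m (\<lambda>k. X m n k \<pi>))\<bar>
        \<le> \<bar>L\<bar> * (R * \<epsilon>) + 2 * B * of_bool (\<not> steady n m \<epsilon> (down_steps \<pi>))" for \<pi>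
    proof (cases "steady n m \<epsilon> (down_steps \<pi>)")
      case True
      have "dist (rescaled_path \<rho> c n \<pi>) (\<Phi> m (\<lambda>k. X m n k \<pi>)) \<le> R * \<epsilon>"
        unfolding rescaled_path_def \<Phi>_def
        by (rule scaled_interp_dist[OF _ continuous_on_fluctuation R(2)])
           (use m(1) elim True steady_interp in \<open>auto simp: X_def\<close>)
      then have "\<bar>L\<bar> * dist (rescaled_path \<rho> c n \<pi>) (\<Phi> m (\<lambda>k. X m n k \<pi>)) \<le> \<bar>L\<bar> * (R * \<epsilon>)"
        by (rule mult_left_mono) simp
      then show ?thesis using L[of "rescaled_path \<rho> c n \<pi>" "\<Phi> m (\<lambda>k. X m n k \<pi>)"] True by simp
    next
      case False
      have "0 \<le> \<bar>L\<bar> * (R * \<epsilon>)" using R \<epsilon> by simp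
      then show ?thesis
        using B[of "rescaled_path \<rho> c n \<pi>"] B[of "\<Phi> m (\<lambda>k. X m n k \<pi>)"] False by simp
    qed
    have bounded_int: "integrable (law n) f" if "\<And>\<pi>. \<bar>f \<pi>\<bar> \<le> D" for f :: "nat list \<Rightarrow> real" and D
      by (rule K.integrable_const_bound[where B = D]) (use that measurable_law in auto)
    have int: "integrable (law n) (\<lambda>\<pi>. F (rescaled_path \<rho> c n \<pi>))" "integrable (law n) (\<lambda>\<pi>. F (\<Phi> m (\<lambda>k. X m n k \<pi>)))"
      "integrable (law n) (\<lambda>\<pi>. of_bool (\<not> steady n m \<epsilon> (down_steps \<pi>)) :: real)"
      using bounded_int[OF B] bounded_int[of _ 1] by auto
    have "\<bar>(\<integral>\<pi>. F (rescaled_path \<rho> c n \<pi>) \<partial>law n) - (\<integral>\<pi>. F (\<Phi> m (\<lambda>k. X m n k \<pi>)) \<partial>law n)\<bar>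
        = \<bar>\<integral>\<pi>. F (rescaled_path \<rho> c n \<pi>) - F (\<Phi> m (\<lambda>k. X m n k \<pi>)) \<partial>law n\<bar>"
      using int by simp
    also have "\<dots> \<le> (\<integral>\<pi>. \<bar>L\<bar> * (R * \<epsilon>) + 2 * B * of_bool (\<not> steady n m \<epsilon> (down_steps \<pi>)) \<partial>law n)"
      using int pt by (intro abs_integral_le) auto
    also have "\<dots> = \<bar>L\<bar> * (R * \<epsilon>) + 2 * B * (\<integral>\<pi>. of_bool (\<not> steady n m \<epsilon> (down_steps \<pi>)) \<partial>law n)"
      using int by (simp add: K.prob_space)
    also have "\<dots> \<le> e / 6 + 2 * B * \<eta>"
      using \<epsilon>LR elim(3) B0 by (intro add_mono mult_left_mono) auto
    also have "\<dots> \<le> e / 3" using \<eta>B by simp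
    finally show ?case using elim(1) m(2) unfolding dist_real_def by linarith
  qed
qed

end

theorem theorem2:
  fixes \<rho> c :: real and a b :: "nat \<Rightarrow> nat"
  assumes "0 < \<rho>" and "\<rho> < 1" and "c \<noteq> 0"
    and "\<And>n. n \<ge> 1 \<Longrightarrow> a n > 0"
    and "\<And>n. n \<ge> 1 \<Longrightarrow> b n > 0"
    and "\<And>n. n \<ge> 1 \<Longrightarrow> a n + b n = 2 * n"
    and "(\<lambda>n. real (a n) / (2 * real n) - \<rho>) \<in> o(\<lambda>n. real n powr (- 1 / 2))"
  shows "\<exists>\<nu>. OU_bridge_law c \<nu> \<and>
    weakly_converges
      (\<lambda>n. distr (q_volume (exp (- c / real n)) (a n) (b n)) borel (rescaled_path \<rho> c n)) \<nu>"
proof -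
  \<comment> \<open>The little-o condition is restated for the number of down-steps, which deviates
    from \<open>2 * n * \<rho>\<close> by o(sqrt n).\<close>
  have "(\<lambda>n. (real (a n) / (2 * real n) - \<rho>) / real n powr (- 1 / 2)) \<longlonglongrightarrow> 0"
    using assms(7) by (rule smalloD_tendsto)
  then have "(\<lambda>n. 2 * ((real (a n) / (2 * real n) - \<rho>) / real n powr (- 1 / 2))) \<longlonglongrightarrow> 2 * 0"
    by (rule tendsto_mult_left)
  then have "(\<lambda>n. 2 * ((real (a n) / (2 * real n) - \<rho>) / real n powr (- 1 / 2))) \<longlonglongrightarrow> 0" by simp
  then have drift: "(\<lambda>n. (real (a n) - 2 * real n * \<rho>) / sqrt (real n)) \<longlonglongrightarrow> 0"
  proof (rule Lim_transform_eventually)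
    show "\<forall>\<^sub>F n in sequentially. 2 * ((real (a n) / (2 * real n) - \<rho>) / real n powr (- 1 / 2)) = (real (a n) - 2 * real n * \<rho>) / sqrt (real n)"
      using eventually_ge_at_top[of 1]
    proof eventually_elim
      case (elim n)
      have r: "sqrt (real n) > 0" "real n = sqrt (real n) * sqrt (real n)" using elim by auto
      have "real n powr (- 1 / 2) = 1 / sqrt (real n)"
        by (simp add: powr_minus_divide powr_half_sqrt)
      then have "2 * ((real (a n) / (2 * real n) - \<rho>) / real n powr (- 1 / 2)) = (real (a n) - 2 * real n * \<rho>) / real n * sqrt (real n)"
        using elim by (simp add: field_simps)
      also have "\<dots> = (real (a n) - 2 * real n * \<rho>) / sqrt (real n)"
        using r by (metis mult.commute nonzero_mult_div_cancel_left divide_divide_eq_left times_divide_eq_left order_less_irrefl)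
      finally show ?case .
    qed
  qed
  interpret box_sequence \<rho> c a b
    by unfold_locales (use assms drift in auto)
  have path: "rescaled_path \<rho> c n \<in> law n \<rightarrow>\<^sub>M borel" for n by (rule measurable_law)
  have "weakly_converges (\<lambda>n. distr (law n) borel (rescaled_path \<rho> c n)) (OU_law c)"
  proof (rule weakly_converges_lipschitz)
    fix F :: "cadlag \<Rightarrow> real" and B L
    assume F: "\<And>x. \<bar>F x\<bar> \<le> B" "\<And>x y. \<bar>F x - F y\<bar> \<le> L * dist x y" "continuous_on UNIV F"
    have FM: "F \<in> borel_measurable borel" using F(3) by (rule borel_measurable_continuous_onI)
    have "(\<integral>x. F x \<partial>distr (law n) borel (rescaled_path \<rho> c n)) = (\<integral>\<pi>. F (rescaled_path \<rho> c n \<pi>) \<partial>law n)" for n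
      by (rule integral_distr[OF path FM])
    moreover have "(\<integral>x. F x \<partial>OU_law c) = (\<integral>\<omega>. F (to_cadlag (\<lambda>t. OU_path c t \<omega>)) \<partial>gauss_space)"
      unfolding OU_law_def by (rule integral_distr[OF measurable_OU_cadlag[OF assms(3)] FM])
    ultimately show "(\<lambda>n. \<integral>x. F x \<partial>distr (law n) borel (rescaled_path \<rho> c n)) \<longlonglongrightarrow> (\<integral>x. F x \<partial>OU_law c)"
      using lipschitz_expectation_tendsto[OF F] by simp
  next
    show "prob_space (distr (law n) borel (rescaled_path \<rho> c n))" for n
      by (rule prob_space.prob_space_distr[OF prob_space_law path])
  qed (use prob_space_OU_law[OF assms(3)] in \<open>auto simp: sets_OU_law\<close>)
  then show ?thesis
    unfolding law_def using OU_bridge_law_OU_law[OF assms(3)] by blast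
qed

end
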